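(* Let $0<\alpha<2$, let $\Omega$ be the open unit disk in $\mathbb{R}^2$, let $k_1,k_2>0$ and $K(x)=\begin{bmatrix}k_1&0\\0&k_2\end{bmatrix}$, and let $f\in L^2_{\alpha/2}(\Omega)$. Then there exists a unique $\widetilde u(x)=\omega^{\alpha/2}u(x)$, with $u$ of the form $$u(x)=\sum_{l\ge1,\;n\ge0,\;\mu\in\{1,-1\}}u_{l,n,\mu}\,V_{l,\mu}(x)\,P_n^{(\frac{\alpha}{2},\,l)}(2r^2-1)+\sum_{n\ge0}\frac{u_{0,n,1}}{2}\,V_{0,1}(x)\,P_n^{(\frac{\alpha}{2},\,0)}(2r^2-1),\qquad u_{l,n,\mu}\in\mathbb{R},$$ satisfying $$\mathcal{L}(\widetilde u)(x):=-\nabla\cdot(-\Delta)^{\frac{\alpha-2}{2}}K(x)\nabla\widetilde u(x)=f(x),\quad x\in\Omega,\qquad\text{subject to } \widetilde u=0\ \text{on }\partial\Omega,$$ where the equality $\mathcal{L}(\widetilde u)=f$ means equality of the coefficients of all the basis functions $V_{l,\mu}(x)P_n^{(\frac{\alpha}{2},\,l)}(2r^2-1)$.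
   Context: $(r,\varphi)$ are polar coordinates of $x\in\mathbb{R}^2$. $V_{l,1}(x)=r^l\cos(l\varphi)$ ($l\ge0$), $V_{l,-1}(x)=r^l\sin(l\varphi)$ ($l\ge1$). $P_n^{(a,b)}$ are the standard Jacobi polynomials. $\omega^{\gamma}=(1-r^2)^{\gamma}$ on $\Omega$, and $\widetilde u=\omega^{\alpha/2}u$ is extended by $0$ outside $\Omega$; the homogeneous boundary condition is encoded in the form $\widetilde u=\omega^{\alpha/2}u$. $L^2_{\alpha/2}(\Omega)$ is the weighted space with norm $\|g\|^2=\int_\Omega(1-r^2)^{\alpha/2}g^2\,dx$. The functions $V_{l,\mu}(x)P_n^{(\alpha/2,\,l)}(2r^2-1)$, with $l,n\ge0$, $\mu\in\{1,-1\}$, $(l,\mu)\ne(0,-1)$, form an orthogonal basis of it; the coefficients of $f$ are those of its expansion in this basis. $(-\Delta)^{\frac{\alpha-2}{2}}$ is the Riesz potential operator of order $2-\alpha$ on $\mathbb{R}^2$: $(-\Delta)^{\frac{\alpha-2}{2}}g(x)=\frac{1}{\gamma_2(2-\alpha)}\int_{\mathbb{R}^2}\frac{g(x-y)}{|y|^{\alpha}}\,dy$, $\gamma_2(2-\alpha)=2^{2-\alpha}\pi\,\Gamma(1-\frac{\alpha}{2})/\Gamma(\frac{\alpha}{2})$, applied componentwise to vector fields (gradients in $\Omega$ extended by zero outside $\Omega$). The expansion of $\mathcal{L}(\widetilde u)$ is obtained by applying $\mathcal{L}$ term by term to the expansion of $\widetilde u=\omega^{\alpha/2}u$: for each basis function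 $\phi$, the restriction of $\mathcal{L}(\omega^{\alpha/2}\phi)$ to $\Omega$ is a finite linear combination of basis functions, and each basis function receives contributions from only finitely many terms, so every coefficient of $\mathcal{L}(\widetilde u)$ is a finite linear combination of the $u_{l,n,\mu}$. *)

theory Defs
  imports "HOL-Analysis.Analysis"
begin

abbreviation unit_disk :: "(real^2) set" where
  "unit_disk \<equiv> ball 0 1"

text \<open>The Jacobi polynomial \<open>P\<^sub>n\<^sup>(\<^sup>a\<^sup>,\<^sup>b\<^sup>)\<close> in the
  standard (Szego) normalization, for which the value at 1 is \<open>(n + a) gchoose n\<close>.\<close>

definition jacobi_poly :: "nat \<Rightarrow> real \<Rightarrow> real \<Rightarrow> real \<Rightarrow> real" where
  "jacobi_poly n a b t =
     (\<Sum>s\<le>n. ((real n + a) gchoose (n - s)) * ((real n + b) gchoose s)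
            * ((t - 1) / 2) ^ s * ((t + 1) / 2) ^ (n - s))"

definition polar_angle :: "real^2 \<Rightarrow> real" where
  "polar_angle x = Arg (Complex (x$1) (x$2))"

definition solid_harmonic :: "nat \<Rightarrow> int \<Rightarrow> real^2 \<Rightarrow> real" where
  "solid_harmonic l \<mu> x =
     (if \<mu> = 1 then norm x ^ l * cos (real l * polar_angle x)
      else norm x ^ l * sin (real l * polar_angle x))"

text \<open>Indices are triples \<open>(l, n, \<mu>)\<close>.\<close>

type_synonym index = "nat \<times> nat \<times> int"

definition basis_index :: "index set" where
  "basis_index = {(l, n, \<mu>). \<mu> \<in> {1, -1} \<and> (l, \<mu>) \<noteq> (0, -1)}"

definition basis_fun :: "real \<Rightarrow> index \<Rightarrow> real^2 \<Rightarrow> real" where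
  "basis_fun \<alpha> = (\<lambda>(l, n, \<mu>) x.
     solid_harmonic l \<mu> x * jacobi_poly n (\<alpha> / 2) (real l) (2 * (norm x)\<^sup>2 - 1))"

definition weight :: "real \<Rightarrow> real^2 \<Rightarrow> real" where
  "weight \<gamma> x = (1 - (norm x)\<^sup>2) powr \<gamma>"

text \<open>The space \<open>L\<^sup>2\<close> on the disk with weight \<open>(1 - r\<^sup>2) powr (\<alpha> / 2)\<close>,
  as a set of functions (not of classes modulo null sets).\<close>

definition weighted_L2 :: "real \<Rightarrow> (real^2 \<Rightarrow> real) set" where
  "weighted_L2 \<alpha> = {g. g \<in> borel_measurable (lebesgue_on unit_disk) \<and>
     integrable (lebesgue_on unit_disk) (\<lambda>x. weight (\<alpha> / 2) x * (g x)\<^sup>2)}"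

definition weighted_inner :: "real \<Rightarrow> (real^2 \<Rightarrow> real) \<Rightarrow> (real^2 \<Rightarrow> real) \<Rightarrow> real" where
  "weighted_inner \<alpha> g h =
     integral\<^sup>L (lebesgue_on unit_disk) (\<lambda>x. weight (\<alpha> / 2) x * (g x * h x))"

text \<open>The coefficient of \<open>g\<close> in its expansion with respect to the orthogonal
  (not normalized) basis \<open>basis_fun \<alpha>\<close>.\<close>

definition basis_coeff :: "real \<Rightarrow> (real^2 \<Rightarrow> real) \<Rightarrow> index \<Rightarrow> real" where
  "basis_coeff \<alpha> g b =
     weighted_inner \<alpha> g (basis_fun \<alpha> b) / weighted_inner \<alpha> (basis_fun \<alpha> b) (basis_fun \<alpha> b)"

definition weighted_ext :: "real \<Rightarrow> (real^2 \<Rightarrow> real) \<Rightarrow> real^2 \<Rightarrow> real" where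
  "weighted_ext \<alpha> u x = (if x \<in> unit_disk then weight (\<alpha> / 2) x * u x else 0)"

definition partial_deriv :: "2 \<Rightarrow> (real^2 \<Rightarrow> real) \<Rightarrow> real^2 \<Rightarrow> real" where
  "partial_deriv i g x = deriv (\<lambda>t. g (x + t *\<^sub>R axis i 1)) 0"

definition disk_gradient :: "(real^2 \<Rightarrow> real) \<Rightarrow> real^2 \<Rightarrow> real^2" where
  "disk_gradient g x = (if x \<in> unit_disk then (\<chi> i. partial_deriv i g x) else 0)"

definition divergence :: "(real^2 \<Rightarrow> real^2) \<Rightarrow> real^2 \<Rightarrow> real" where
  "divergence F x = (\<Sum>i\<in>UNIV. partial_deriv i (\<lambda>y. F y $ i) x)"

text \<open>The operator \<open>(-\<Delta>) powr ((\<alpha> - 2) / 2)\<close> on the plane, that is, the Riesz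
  potential of order \<open>2 - \<alpha>\<close>.\<close>

definition riesz_const :: "real \<Rightarrow> real" where
  "riesz_const \<alpha> = 2 powr (2 - \<alpha>) * pi * Gamma (1 - \<alpha> / 2) / Gamma (\<alpha> / 2)"

definition riesz_potential :: "real \<Rightarrow> (real^2 \<Rightarrow> real) \<Rightarrow> real^2 \<Rightarrow> real" where
  "riesz_potential \<alpha> g x =
     1 / riesz_const \<alpha> * integral\<^sup>L lebesgue (\<lambda>y. g (x - y) / norm y powr \<alpha>)"

definition riesz_potential_vec :: "real \<Rightarrow> (real^2 \<Rightarrow> real^2) \<Rightarrow> real^2 \<Rightarrow> real^2" where
  "riesz_potential_vec \<alpha> F x = (\<chi> i. riesz_potential \<alpha> (\<lambda>y. F y $ i) x)"

definition frac_diffusion ::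
    "real \<Rightarrow> (real^2 \<Rightarrow> real^2^2) \<Rightarrow> (real^2 \<Rightarrow> real) \<Rightarrow> real^2 \<Rightarrow> real" where
  "frac_diffusion \<alpha> K v x =
     - divergence (riesz_potential_vec \<alpha> (\<lambda>y. K y *v disk_gradient v y)) x"

text \<open>The series attached to a family \<open>c\<close> of coefficients has the terms
  \<open>c (l, n, \<mu>) * V\<^sub>l\<^sub>,\<^sub>\<mu> * P\<^sub>n\<close> for \<open>l \<ge> 1\<close>, and half of that for \<open>l = 0\<close>.\<close>

definition series_coeff :: "(index \<Rightarrow> real) \<Rightarrow> index \<Rightarrow> real" where
  "series_coeff c = (\<lambda>(l, n, \<mu>). if l = 0 then c (l, n, \<mu>) / 2 else c (l, n, \<mu>))"

definition series_converges_to :: "real \<Rightarrow> (index \<Rightarrow> real) \<Rightarrow> (real^2 \<Rightarrow> real) \<Rightarrow> bool" where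
  "series_converges_to \<alpha> c u \<longleftrightarrow>
     ((\<lambda>S. let d = (\<lambda>x. u x - (\<Sum>b\<in>S. series_coeff c b * basis_fun \<alpha> b x))
           in weighted_inner \<alpha> d d) \<longlongrightarrow> 0) (finite_subsets_at_top basis_index)"

text \<open>The contribution to the basis function \<open>b\<close> of the operator applied to the
  term with index \<open>b'\<close>.\<close>

definition operator_entry ::
    "real \<Rightarrow> (real^2 \<Rightarrow> real^2^2) \<Rightarrow> index \<Rightarrow> index \<Rightarrow> real" where
  "operator_entry \<alpha> K b b' =
     basis_coeff \<alpha> (frac_diffusion \<alpha> K (weighted_ext \<alpha> (basis_fun \<alpha> b'))) b"

definition contributing ::
    "real \<Rightarrow> (real^2 \<Rightarrow> real^2^2) \<Rightarrow> index \<Rightarrow> index set" where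
  "contributing \<alpha> K b = {b' \<in> basis_index. operator_entry \<alpha> K b b' \<noteq> 0}"

text \<open>Equality of all coefficients in \<open>\<L>(u) = f\<close>, where the operator acts termwise on
  the series attached to \<open>c\<close>. The finiteness condition does not involve \<open>c\<close>; it rules
  out the default value 0 of a sum over an infinite set.\<close>

definition coefficients_agree ::
    "real \<Rightarrow> (real^2 \<Rightarrow> real^2^2) \<Rightarrow> (real^2 \<Rightarrow> real) \<Rightarrow> (index \<Rightarrow> real) \<Rightarrow> bool" where
  "coefficients_agree \<alpha> K f c \<longleftrightarrow>
     (\<forall>b\<in>basis_index. finite (contributing \<alpha> K b) \<and>
        (\<Sum>b'\<in>contributing \<alpha> K b. series_coeff c b' * operator_entry \<alpha> K b b')
          = basis_coeff \<alpha> f b)"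

end

theory Submission imports Defs
begin

text \<open>With \<open>z = x\<^sub>1 + \<i> x\<^sub>2\<close> and \<open>a = \<alpha> / 2\<close>, index the complex basis functions by pairs \<open>(p, q)\<close>
  of angular frequency \<open>p - q\<close> and degree \<open>p + q\<close>. Suitably normalized, the Wirtinger derivatives
  map \<open>(1 - r\<^sup>2) powr a * zern a p q\<close> to \<open>(1 - r\<^sup>2) powr (a - 1)\<close> times \<open>zern (a - 1)\<close> at
  \<open>(p, q + 1)\<close> and \<open>(p + 1, q)\<close>; the Riesz potential acts on these as a scalar (Copson's formula turns
  it into two successive fractional integrals in \<open>r\<^sup>2\<close>, each of which maps Jacobi polynomials to Jacobi
  polynomials); and the outer derivatives lead back to \<open>zern a\<close>. Hence the operator preserves the
  degree \<open>N = p + q\<close>, and up to the diagonal matrix of eigenvalues of the fractional Laplacian it is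
  the Toeplitz matrix with \<open>(k1 + k2) / 2\<close> on the diagonal and \<open>(k1 - k2) / 4\<close> next to it on
  \<open>p = 0, \<dots>, N\<close>. This matrix is positive definite with lower bound \<open>min k1 k2\<close> for every \<open>N\<close>, so
  the coefficients exist, are unique, and are square summable with the weights of the basis.\<close>

section \<open>Jacobi polynomials\<close>

text \<open>The half in front of the \<open>l = 0\<close> terms is what makes the Toeplitz structure
  exact. A real harmonic with \<open>l > 0\<close> combines the complex ones at
  \<open>(p, q)\<close> and \<open>(q, p)\<close>, which coincide for \<open>l = 0\<close>; with the
  half, the unknowns of one degree \<open>N\<close> and one parity unfold to a vector on
  \<open>p = 0, ..., N\<close> that is even or odd under \<open>p -> N - p\<close>, and the middle
  row needs no special treatment. The bound \<open>min k1 k2\<close> is the minimum of the symbol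
  \<open>(k1 + k2) / 2 + (k1 - k2) / 2 * cos t = k1 * cos^2 (t / 2) + k2 * sin^2 (t / 2)\<close>.
  The eigenvalues multiply the Toeplitz matrix from the left only, so they are divided into the
  right-hand side and their growth does not affect solvability. The obstacle is the Riesz potential,
  whose angular Fourier coefficients are hypergeometric in the quotient of the two squared radii.
  Copson's formula is checked by comparing power series: the circular mean and the Abel-type
  integral both produce the coefficients \<open>bcf a p * bcf a (p + m)\<close>. Null sets take care
  of the circle \<open>norm y = norm x\<close>.\<close>

definition jac :: "nat \<Rightarrow> real \<Rightarrow> real \<Rightarrow> real \<Rightarrow> real" where
  "jac n a b s = (\<Sum>k\<le>n. ((real n + a) gchoose (n - k)) * ((real n + b) gchoose k) * (s - 1) ^ k * s ^ (n - k))"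

text \<open>With \<open>s = r^2\<close> the weights become powers of \<open>s\<close> and
  \<open>1 - s\<close> on the unit interval, and the factors 2 of the standard interval disappear
  from all derivative rules.\<close>

lemma jacobi_poly_eq_jac: "jacobi_poly n a b (2 * s - 1) = jac n a b s"
  unfolding jacobi_poly_def jac_def by (simp add: diff_divide_distrib)

lemma jac_0 [simp]: "jac 0 a b s = 1"
  by (simp add: jac_def)

text \<open>Reversing the order of summation exchanges the two binomial factors. This is the
  classical symmetry of Jacobi polynomials under \<open>t -> - t\<close>.\<close>

lemma jac_reflect: "jac n a b s = (- 1) ^ n * jac n b a (1 - s)"
proof -
  have "jac n a b s = (\<Sum>k\<le>n. ((real n + a) gchoose (n - (n - k))) * ((real n + b) gchoose (n - k)) * (s - 1) ^ (n - k) * s ^ (n - (n - k)))"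
    unfolding jac_def by (rule sum.reindex_bij_witness[of _ "\<lambda>k. n - k" "\<lambda>k. n - k"]) auto
  also have "\<dots> = (\<Sum>k\<le>n. (- 1) ^ n * (((real n + b) gchoose (n - k)) * ((real n + a) gchoose k) * ((1 - s) - 1) ^ k * (1 - s) ^ (n - k)))"
  proof (intro sum.cong refl)
    fix k assume "k \<in> {..n}"
    then have k: "k \<le> n" by simp
    have "(s - 1) ^ (n - k) = (-1) ^ (n - k) * (1 - s) ^ (n - k)"
      by (simp add: power_mult_distrib[symmetric])
    moreover have "(1 - s - 1) ^ k = (-1) ^ k * s ^ k"
      by (simp add: power_mult_distrib[symmetric])
    moreover have "(-1::real) ^ n = (-1) ^ (n - k) * (-1) ^ k"
      using k by (simp add: power_add[symmetric])
    moreover have "(-1::real) ^ k * (-1) ^ k = 1" by (simp add: power_mult_distrib[symmetric])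
    ultimately show "((real n + a) gchoose (n - (n - k))) * ((real n + b) gchoose (n - k)) * (s - 1) ^ (n - k) * s ^ (n - (n - k)) =
       (- 1) ^ n * (((real n + b) gchoose (n - k)) * ((real n + a) gchoose k) * ((1 - s) - 1) ^ k * (1 - s) ^ (n - k))"
      using k by simp
  qed
  also have "\<dots> = (- 1) ^ n * jac n b a (1 - s)"
    unfolding jac_def by (simp add: sum_distrib_left)
  finally show ?thesis .
qed

text \<open>Both sides equal \<open>x * ((x - 1) gchoose k)\<close>.\<close>

lemma gbinomial_absorb_upper: "(x - real k) * (x gchoose k) = real (Suc k) * (x gchoose (Suc k))"
  using gbinomial_absorption[of k x] gbinomial_absorb_comp[of x k] by simp

lemma power_diff_deriv: "((\<lambda>s::real. (s - 1) ^ k * s ^ m) has_real_derivative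
   real k * (s - 1) ^ (k - 1) * s ^ m + real m * (s - 1) ^ k * s ^ (m - 1)) (at s)"
  by (auto intro!: derivative_eq_intros simp: algebra_simps)

lemma jac_DERIV_sum:
  "(jac n a b has_real_derivative (\<Sum>k\<le>n. ((real n + a) gchoose (n - k)) * ((real n + b) gchoose k) *
     (real k * (s - 1) ^ (k - 1) * s ^ (n - k) + real (n - k) * (s - 1) ^ k * s ^ (n - k - 1)))) (at s)"
  unfolding jac_def mult.assoc[of "((real n + a) gchoose i) * ((real n + b) gchoose j)" for i j]
  by (intro DERIV_sum DERIV_cmult power_diff_deriv)

lemma jac_DERIV: "\<exists>D. (jac n a b has_real_derivative D) (at s)"
  using jac_DERIV_sum by blast

text \<open>The product rule gives two sums, aligned by an index shift. Absorption then turns each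
  into a multiple of the same term, with factors \<open>Suc n + b - k\<close> and
  \<open>a + 1 + k\<close>, whose sum does not depend on \<open>k\<close>.\<close>

lemma jac_has_derivative:
  "(jac (Suc n) a b has_real_derivative (real (Suc n) + a + b + 1) * jac n (a + 1) (b + 1) s) (at s)"
proof -
  define u where "u = (\<lambda>k. (real (Suc n) + a) gchoose k)"
  define v where "v = (\<lambda>k. (real (Suc n) + b) gchoose k)"
  have "(jac (Suc n) a b has_real_derivative
        (\<Sum>k\<le>Suc n. u (Suc n - k) * v k * (real k * (s - 1) ^ (k - 1) * s ^ (Suc n - k) + real (Suc n - k) * (s - 1) ^ k * s ^ (Suc n - k - 1)))) (at s)"
    unfolding u_def v_def by (rule jac_DERIV_sum)
  also have "(\<Sum>k\<le>Suc n. u (Suc n - k) * v k * (real k * (s - 1) ^ (k - 1) * s ^ (Suc n - k) + real (Suc n - k) * (s - 1) ^ k * s ^ (Suc n - k - 1)))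
     = (\<Sum>k\<le>Suc n. u (Suc n - k) * v k * real k * (s - 1) ^ (k - 1) * s ^ (Suc n - k)) +
       (\<Sum>k\<le>Suc n. u (Suc n - k) * v k * real (Suc n - k) * (s - 1) ^ k * s ^ (Suc n - k - 1))"
    unfolding sum.distrib[symmetric] by (intro sum.cong refl) (simp add: distrib_left mult.assoc)
  also have "(\<Sum>k\<le>Suc n. u (Suc n - k) * v k * real k * (s - 1) ^ (k - 1) * s ^ (Suc n - k))
     = (\<Sum>k\<le>n. u (n - k) * (real (Suc k) * v (Suc k)) * (s - 1) ^ k * s ^ (n - k))"
    by (subst sum.atMost_Suc_shift) (simp add: mult_ac)
  also have "(\<Sum>k\<le>Suc n. u (Suc n - k) * v k * real (Suc n - k) * (s - 1) ^ k * s ^ (Suc n - k - 1))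
     = (\<Sum>k\<le>n. (real (Suc (n - k)) * u (Suc (n - k))) * v k * (s - 1) ^ k * s ^ (n - k))"
    by (subst sum.atMost_Suc) (auto intro!: sum.cong simp: Suc_diff_le mult_ac)
  also have "(\<Sum>k\<le>n. u (n - k) * (real (Suc k) * v (Suc k)) * (s - 1) ^ k * s ^ (n - k)) +
      (\<Sum>k\<le>n. (real (Suc (n - k)) * u (Suc (n - k))) * v k * (s - 1) ^ k * s ^ (n - k))
     = (\<Sum>k\<le>n. (real (Suc n) + a + b + 1) * (u (n - k) * v k * (s - 1) ^ k * s ^ (n - k)))"
    unfolding sum.distrib[symmetric]
  proof (intro sum.cong refl)
    fix k assume "k \<in> {..n}"
    then have k: "real (n - k) = real n - real k" by (simp add: of_nat_diff)
    have 1: "real (Suc k) * v (Suc k) = (real (Suc n) + b - real k) * v k"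
      unfolding v_def by (rule gbinomial_absorb_upper[symmetric])
    have 2: "real (Suc (n - k)) * u (Suc (n - k)) = (real (Suc n) + a - (real n - real k)) * u (n - k)"
      unfolding u_def k[symmetric] by (rule gbinomial_absorb_upper[symmetric])
    show "u (n - k) * (real (Suc k) * v (Suc k)) * (s - 1) ^ k * s ^ (n - k) +
         real (Suc (n - k)) * u (Suc (n - k)) * v k * (s - 1) ^ k * s ^ (n - k) =
         (real (Suc n) + a + b + 1) * (u (n - k) * v k * (s - 1) ^ k * s ^ (n - k))"
      unfolding 1 2 by (simp add: algebra_simps)
  qed
  also have "\<dots> = (real (Suc n) + a + b + 1) * jac n (a + 1) (b + 1) s"
    by (simp add: jac_def sum_distrib_left u_def v_def add_ac)
  finally show ?thesis .
qed

lemma continuous_on_jac [continuous_intros]: "continuous_on A f \<Longrightarrow> continuous_on A (\<lambda>x. jac n a b (f x))"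
  unfolding jac_def by (intro continuous_intros)

lemma jac_at_1: "jac n a b 1 = (real n + a) gchoose n"
proof -
  have "jac n a b 1 = (\<Sum>k\<in>{0}. ((real n + a) gchoose (n - k)) * ((real n + b) gchoose k) * (1 - 1) ^ k * 1 ^ (n - k))"
    unfolding jac_def by (rule sum.mono_neutral_right) auto
  then show ?thesis by simp
qed

text \<open>The hypergeometric form, centred at \<open>s = 1\<close>. Both sides have the same
  derivative, by \<open>jac_has_derivative\<close> and induction at the parameters
  \<open>a + 1\<close> and \<open>b + 1\<close>, and they agree at \<open>s = 1\<close>.\<close>

lemma jac_taylor: "jac n a b s = (\<Sum>i\<le>n. pochhammer (real n + a + b + 1) i * ((real n + a) gchoose (n - i)) / fact i * (s - 1) ^ i)"
proof (induction n arbitrary: a b s)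
  case 0
  then show ?case by simp
next
  case (Suc n)
  define P where "P = (\<lambda>s. \<Sum>i\<le>Suc n. pochhammer (real (Suc n) + a + b + 1) i * ((real (Suc n) + a) gchoose (Suc n - i)) / fact i * (s - 1) ^ i)"
  have dP: "(P has_real_derivative (real (Suc n) + a + b + 1) * jac n (a + 1) (b + 1) s) (at s)" for s
  proof -
    have "(P has_real_derivative (\<Sum>i\<le>Suc n. pochhammer (real (Suc n) + a + b + 1) i * ((real (Suc n) + a) gchoose (Suc n - i)) / fact i * (real i * (s - 1) ^ (i - 1)))) (at s)"
      unfolding P_def by (rule DERIV_sum) (auto intro!: derivative_eq_intros)
    also have "(\<Sum>i\<le>Suc n. pochhammer (real (Suc n) + a + b + 1) i * ((real (Suc n) + a) gchoose (Suc n - i)) / fact i * (real i * (s - 1) ^ (i - 1)))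
       = (\<Sum>i\<le>n. (real (Suc n) + a + b + 1) * (pochhammer (real n + (a + 1) + (b + 1) + 1) i * ((real n + (a + 1)) gchoose (n - i)) / fact i * (s - 1) ^ i))"
    proof (subst sum.atMost_Suc_shift, simp only: of_nat_0 mult_zero_left mult_zero_right add_0, intro sum.cong refl)
      fix i assume "i \<in> {..n}"
      have "pochhammer (real (Suc n) + a + b + 1) (Suc i) = (real (Suc n) + a + b + 1) * pochhammer (real n + (a + 1) + (b + 1) + 1) i"
        by (simp add: pochhammer_rec add_ac)
      moreover have "fact (Suc i) = real (Suc i) * fact i"
        by simp
      moreover have "real n + (a + 1) = real (Suc n) + a" by simp
      ultimately show "pochhammer (real (Suc n) + a + b + 1) (Suc i) * (real (Suc n) + a gchoose Suc n - Suc i) / fact (Suc i) *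
         (real (Suc i) * (s - 1) ^ (Suc i - 1)) =
         (real (Suc n) + a + b + 1) * (pochhammer (real n + (a + 1) + (b + 1) + 1) i * ((real n + (a + 1)) gchoose (n - i)) / fact i * (s - 1) ^ i)"
        by (simp only: times_divide_eq_left times_divide_eq_right diff_Suc_1 diff_Suc_Suc)
           (simp add: add_ac mult_ac divide_simps del: of_nat_Suc fact_Suc)
    qed
    also have "\<dots> = (real (Suc n) + a + b + 1) * jac n (a + 1) (b + 1) s"
      by (simp only: Suc.IH sum_distrib_left)
    finally show ?thesis .
  qed
  have "((\<lambda>s. jac (Suc n) a b s - P s) has_real_derivative 0) (at s)" for s
    using DERIV_diff[OF jac_has_derivative[of n a b] dP] by simp
  then have "jac (Suc n) a b s - P s = jac (Suc n) a b 1 - P 1"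
    by (intro DERIV_isconst_all) auto
  moreover have "P 1 = (real (Suc n) + a) gchoose (Suc n)"
  proof -
    have "P 1 = (\<Sum>i\<in>{0}. pochhammer (real (Suc n) + a + b + 1) i * ((real (Suc n) + a) gchoose (Suc n - i)) / fact i * (1 - 1) ^ i)"
      unfolding P_def by (rule sum.mono_neutral_right) auto
    then show ?thesis by simp
  qed
  ultimately show ?case
    by (simp add: jac_at_1 P_def)
qed

text \<open>The left-hand side is \<open>(1 - s) powr (1 - a)\<close> times the derivative of
  \<open>(1 - s) powr a * jac n a b s\<close>; the next two lemmas are the analogues for the weights
  \<open>s powr b\<close> and \<open>s powr b * (1 - s) powr a\<close>.\<close>

lemma jac_weighted_deriv_left:
  assumes "(jac n a b has_real_derivative D) (at s)"
  shows "(1 - s) * D - a * jac n a b s = - (real n + a) * jac n (a - 1) (b + 1) s"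
proof -
  define u where "u = (\<lambda>k. (real n + a) gchoose k)"
  define v where "v = (\<lambda>k. (real n + b) gchoose k)"
  have D: "D = (\<Sum>k\<le>n. u (n - k) * v k * (real k * (s - 1) ^ (k - 1) * s ^ (n - k) + real (n - k) * (s - 1) ^ k * s ^ (n - k - 1)))"
    unfolding u_def v_def by (rule DERIV_unique[OF assms jac_DERIV_sum])
  have "(s - 1) * D + a * jac n a b s = (\<Sum>k\<le>n. (real k + a) * u (n - k) * v k * (s - 1) ^ k * s ^ (n - k))
      + (\<Sum>k\<le>n. real (n - k) * u (n - k) * v k * (s - 1) ^ Suc k * s ^ (n - k - 1))"
    unfolding D jac_def sum_distrib_left sum.distrib[symmetric]
  proof (intro sum.cong refl)
    fix k
    have "real k * ((s - 1) * (s - 1) ^ (k - 1)) = real k * (s - 1) ^ k"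
      by (cases k) auto
    then show "(s - 1) * (u (n - k) * v k * (real k * (s - 1) ^ (k - 1) * s ^ (n - k) + real (n - k) * (s - 1) ^ k * s ^ (n - k - 1)))
      + a * ((real n + a gchoose n - k) * (real n + b gchoose k) * (s - 1) ^ k * s ^ (n - k)) =
      (real k + a) * u (n - k) * v k * (s - 1) ^ k * s ^ (n - k) + real (n - k) * u (n - k) * v k * (s - 1) ^ Suc k * s ^ (n - k - 1)"
      unfolding u_def[symmetric] v_def[symmetric] fun_cong[OF u_def, symmetric] fun_cong[OF v_def, symmetric]
      by (simp add: distrib_left distrib_right mult_ac) (metis mult.left_commute)
  qed
  also have "(\<Sum>k\<le>n. real (n - k) * u (n - k) * v k * (s - 1) ^ Suc k * s ^ (n - k - 1))
      = (\<Sum>k\<le>n. real (n - k + 1) * u (n - k + 1) * (if k = 0 then 0 else v (k - 1)) * (s - 1) ^ k * s ^ (n - k))"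
  proof (cases n)
    case (Suc m)
    let ?g = "\<lambda>k. real (n - k + 1) * u (n - k + 1) * (if k = 0 then 0 else v (k - 1)) * (s - 1) ^ k * s ^ (n - k)"
    have "(\<Sum>k\<le>n. ?g k) = ?g 0 + (\<Sum>k\<le>m. ?g (Suc k))"
      unfolding Suc by (rule sum.atMost_Suc_shift)
    also have "\<dots> = (\<Sum>k\<le>m. real (n - k) * u (n - k) * v k * (s - 1) ^ Suc k * s ^ (n - k - 1))"
      unfolding Suc by (auto intro!: sum.cong simp: Suc_diff_le)
    finally show ?thesis
      unfolding Suc by simp
  qed simp
  also have "(\<Sum>k\<le>n. (real k + a) * u (n - k) * v k * (s - 1) ^ k * s ^ (n - k)) + \<dots>
     = (\<Sum>k\<le>n. (real n + a) * (((real n + (a - 1)) gchoose (n - k)) * ((real n + (b + 1)) gchoose k) * (s - 1) ^ k * s ^ (n - k)))"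
    unfolding sum.distrib[symmetric]
  proof (intro sum.cong refl)
    fix k assume "k \<in> {..n}"
    then have k: "real (n - k) = real n - real k" by (simp add: of_nat_diff)
    \<comment> \<open>1 and 2 absorb both prefactors into the same binomial coefficient with upper
      parameter lowered by one; 3 is Pascal's rule, which merges \<open>v k\<close> and
      \<open>v (k - 1)\<close> and thereby raises \<open>b\<close>.\<close>
    have 1: "(real k + a) * u (n - k) = (real n + a) * ((real n + (a - 1)) gchoose (n - k))"
      using gbinomial_absorb_comp[of "real n + a" "n - k"] k unfolding u_def
      by (simp add: algebra_simps)
    have 2: "real (n - k + 1) * u (n - k + 1) = (real n + a) * ((real n + (a - 1)) gchoose (n - k))"
      using gbinomial_absorption[of "n - k" "real n + a"] unfolding u_def by (simp add: algebra_simps)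
    have 3: "(real n + (b + 1)) gchoose k = v k + (if k = 0 then 0 else v (k - 1))"
      using gbinomial_Suc_Suc[of "real n + b" "k - 1"] unfolding v_def by (cases k) (auto simp: algebra_simps)
    show "(real k + a) * u (n - k) * v k * (s - 1) ^ k * s ^ (n - k) +
         real (n - k + 1) * u (n - k + 1) * (if k = 0 then 0 else v (k - 1)) * (s - 1) ^ k * s ^ (n - k) =
         (real n + a) * ((real n + (a - 1) gchoose n - k) * (real n + (b + 1) gchoose k) * (s - 1) ^ k * s ^ (n - k))"
      unfolding 1 2 3 by (simp add: algebra_simps)
  qed
  also have "\<dots> = (real n + a) * jac n (a - 1) (b + 1) s"
    by (simp add: jac_def sum_distrib_left)
  finally show ?thesis by (simp add: algebra_simps)
qed

lemma jac_weighted_deriv_right: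
  assumes "(jac n a b has_real_derivative D) (at s)"
  shows "s * D + b * jac n a b s = (real n + b) * jac n (a + 1) (b - 1) s"
proof -
  \<comment> \<open>The reflection \<open>s -> 1 - s\<close> exchanges the weights at the two end
    points, so the previous lemma applies with \<open>a\<close> and \<open>b\<close>
    interchanged.\<close>
  have jr: "jac n b a = (\<lambda>x. (- 1) ^ n * jac n a b (1 - x))"
    by (rule ext) (subst jac_reflect, simp)
  have "((\<lambda>x. (- 1) ^ n * jac n a b (1 - x)) has_real_derivative (- 1) ^ n * - D) (at (1 - s))"
  proof (rule DERIV_cmult)
    have "((\<lambda>x. 1 - x :: real) has_real_derivative - 1) (at (1 - s))"
      by (auto intro!: derivative_eq_intros)
    from DERIV_chain2[OF _ this, of "jac n a b" D] assms show "((\<lambda>x. jac n a b (1 - x)) has_real_derivative - D) (at (1 - s))"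
      by simp
  qed
  then have "(jac n b a has_real_derivative (- 1) ^ n * - D) (at (1 - s))"
    unfolding jr .
  from jac_weighted_deriv_left[OF this]
  have "(- 1) ^ n * (s * D + b * jac n a b s) = (- 1) ^ n * ((real n + b) * jac n (a + 1) (b - 1) s)"
    using jac_reflect[of n a b s] jac_reflect[of n "a + 1" "b - 1" s]
    by (simp add: algebra_simps)
  then show ?thesis by simp
qed

lemma jac_weighted_deriv_both:
  assumes "(jac n a b has_real_derivative D) (at s)"
  shows "s * (1 - s) * D + (b * (1 - s) - a * s) * jac n a b s = - real (Suc n) * jac (Suc n) (a - 1) (b - 1) s"
proof -
  define u where "u = (\<lambda>k. (real n + a) gchoose k)"
  define v where "v = (\<lambda>k. (real n + b) gchoose k)"
  have D: "D = (\<Sum>k\<le>n. u (n - k) * v k * (real k * (s - 1) ^ (k - 1) * s ^ (n - k) + real (n - k) * (s - 1) ^ k * s ^ (n - k - 1)))"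
    unfolding u_def v_def by (rule DERIV_unique[OF assms jac_DERIV_sum])
  have "s * (s - 1) * D + (b * (s - 1) + a * s) * jac n a b s =
      (\<Sum>k\<le>n. (real k + a) * u (n - k) * v k * (s - 1) ^ k * s ^ (Suc n - k))
      + (\<Sum>k\<le>n. (real (n - k) + b) * u (n - k) * v k * (s - 1) ^ Suc k * s ^ (n - k))"
    unfolding D jac_def sum_distrib_left sum.distrib[symmetric]
  proof (intro sum.cong refl)
    fix k assume "k \<in> {..n}"
    then have S: "s ^ (Suc n - k) = s * s ^ (n - k)" by (simp add: Suc_diff_le)
    have 1: "real k * ((s - 1) * (s - 1) ^ (k - 1)) = real k * (s - 1) ^ k"
      by (cases k) auto
    have 2: "real (n - k) * (s * s ^ (n - k - 1)) = real (n - k) * s ^ (n - k)"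
      by (cases "n - k") auto
    have "s * (s - 1) * (real k * (s - 1) ^ (k - 1) * s ^ (n - k) + real (n - k) * (s - 1) ^ k * s ^ (n - k - 1))
      = s * s ^ (n - k) * (real k * ((s - 1) * (s - 1) ^ (k - 1))) + (s - 1) * (s - 1) ^ k * (real (n - k) * (s * s ^ (n - k - 1)))"
      by (simp add: algebra_simps)
    also have "\<dots> = s * s ^ (n - k) * (real k * (s - 1) ^ k) + (s - 1) * (s - 1) ^ k * (real (n - k) * s ^ (n - k))"
      unfolding 1 2 ..
    finally have 3: "s * (s - 1) * (u (n - k) * v k * (real k * (s - 1) ^ (k - 1) * s ^ (n - k) + real (n - k) * (s - 1) ^ k * s ^ (n - k - 1)))
      = u (n - k) * v k * (s * s ^ (n - k) * (real k * (s - 1) ^ k) + (s - 1) * (s - 1) ^ k * (real (n - k) * s ^ (n - k)))"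
      by (simp only: mult.left_commute[of "s * (s - 1)"])
    show "s * (s - 1) * (u (n - k) * v k * (real k * (s - 1) ^ (k - 1) * s ^ (n - k) + real (n - k) * (s - 1) ^ k * s ^ (n - k - 1)))
      + (b * (s - 1) + a * s) * ((real n + a gchoose n - k) * (real n + b gchoose k) * (s - 1) ^ k * s ^ (n - k)) =
      (real k + a) * u (n - k) * v k * (s - 1) ^ k * s ^ (Suc n - k) + (real (n - k) + b) * u (n - k) * v k * (s - 1) ^ Suc k * s ^ (n - k)"
      unfolding 3 S unfolding u_def v_def by (simp add: algebra_simps)
  qed
  \<comment> \<open>Absorption rewrites both sums over the degree \<open>Suc n\<close>, with weights
    \<open>Suc n - k\<close> and \<open>k\<close>; their total \<open>Suc n\<close> is the constant
    of the statement.\<close>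
  also have "(\<Sum>k\<le>n. (real k + a) * u (n - k) * v k * (s - 1) ^ k * s ^ (Suc n - k)) =
     (\<Sum>k\<le>Suc n. real (Suc n - k) * u (Suc n - k) * v k * (s - 1) ^ k * s ^ (Suc n - k))"
  proof (subst sum.atMost_Suc, simp only: diff_self_eq_0 of_nat_0 mult_zero_left add_0_right, intro sum.cong refl)
    fix k assume "k \<in> {..n}"
    then have k: "real (n - k) = real n - real k" "Suc n - k = Suc (n - k)" by (simp_all add: of_nat_diff Suc_diff_le)
    have "(real k + a) * u (n - k) = real (Suc n - k) * u (Suc n - k)"
      using gbinomial_absorb_upper[of "real n + a" "n - k"] k unfolding u_def by (simp add: algebra_simps)
    then show "(real k + a) * u (n - k) * v k * (s - 1) ^ k * s ^ (Suc n - k) = real (Suc n - k) * u (Suc n - k) * v k * (s - 1) ^ k * s ^ (Suc n - k)"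
      by simp
  qed
  also have "(\<Sum>k\<le>n. (real (n - k) + b) * u (n - k) * v k * (s - 1) ^ Suc k * s ^ (n - k)) =
     (\<Sum>k\<le>Suc n. real k * u (Suc n - k) * v k * (s - 1) ^ k * s ^ (Suc n - k))"
  proof (subst sum.atMost_Suc_shift, simp only: of_nat_0 mult_zero_left add_0, intro sum.cong refl)
    fix k assume "k \<in> {..n}"
    then have k: "real (n - k) = real n - real k" by (simp add: of_nat_diff)
    have "(real (n - k) + b) * v k = real (Suc k) * v (Suc k)"
      using gbinomial_absorb_upper[of "real n + b" k] k unfolding v_def by (simp add: algebra_simps)
    then show "(real (n - k) + b) * u (n - k) * v k * (s - 1) ^ Suc k * s ^ (n - k) = real (Suc k) * u (Suc n - Suc k) * v (Suc k) * (s - 1) ^ Suc k * s ^ (Suc n - Suc k)"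
      by (simp add: mult_ac)
  qed
  also have "(\<Sum>k\<le>Suc n. real (Suc n - k) * u (Suc n - k) * v k * (s - 1) ^ k * s ^ (Suc n - k)) +
     (\<Sum>k\<le>Suc n. real k * u (Suc n - k) * v k * (s - 1) ^ k * s ^ (Suc n - k)) =
     (\<Sum>k\<le>Suc n. real (Suc n) * (u (Suc n - k) * v k * (s - 1) ^ k * s ^ (Suc n - k)))"
    unfolding sum.distrib[symmetric]
    by (intro sum.cong refl) (auto simp: of_nat_diff algebra_simps)
  also have "\<dots> = real (Suc n) * jac (Suc n) (a - 1) (b - 1) s"
    unfolding jac_def u_def v_def by (simp add: sum_distrib_left del: sum.atMost_Suc)
  finally show ?thesis by (simp add: algebra_simps)
qed

section \<open>Rotation averages and radial integrals in the plane\<close>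

definition cz :: "real^2 \<Rightarrow> complex" where
  "cz x = Complex (x $ 1) (x $ 2)"

lemma Re_cz [simp]: "Re (cz x) = x $ 1" and Im_cz [simp]: "Im (cz x) = x $ 2"
  by (simp_all add: cz_def)

lemma norm_vec_2: "norm (x :: real^2) = sqrt ((x $ 1)\<^sup>2 + (x $ 2)\<^sup>2)"
  by (simp add: norm_vec_def L2_set_def sum_2)

lemma norm_cz [simp]: "norm (cz x) = norm x"
  by (simp add: norm_vec_2 cmod_def)

lemma cz_diff [simp]: "cz (x - y) = cz x - cz y"
  by (simp add: complex_eq_iff)

lemma cz_add [simp]: "cz (x + y) = cz x + cz y"
  by (simp add: complex_eq_iff)

lemma cz_scaleR [simp]: "cz (c *\<^sub>R x) = c *\<^sub>R cz x"
  by (simp add: complex_eq_iff)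

lemma bounded_linear_cz: "bounded_linear cz"
  by (rule bounded_linear_intro[of _ 1]) auto

lemma cz_measurable [measurable]: "cz \<in> borel_measurable borel"
  by (intro borel_measurable_continuous_onI linear_continuous_on bounded_linear_cz)

lemma cz_eq_iff [simp]: "cz x = cz y \<longleftrightarrow> x = y"
  by (auto simp: complex_eq_iff vec_eq_iff forall_2)

lemma cz_0 [simp]: "cz 0 = 0"
  by (simp add: complex_eq_iff)

lemma cz_eq_0_iff [simp]: "cz x = 0 \<longleftrightarrow> x = 0"
  by (metis cz_0 cz_eq_iff)

definition rot :: "real \<Rightarrow> real^2 \<Rightarrow> real^2" where
  "rot t x = vector [cos t * x $ 1 - sin t * x $ 2, sin t * x $ 1 + cos t * x $ 2]"

lemma cz_rot [simp]: "cz (rot t x) = cis t * cz x"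
  by (simp add: rot_def complex_eq_iff)

lemma norm_rot [simp]: "norm (rot t x) = norm x"
  by (metis cz_rot norm_cis norm_cz norm_mult mult_1)

lemma rot_rot: "rot s (rot t x) = rot (s + t) x"
  by (subst cz_eq_iff[symmetric]) (simp add: cis_mult[symmetric] mult.assoc)

lemma rot_0 [simp]: "rot 0 x = x"
  by (subst cz_eq_iff[symmetric]) simp

lemma linear_rot: "linear (rot t)"
  by (rule linearI; subst cz_eq_iff[symmetric])
     (simp_all add: algebra_simps)

lemma orthogonal_rot: "orthogonal_transformation (rot t)"
  by (simp add: orthogonal_transformation linear_rot)

lemma rot_measurable_pair: "(\<lambda>p. rot (fst p) (snd p)) \<in> borel_measurable (borel \<Otimes>\<^sub>M borel)"
proof -
  have "continuous_on UNIV (\<lambda>p. \<chi> i :: 2. if i = 1 then cos (fst p) * snd p $ 1 - sin (fst p) * snd p $ 2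
      else sin (fst p) * snd p $ 1 + cos (fst p) * (snd p :: real^2) $ 2)"
  proof (rule continuous_on_vec_lambda)
    fix i :: 2
    show "continuous_on UNIV (\<lambda>p. if i = 1 then cos (fst p) * snd p $ 1 - sin (fst p) * snd p $ 2
      else sin (fst p) * snd p $ 1 + cos (fst p) * (snd p :: real^2) $ 2)"
      by (cases "i = 1") (auto intro!: continuous_intros)
  qed
  moreover have "(\<lambda>p. \<chi> i :: 2. if i = 1 then cos (fst p) * snd p $ 1 - sin (fst p) * snd p $ 2
      else sin (fst p) * snd p $ 1 + cos (fst p) * (snd p :: real^2) $ 2) = (\<lambda>p. rot (fst p) (snd p))"
    by (auto simp: rot_def vec_eq_iff forall_2)
  ultimately have "continuous_on UNIV (\<lambda>p. rot (fst p) (snd p))"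
    by (simp only:)
  then show ?thesis
    by (simp add: borel_prod borel_measurable_continuous_onI)
qed

lemma rot_measurable [measurable]:
  assumes [measurable]: "f \<in> borel_measurable M" "g \<in> borel_measurable M"
  shows "(\<lambda>x. rot (f x) (g x)) \<in> borel_measurable M"
  using measurable_compose[OF _ rot_measurable_pair, of "\<lambda>x. (f x, g x)" M] by simp

lemma unit_disk_borel [measurable]: "unit_disk \<in> sets borel"
  by simp

lemma vimage_rot: "rot t -` A = rot (- t) ` A"
proof (intro set_eqI iffI)
  fix x assume "x \<in> rot t -` A"
  moreover have "x = rot (- t) (rot t x)" by (simp add: rot_rot)
  ultimately show "x \<in> rot (- t) ` A" by blast
qed (auto simp: rot_rot)

lemma distr_rot: "distr lborel borel (rot t) = lborel"
proof -
  have m: "rot t \<in> borel_measurable borel"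
    using linear_rot[of t] by (intro borel_measurable_continuous_onI linear_continuous_on) (simp only: linear_conv_bounded_linear)
  have "lborel = distr lborel borel (rot t)"
  proof (rule lborel_eqI)
    fix l u :: "real^2" assume lu: "\<And>b. b \<in> Basis \<Longrightarrow> l \<bullet> b \<le> u \<bullet> b"
    have "rot t -` box l u \<in> sets borel"
      using measurable_sets[OF m, of "box l u"] by simp
    then have "emeasure (distr lborel borel (rot t)) (box l u) = emeasure lebesgue (rot (- t) ` box l u)"
      using m by (simp add: emeasure_distr vimage_rot)
    also have "\<dots> = measure lebesgue (rot (- t) ` box l u)"
      using measurable_orthogonal_image[OF orthogonal_rot[of "- t"] lmeasurable_box, of l u]
      by (rule emeasure_eq_measure2)
    also have "\<dots> = measure lebesgue (box l u)"
      using measure_orthogonal_image[OF orthogonal_rot[of "- t"], of "box l u"] by simp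
    also have "\<dots> = (\<Prod>b\<in>Basis. (u - l) \<bullet> b)"
      using lu by (simp add: measure_lborel_box_eq)
    finally show "emeasure (distr lborel borel (rot t)) (box l u) = (\<Prod>b\<in>Basis. (u - l) \<bullet> b)" .
  qed simp
  then show ?thesis by simp
qed

text \<open>The uniform probability measure on angles. As a finite measure it can be paired with
  \<open>lborel\<close> for Fubini, and angular averages become plain integrals.\<close>

definition circ :: "real measure" where
  "circ = density lborel (\<lambda>t. ennreal (indicator {0..2 * pi} t / (2 * pi)))"

lemma sets_circ [measurable_cong, simp]: "sets circ = sets borel"
  by (simp add: circ_def)

lemma space_circ [simp]: "space circ = UNIV"
  by (simp add: circ_def)

lemma emeasure_circ: "emeasure circ UNIV = 1"
proof -
  have "emeasure circ (space circ) = (\<integral>\<^sup>+t. ennreal (1 / (2 * pi)) * indicator {0..2 * pi} t \<partial>lborel)"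
    by (simp add: circ_def emeasure_density) (auto intro!: nn_integral_cong split: split_indicator)
  also have "\<dots> = ennreal (1 / (2 * pi)) * ennreal (2 * pi)"
    by (subst nn_integral_cmult_indicator) auto
  also have "\<dots> = 1" by (simp add: ennreal_mult[symmetric])
  finally show ?thesis by simp
qed

lemma measure_circ [simp]: "measure circ UNIV = 1"
  by (simp add: measure_def emeasure_circ)

interpretation circ: finite_measure circ
  by standard (simp add: emeasure_circ)

interpretation circ_lborel: pair_sigma_finite circ "lborel :: (real^2) measure" ..

text \<open>Every rotation leaves the plane integral unchanged, so it equals its own average over
  the angle; Tonelli moves the average inside. With the law of \<open>r^2\<close> below this
  replaces polar coordinates.\<close>

lemma nn_integral_rot_average:
  assumes [measurable]: "F \<in> borel_measurable borel"
  shows "(\<integral>\<^sup>+y. F y \<partial>lborel) = (\<integral>\<^sup>+y. (\<integral>\<^sup>+t. F (rot t y) \<partial>circ) \<partial>lborel)"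
proof -
  have "(\<integral>\<^sup>+y. F (rot t y) \<partial>lborel) = (\<integral>\<^sup>+y. F y \<partial>lborel)" for t
    by (subst (2) distr_rot[of t, symmetric], subst nn_integral_distr) auto
  then have "(\<integral>\<^sup>+t. (\<integral>\<^sup>+y. F (rot t y) \<partial>lborel) \<partial>circ) = (\<integral>\<^sup>+y. F y \<partial>lborel)"
    by (simp add: emeasure_circ)
  also have "(\<integral>\<^sup>+t. (\<integral>\<^sup>+y. F (rot t y) \<partial>lborel) \<partial>circ) = (\<integral>\<^sup>+y. (\<integral>\<^sup>+t. F (rot t y) \<partial>circ) \<partial>lborel)"
    by (rule circ_lborel.Fubini'[symmetric]) measurable
  finally show ?thesis by simp
qed

lemma integral_rot_average:
  fixes F :: "real^2 \<Rightarrow> 'b :: {banach, second_countable_topology}"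
  assumes F: "integrable lborel F"
  shows "(\<integral>y. F y \<partial>lborel) = (\<integral>y. (\<integral>t. F (rot t y) \<partial>circ) \<partial>lborel)"
proof -
  have [measurable]: "F \<in> borel_measurable borel" using F by auto
  have i: "integrable lborel (\<lambda>y. F (rot t y))" "(\<integral>y. F (rot t y) \<partial>lborel) = (\<integral>y. F y \<partial>lborel)"
    "(\<integral>y. norm (F (rot t y)) \<partial>lborel) = (\<integral>y. norm (F y) \<partial>lborel)" for t
  proof -
    have [measurable]: "rot t \<in> borel_measurable borel" by measurable
    show "integrable lborel (\<lambda>y. F (rot t y))"
      using F by (subst (asm) distr_rot[of t, symmetric], subst (asm) integrable_distr_eq) auto
    show "(\<integral>y. F (rot t y) \<partial>lborel) = (\<integral>y. F y \<partial>lborel)"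
      by (subst (2) distr_rot[of t, symmetric], subst integral_distr) auto
    show "(\<integral>y. norm (F (rot t y)) \<partial>lborel) = (\<integral>y. norm (F y) \<partial>lborel)"
      by (subst (2) distr_rot[of t, symmetric], subst integral_distr) auto
  qed
  have "integrable (circ \<Otimes>\<^sub>M lborel) (\<lambda>(t, y). F (rot t y))"
    by (rule circ_lborel.Fubini_integrable) (auto simp: i)
  from circ_lborel.Fubini_integral[OF this]
  have "(\<integral>y. (\<integral>t. F (rot t y) \<partial>circ) \<partial>lborel) = (\<integral>t. (\<integral>y. F (rot t y) \<partial>lborel) \<partial>circ)"
    by simp
  also have "\<dots> = (\<integral>y. F y \<partial>lborel)"
    by (simp add: i)
  finally show ?thesis ..
qed

text \<open>The annulus \<open>x < r^2 < 1\<close> has area \<open>pi * (1 - x)\<close>, so the area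
  measure of the disk has constant density in \<open>r^2\<close>. This is why \<open>r^2\<close> and
  not \<open>r\<close> is the radial variable throughout.\<close>

lemma distr_norm_square_disk:
  "distr (density lborel (indicator (ball 0 1 :: (real^2) set))) borel (\<lambda>y. (norm y)\<^sup>2) =
     density lborel (\<lambda>s. ennreal pi * indicator {0<..<1} s)" (is "?M = ?N")
proof (rule measure_eqI_lessThan)
  have ball: "emeasure lborel (ball (0 :: real^2) r) = ennreal (pi * r\<^sup>2)" if "0 \<le> r" for r
    using that by (simp add: emeasure_ball unit_ball_vol_2)
  have cball: "emeasure lborel (cball (0 :: real^2) r) = ennreal (pi * r\<^sup>2)" if "0 \<le> r" for r
    using that by (simp add: emeasure_cball unit_ball_vol_2)
  have M: "emeasure ?M {x<..} = emeasure lborel ({y. x < (norm y)\<^sup>2} \<inter> ball (0 :: real^2) 1)" for x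
  proof -
    have "emeasure ?M {x<..} = (\<integral>\<^sup>+y. indicator (ball 0 1) y * indicator {y. x < (norm y)\<^sup>2} y \<partial>(lborel :: (real^2) measure))"
      by (subst emeasure_distr, simp, simp, subst emeasure_density) (auto simp: vimage_def)
    also have "\<dots> = (\<integral>\<^sup>+y. indicator ({y. x < (norm y)\<^sup>2} \<inter> ball 0 1) y \<partial>(lborel :: (real^2) measure))"
      by (intro nn_integral_cong) (simp split: split_indicator)
    finally show ?thesis by simp
  qed
  have N: "emeasure ?N {x<..} = ennreal pi * emeasure lborel ({0<..<1} \<inter> {x<..})" for x
    by (simp add: emeasure_density mult.assoc indicator_inter_arith[symmetric] nn_integral_cmult)
  fix x :: real
  consider "x < 0" | "0 \<le> x" "x < 1" | "1 \<le> x" by linarith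
  then have "emeasure ?M {x<..} = emeasure ?N {x<..} \<and> emeasure ?N {x<..} < \<infinity>"
  proof cases
    case 1
    then have "{y. x < (norm y)\<^sup>2} \<inter> ball (0 :: real^2) 1 = ball 0 1"
      by (auto intro: less_le_trans[OF _ zero_le_power2])
    moreover have "{0<..<1} \<inter> {x<..} = {0<..<1}" using 1 by auto
    ultimately show ?thesis unfolding M N using ball[of 1] by simp
  next
    case 2
    have "{y. x < (norm y)\<^sup>2} \<inter> ball (0 :: real^2) 1 = ball 0 1 - cball 0 (sqrt x)"
    proof -
      have *: "x < (norm y)\<^sup>2 \<longleftrightarrow> \<not> norm y \<le> sqrt x" for y :: "real^2"
      proof -
        have "norm y \<le> sqrt x \<longleftrightarrow> sqrt ((norm y)\<^sup>2) \<le> sqrt x" by simp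
        also have "\<dots> \<longleftrightarrow> (norm y)\<^sup>2 \<le> x" by (rule real_sqrt_le_iff)
        finally show ?thesis by (simp only: not_le)
      qed
      show ?thesis
        by (intro set_eqI) (simp only: Int_iff mem_Collect_eq Diff_iff mem_cball mem_ball dist_0_norm *, blast)
    qed
    moreover have "cball (0 :: real^2) (sqrt x) \<subseteq> ball 0 1"
    proof
      fix y :: "real^2" assume "y \<in> cball 0 (sqrt x)"
      moreover have "sqrt x < 1" using 2 by simp
      ultimately have "norm y < 1" by (simp only: mem_cball dist_0_norm)
      then show "y \<in> ball 0 1" by simp
    qed
    ultimately have "emeasure ?M {x<..} = ennreal (pi * 1 - pi * x)"
      unfolding M using 2 by (simp add: emeasure_Diff ball cball ennreal_minus)
    moreover have "{0<..<1} \<inter> {x<..} = {x<..<1}" using 2 by auto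
    then have "emeasure ?N {x<..} = ennreal (pi * (1 - x))"
      unfolding N using 2 by (simp add: ennreal_mult)
    ultimately show ?thesis by (simp add: algebra_simps)
  next
    case 3
    have "(norm y)\<^sup>2 < x" if "norm y < 1" for y :: "real^2"
    proof -
      have "(norm y)\<^sup>2 < 1" using that by (simp add: abs_square_less_1)
      then show ?thesis using 3 by simp
    qed
    then have "{y. x < (norm y)\<^sup>2} \<inter> ball (0 :: real^2) 1 = {}"
      by (intro equals0I) (metis IntE dist_0_norm less_asym mem_Collect_eq mem_ball)
    moreover have "{0<..<1} \<inter> {x<..} = {}" using 3 by auto
    ultimately show ?thesis unfolding M N by simp
  qed
  then show "emeasure ?M {x<..} = emeasure ?N {x<..}" "emeasure ?M {x<..} < \<infinity>" by auto
qed auto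

lemma nn_integral_radial:
  fixes h :: "real \<Rightarrow> ennreal"
  assumes [measurable]: "h \<in> borel_measurable borel"
  shows "(\<integral>\<^sup>+y. indicator (ball (0::real^2) 1) y * h ((norm y)\<^sup>2) \<partial>lborel) = ennreal pi * (\<integral>\<^sup>+s. indicator {0<..<1} s * h s \<partial>lborel)"
proof -
  have "(\<integral>\<^sup>+y. indicator (ball (0::real^2) 1) y * h ((norm y)\<^sup>2) \<partial>lborel) = (\<integral>\<^sup>+s. h s \<partial>distr (density lborel (indicator (ball 0 1 :: (real^2) set))) borel (\<lambda>y. (norm y)\<^sup>2))"
    by (simp add: nn_integral_distr nn_integral_density)
  also have "\<dots> = ennreal pi * (\<integral>\<^sup>+s. indicator {0<..<1} s * h s \<partial>lborel)"
    by (simp add: distr_norm_square_disk nn_integral_density mult.assoc nn_integral_cmult)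
  finally show ?thesis .
qed

lemma integral_cis_power:
  "integrable circ (\<lambda>t. cis t ^ p * cnj (cis t) ^ q)"
  "(\<integral>t. cis t ^ p * cnj (cis t) ^ q \<partial>circ) = (if p = q then 1 else 0)"
proof -
  have [measurable]: "cis \<in> borel_measurable borel"
    by (intro borel_measurable_continuous_onI continuous_intros)
  have [measurable]: "(\<lambda>t. cis t ^ p * cnj (cis t) ^ q) \<in> borel_measurable borel"
    by (intro borel_measurable_continuous_onI continuous_intros)
  show "integrable circ (\<lambda>t. cis t ^ p * cnj (cis t) ^ q)"
    by (rule circ.integrable_const_bound[of _ 1]) (auto simp: norm_mult norm_power)
  define k where "k = real p - real q"
  have e: "cis t ^ p * cnj (cis t) ^ q = cis (k * t)" for t
    by (simp add: Complex.DeMoivre cis_cnj cis_mult k_def left_diff_distrib)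
  have I: "(\<integral>t. cis t ^ p * cnj (cis t) ^ q \<partial>circ) = (\<integral>t. (indicator {0..2 * pi} t / (2 * pi)) *\<^sub>R cis (k * t) \<partial>lborel)"
    unfolding e circ_def by (subst integral_density) auto
  also have "\<dots> = (1 / (2 * pi)) *\<^sub>R (LINT t:{0..2*pi}|lborel. cis (k * t))"
    unfolding set_lebesgue_integral_def by (subst integral_scaleR_right[symmetric]) (simp only: scaleR_scaleR, simp add: mult.commute)
  also have "(LINT t:{0..2*pi}|lborel. cis (k * t)) = (if p = q then 2 * pi else 0)"
  proof (cases "p = q")
    case True
    then show ?thesis by (simp add: k_def set_lebesgue_integral_def scaleR_conv_of_real)
  next
    case False
    then have k: "k \<noteq> 0" by (simp add: k_def)
    have c: "set_integrable lborel {0..2*pi} (\<lambda>t. cis (k * t))"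
      unfolding set_integrable_def by (intro borel_integrable_compact continuous_intros compact_Icc)
    have "((\<lambda>t. cis (k * t)) has_integral cis (k * (2 * pi)) / (\<i> * k) - cis (k * 0) / (\<i> * k)) {0..2*pi}"
    proof (rule fundamental_theorem_of_calculus)
      fix t assume "t \<in> {0..2*pi}"
      have "((\<lambda>t. cis (k * t)) has_vector_derivative (k * \<i>) * cis (k * t)) (at t within {0..2*pi})"
        using exp_scaleR_has_vector_derivative_right[of "k * \<i>" t "{0..2*pi}"]
        by (simp add: cis_conv_exp scaleR_conv_of_real mult_ac)
      then show "((\<lambda>t. cis (k * t) / (\<i> * k)) has_vector_derivative cis (k * t)) (at t within {0..2*pi})"
        using k by (auto intro!: derivative_eq_intros)
    qed simp
    moreover have "cis (k * (2 * pi)) = 1"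
    proof -
      have "cis (k * (2 * pi)) = cis (2 * pi * of_int (int p - int q))"
        by (simp add: k_def mult_ac)
      then show ?thesis by (simp only: cis_multiple_2pi Ints_of_int)
    qed
    ultimately show ?thesis using False set_borel_integral_eq_integral(2)[OF c]
      by (simp add: integral_unique)
  qed
  finally show "(\<integral>t. cis t ^ p * cnj (cis t) ^ q \<partial>circ) = (if p = q then 1 else 0)"
    by (cases "p = q") (simp_all add: scaleR_conv_of_real)
qed

section \<open>Circular means of powers of the distance\<close>

text \<open>The Taylor coefficients of \<open>(1 - q) powr (- a)\<close>.\<close>

definition bcf :: "real \<Rightarrow> nat \<Rightarrow> real" where
  "bcf a p = pochhammer a p / fact p"

lemma bcf_pos: "0 < a \<Longrightarrow> 0 < bcf a p"
  by (simp add: bcf_def pochhammer_pos)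

lemma gchoose_minus_bcf: "((- a) gchoose p) * (- z) ^ p = bcf a p * z ^ p"
proof -
  have "((- 1) ^ p * (- 1) ^ p :: real) = 1" by (simp add: power_mult_distrib[symmetric])
  then show ?thesis
    by (simp add: gbinomial_pochhammer bcf_def power_minus[of z])
qed

lemma binomial_series_real:
  fixes q :: real assumes "\<bar>q\<bar> < 1"
  shows "(\<lambda>p. bcf a p * q ^ p) sums (1 - q) powr (- a)"
  using gen_binomial_real[of "- q" "- a"] assms by (simp only: gchoose_minus_bcf) simp

lemma binomial_series_complex:
  fixes z :: complex assumes "norm z < 1"
  shows "(\<lambda>p. of_real (bcf a p) * z ^ p) sums (1 - z) powr (of_real (- a))"
proof -
  have "(\<lambda>p. (of_real (- a) gchoose p) * (- z) ^ p) sums (1 + - z) powr (of_real (- a))"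
    using assms by (intro gen_binomial_complex) simp
  moreover have "(of_real (- a) gchoose p) * (- z) ^ p = of_real (bcf a p) * z ^ p" for p
  proof -
    have "((- 1) ^ p * (- 1) ^ p :: complex) = 1" by (simp add: power_mult_distrib[symmetric])
    then show ?thesis
      by (simp add: gbinomial_pochhammer bcf_def power_minus[of z] pochhammer_of_real)
  qed
  ultimately show ?thesis by simp
qed

lemma bcf_summable:
  assumes "0 < a" "0 \<le> q" "q < 1"
  shows "summable (\<lambda>p. bcf a p * q ^ p)"
  using binomial_series_real[of q a] assms by (auto simp: sums_iff)

text \<open>Termwise integration of the binomial series, dominated by
  \<open>B * bcf a p * norm w ^ p\<close>. The bounded factor \<open>h\<close> is left general
  because \<open>circle_mean\<close> expands twice: once against monomials, once against a
  conjugated power.\<close>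

lemma circle_mean_series:
  assumes a: "0 < a" and w: "norm w < 1"
    and h [measurable]: "h \<in> borel_measurable borel" and hB: "\<And>t. norm (h t) \<le> B"
  shows "(\<lambda>p. of_real (bcf a p) * (\<integral>t. h t * (w * cis t) ^ p \<partial>circ)) sums
           (\<integral>t. h t * (1 - w * cis t) powr (of_real (- a)) \<partial>circ)"
proof -
  define g where "g = (\<lambda>p t. h t * (of_real (bcf a p) * (w * cis t) ^ p))"
  have [measurable]: "cis \<in> borel_measurable borel"
    by (intro borel_measurable_continuous_onI continuous_intros)
  have gB: "norm (g p t) \<le> B * (bcf a p * norm w ^ p)" for p t
    using hB[of t] bcf_pos[OF a, of p]
    by (simp add: g_def norm_mult norm_power power_mult_distrib mult_right_mono)
  have sB: "summable (\<lambda>p. B * (bcf a p * norm w ^ p))"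
    by (intro summable_mult bcf_summable) (use a w in auto)
  have gi: "integrable circ (g p)" for p
    by (rule circ.integrable_const_bound[OF AE_I2[OF gB]]) (simp add: g_def)
  have "(\<lambda>p. \<integral>t. g p t \<partial>circ) sums (\<integral>t. (\<Sum>p. g p t) \<partial>circ)"
  proof (rule sums_integral)
    show "AE t in circ. summable (\<lambda>p. norm (g p t))"
      by (rule AE_I2) (rule summable_comparison_test'[OF sB], simp add: gB)
    have "norm (\<integral>t. norm (g p t) \<partial>circ) \<le> B * (bcf a p * norm w ^ p)" for p
    proof -
      have "(\<integral>t. norm (g p t) \<partial>circ) \<le> (\<integral>t. B * (bcf a p * norm w ^ p) \<partial>circ)"
        by (intro integral_mono integrable_norm gi gB) auto
      then show ?thesis by simp
    qed
    then show "summable (\<lambda>p. \<integral>t. norm (g p t) \<partial>circ)"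
      by (intro summable_comparison_test'[OF sB]) auto
  qed (rule gi)
  moreover have "(\<Sum>p. g p t) = h t * (1 - w * cis t) powr (of_real (- a))" for t
  proof -
    have "(\<lambda>p. of_real (bcf a p) * (w * cis t) ^ p) sums (1 - w * cis t) powr (of_real (- a))"
      using w by (intro binomial_series_complex) (simp add: norm_mult)
    then show ?thesis unfolding g_def by (intro sums_unique[symmetric] sums_mult)
  qed
  moreover have "(\<integral>t. g p t \<partial>circ) = of_real (bcf a p) * (\<integral>t. h t * (w * cis t) ^ p \<partial>circ)" for p
    unfolding g_def by (subst integral_mult_right_zero[symmetric]) (simp only: mult_ac)
  ultimately show ?thesis by simp
qed

text \<open>Up to the factor \<open>bcf a m\<close> this is the Gauss function
  \<open>2F1 (a, a + m; m + 1; q)\<close>.\<close>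

definition bcf_series :: "real \<Rightarrow> nat \<Rightarrow> real \<Rightarrow> real" where
  "bcf_series a m q = (\<Sum>p. bcf a p * bcf a (p + m) * q ^ p)"

lemma norm_powr_bound:
  fixes w :: complex
  assumes "0 < a" "norm w < 1"
  shows "norm (1 - w) powr (- a) \<le> (1 - norm w) powr (- a)"
proof (rule powr_mono2')
  show "1 - norm w \<le> norm (1 - w)" using norm_triangle_ineq2[of 1 w] by simp
qed (use assms in auto)

text \<open>The power of the distance is \<open>f * cnj f\<close> with
  \<open>f = (1 - w * cis t) powr (- a)\<close>. Both factors have binomial series, and
  orthogonality of the characters keeps only the terms whose indices differ by
  \<open>m\<close>.\<close>

lemma circle_mean:
  assumes a: "0 < a" and w: "norm w < 1"
  shows "(\<lambda>p. bcf a p * bcf a (p + m) * ((norm w)\<^sup>2) ^ (p + m)) sums (Re (\<integral>t. (w * cis t) ^ m * of_real (norm (1 - w * cis t) powr (- 2 * a)) \<partial>circ))"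
    and "Im (\<integral>t. (w * cis t) ^ m * of_real (norm (1 - w * cis t) powr (- 2 * a)) \<partial>circ) = 0"
proof -
  let ?h = "\<lambda>q. if m \<le> q then bcf a (q - m) * ((norm w)\<^sup>2) ^ q else 0"
  let ?I = "\<integral>t. (w * cis t) ^ m * of_real (norm (1 - w * cis t) powr (- 2 * a)) \<partial>circ"
  have [measurable]: "cis \<in> borel_measurable borel"
    by (intro borel_measurable_continuous_onI continuous_intros)
  have nz: "1 - w * cis t \<noteq> 0" for t
  proof
    assume "1 - w * cis t = 0"
    then have "norm (w * cis t) = 1" by (metis eq_iff_diff_eq_0 norm_one)
    then show False using w by (simp add: norm_mult)
  qed
  \<comment> \<open>The base stays in the right half-plane, off the branch cut of \<open>Ln\<close>,
    which makes \<open>f\<close> continuous and hence measurable.\<close>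
  have Re_pos: "Re (1 - w * cis t) > 0" for t
    using w complex_Re_le_cmod[of "w * cis t"] by (simp add: norm_mult)
  define f where "f = (\<lambda>t. (1 - w * cis t) powr (of_real (- a)))"
  have norm_f: "norm (f t) = norm (1 - w * cis t) powr (- a)" for t
    unfolding f_def by (subst norm_powr_real_powr') auto
  have fB: "norm (f t) \<le> (1 - norm w) powr (- a)" for t
    unfolding norm_f using norm_powr_bound[OF a, of "w * cis t"] w by (simp add: norm_mult)
  have fm [measurable]: "f \<in> borel_measurable borel"
  proof -
    have "continuous_on UNIV (\<lambda>t. exp (of_real (- a) * Ln (1 - w * cis t)))"
      using Re_pos by (intro continuous_intros) (auto simp: complex_nonpos_Reals_iff not_le less_imp_le)
    then have "continuous_on UNIV f"
      using nz by (simp add: f_def powr_def)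
    then show ?thesis by (rule borel_measurable_continuous_onI)
  qed
  \<comment> \<open>First expansion, of \<open>f\<close> against trigonometric monomials; by
    \<open>M\<close> at most the term \<open>p = q - m\<close> survives.\<close>
  have I1: "(\<lambda>p. of_real (bcf a p) * (\<integral>t. (w * cis t) ^ m * cnj (w * cis t) ^ q * (w * cis t) ^ p \<partial>circ)) sums
     (\<integral>t. (w * cis t) ^ m * cnj (w * cis t) ^ q * f t \<partial>circ)" for q
    unfolding f_def
  proof (rule circle_mean_series[OF a w])
    show "(\<lambda>t. (w * cis t) ^ m * cnj (w * cis t) ^ q) \<in> borel_measurable borel"
      by (intro borel_measurable_continuous_onI continuous_intros)
    show "norm ((w * cis t) ^ m * cnj (w * cis t) ^ q) \<le> norm w ^ m * norm w ^ q" for t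
      by (simp add: norm_mult norm_power)
  qed
  have M: "(\<integral>t. (w * cis t) ^ m * cnj (w * cis t) ^ q * (w * cis t) ^ p \<partial>circ) = (if m + p = q then of_real (((norm w)\<^sup>2) ^ q) else 0)" for p q
  proof -
    have "(\<integral>t. (w * cis t) ^ m * cnj (w * cis t) ^ q * (w * cis t) ^ p \<partial>circ) =
      (\<integral>t. (w ^ (m + p) * cnj w ^ q) * (cis t ^ (m + p) * cnj (cis t) ^ q) \<partial>circ)"
      by (intro Bochner_Integration.integral_cong refl) (simp add: power_mult_distrib power_add mult_ac)
    also have "\<dots> = (w ^ (m + p) * cnj w ^ q) * (if m + p = q then 1 else 0)"
      by (simp only: integral_mult_right_zero integral_cis_power)
    also have "\<dots> = (if m + p = q then of_real (((norm w)\<^sup>2) ^ q) else 0)"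
      by (simp add: power_mult_distrib[symmetric] complex_norm_square[symmetric])
    finally show ?thesis .
  qed
  have I2: "(\<integral>t. (w * cis t) ^ m * cnj (w * cis t) ^ q * f t \<partial>circ) = (if m \<le> q then of_real (bcf a (q - m) * ((norm w)\<^sup>2) ^ q) else 0)" for q
  proof -
    have "(\<lambda>p. of_real (bcf a p) * (if m + p = q then of_real (((norm w)\<^sup>2) ^ q) else 0)) sums
      (if m \<le> q then of_real (bcf a (q - m) * ((norm w)\<^sup>2) ^ q) else (0::complex))"
      using sums_finite[of "{q - m}" "\<lambda>p. of_real (bcf a p) * (if m + p = q then of_real (((norm w)\<^sup>2) ^ q) else 0) :: complex"]
      by (cases "m \<le> q") auto
    then show ?thesis using I1[of q] unfolding M by (rule sums_unique2[symmetric])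
  qed
  \<comment> \<open>Second expansion: now \<open>cnj\<close> of the power times \<open>f\<close>
    plays the role of \<open>h\<close>, and its moments are the conjugates of those in
    \<open>I2\<close>.\<close>
  have "(\<lambda>q. of_real (bcf a q) * (\<integral>t. cnj ((w * cis t) ^ m * f t) * (w * cis t) ^ q \<partial>circ)) sums
     (\<integral>t. cnj ((w * cis t) ^ m * f t) * f t \<partial>circ)"
  proof -
    have m1: "(\<lambda>t. cnj ((w * cis t) ^ m * f t)) \<in> borel_measurable borel"
      using measurable_compose[of "\<lambda>t. (w * cis t) ^ m * f t" borel borel cnj borel]
      by (simp add: borel_measurable_continuous_onI continuous_on_cnj)
    have m2: "norm (cnj ((w * cis t) ^ m * f t)) \<le> norm w ^ m * (1 - norm w) powr (- a)" for t
      using fB[of t] by (simp add: norm_mult norm_power mult_left_mono)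
    have fx: "(1 - w * cis t) powr (of_real (- a)) = f t" for t
      by (simp only: f_def)
    show ?thesis
      using circle_mean_series[OF a w m1 m2] unfolding fx .
  qed
  also have "(\<lambda>q. of_real (bcf a q) * (\<integral>t. cnj ((w * cis t) ^ m * f t) * (w * cis t) ^ q \<partial>circ)) =
     (\<lambda>q. of_real (bcf a q * (?h q)))"
  proof
    fix q
    have "(\<integral>t. cnj ((w * cis t) ^ m * f t) * (w * cis t) ^ q \<partial>circ) = cnj (\<integral>t. (w * cis t) ^ m * cnj (w * cis t) ^ q * f t \<partial>circ)"
      by (subst Bochner_Integration.integral_cnj[symmetric]) (simp add: mult_ac)
    then show "of_real (bcf a q) * (\<integral>t. cnj ((w * cis t) ^ m * f t) * (w * cis t) ^ q \<partial>circ) =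
       of_real (bcf a q * (?h q))"
      unfolding I2 by simp
  qed
  also have "(\<integral>t. cnj ((w * cis t) ^ m * f t) * f t \<partial>circ) = cnj ?I"
  proof (subst Bochner_Integration.integral_cnj[symmetric], intro Bochner_Integration.integral_cong refl)
    fix t
    have "f t * cnj (f t) = of_real ((norm (f t))\<^sup>2)"
      by (simp add: complex_norm_square[symmetric])
    also have "(norm (f t))\<^sup>2 = norm (1 - w * cis t) powr (- 2 * a)"
      using nz[of t] by (simp add: norm_f power2_eq_square powr_add[symmetric])
    finally show "cnj ((w * cis t) ^ m * f t) * f t = cnj ((w * cis t) ^ m * of_real (norm (1 - w * cis t) powr (- 2 * a)))"
      by (simp add: mult_ac)
  qed
  finally have S: "(\<lambda>q. complex_of_real (bcf a q * (?h q))) sums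
    cnj ?I" .
  from sums_Im[OF S] show "Im ?I = 0"
    by (simp add: sums_iff)
  from sums_Re[OF S] have "(\<lambda>q. bcf a q * (?h q)) sums
     Re ?I"
    by simp
  then have "(\<lambda>q. bcf a (q + m) * (if m \<le> q + m then bcf a (q + m - m) * ((norm w)\<^sup>2) ^ (q + m) else 0)) sums
     (Re ?I - (\<Sum>q<m. bcf a q * (?h q)))"
    by (rule sums_split_initial_segment)
  moreover have "(\<Sum>q<m. bcf a q * (?h q)) = 0"
    by (intro sum.neutral) auto
  ultimately show "(\<lambda>p. bcf a p * bcf a (p + m) * ((norm w)\<^sup>2) ^ (p + m)) sums (Re ?I)"
    by (simp add: mult_ac)
qed

text \<open>Read off from \<open>circle_mean\<close> at \<open>w = sqrt q\<close>. Removing the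
  extra factor \<open>q ^ m\<close> needs \<open>q\<close> nonzero, hence the case
  distinction.\<close>

lemma bcf_double_summable:
  assumes a: "0 < a" and q: "0 \<le> q" "q < 1"
  shows "summable (\<lambda>p. bcf a p * bcf a (p + m) * q ^ p)"
proof (cases "q = 0")
  case True
  then show ?thesis by (intro summable_finite[of "{0}"]) auto
next
  case False
  have "norm (of_real (sqrt q) :: complex) < 1" using q by simp
  from circle_mean(1)[OF a this, of m] have "summable (\<lambda>p. bcf a p * bcf a (p + m) * q ^ (p + m))"
    using q by (simp add: sums_iff)
  then have "summable (\<lambda>p. (bcf a p * bcf a (p + m) * q ^ (p + m)) * inverse (q ^ m))"
    by (rule summable_mult2)
  then show ?thesis using False by (simp add: power_add field_simps)
qed

lemma circle_mean_eq:
  assumes a: "0 < a" and w: "norm w < 1"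
  shows "(\<integral>t. (w * cis t) ^ m * of_real (norm (1 - w * cis t) powr (- 2 * a)) \<partial>circ) =
      of_real (((norm w)\<^sup>2) ^ m * bcf_series a m ((norm w)\<^sup>2))"
proof -
  have n: "(norm w)\<^sup>2 < 1" using w by (simp add: abs_square_less_1)
  have "(\<lambda>p. ((norm w)\<^sup>2) ^ m * (bcf a p * bcf a (p + m) * ((norm w)\<^sup>2) ^ p)) sums (((norm w)\<^sup>2) ^ m * bcf_series a m ((norm w)\<^sup>2))"
    unfolding bcf_series_def by (intro sums_mult summable_sums bcf_double_summable a n) simp
  then have "(\<lambda>p. bcf a p * bcf a (p + m) * ((norm w)\<^sup>2) ^ (p + m)) sums (((norm w)\<^sup>2) ^ m * bcf_series a m ((norm w)\<^sup>2))"
    by (simp add: power_add mult_ac)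
  from sums_unique2[OF this circle_mean(1)[OF a w]] circle_mean(2)[OF a w]
  show ?thesis by (simp add: complex_eq_iff)
qed

section \<open>The kernel of the circular mean as an Abel-type integral\<close>

lemma Beta_real_nonneg:
  fixes x y :: real shows "0 < x \<Longrightarrow> 0 < y \<Longrightarrow> 0 \<le> Beta x y"
  using Gamma_real_pos[of x] Gamma_real_pos[of y] Gamma_real_pos[of "x + y"] by (simp add: Beta_def)

lemma nn_integral_Beta:
  assumes "0 < x" "0 < y" "c < d"
  shows "(\<integral>\<^sup>+t. indicator {c<..<d} t * ennreal ((t - c) powr (x - 1) * (d - t) powr (y - 1)) \<partial>lborel) = ennreal ((d - c) powr (x + y - 1) * Beta x y)"
proof -
  have dc: "0 < d - c" using assms by simp
  have "(\<integral>\<^sup>+t. indicator {c<..<d} t * ennreal ((t - c) powr (x - 1) * (d - t) powr (y - 1)) \<partial>lborel) =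
     ennreal \<bar>d - c\<bar> * (\<integral>\<^sup>+t. indicator {c<..<d} (c + (d - c) * t) * ennreal ((c + (d - c) * t - c) powr (x - 1) * (d - (c + (d - c) * t)) powr (y - 1)) \<partial>lborel)"
    using dc by (intro nn_integral_real_affine) auto
  also have "(\<integral>\<^sup>+t. indicator {c<..<d} (c + (d - c) * t) * ennreal ((c + (d - c) * t - c) powr (x - 1) * (d - (c + (d - c) * t)) powr (y - 1)) \<partial>lborel) =
     (\<integral>\<^sup>+t. ennreal ((d - c) powr (x + y - 2)) * (ennreal (t powr (x - 1) * (1 - t) powr (y - 1)) * indicator {0<..<1} t) \<partial>lborel)"
  proof (intro nn_integral_cong)
    fix t :: real
    have 1: "c + (d - c) * t \<in> {c<..<d} \<longleftrightarrow> t \<in> {0<..<1}"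
    proof -
      have "c < c + (d - c) * t \<longleftrightarrow> 0 < t" using dc by (simp add: zero_less_mult_iff)
      moreover have "c + (d - c) * t < d \<longleftrightarrow> (d - c) * t < (d - c) * 1" by auto
      then have "c + (d - c) * t < d \<longleftrightarrow> t < 1" using dc by (simp only: mult_less_cancel_left_pos)
      ultimately show ?thesis by simp
    qed
    have 2: "indicator {c<..<d} (c + (d - c) * t) = (indicator {0<..<1} t :: ennreal)"
      unfolding indicator_def 1 ..
    show "indicator {c<..<d} (c + (d - c) * t) * ennreal ((c + (d - c) * t - c) powr (x - 1) * (d - (c + (d - c) * t)) powr (y - 1)) =
      ennreal ((d - c) powr (x + y - 2)) * (ennreal (t powr (x - 1) * (1 - t) powr (y - 1)) * indicator {0<..<1} t)"
    proof (cases "t \<in> {0<..<1}")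
      case True
      have "(c + (d - c) * t - c) powr (x - 1) * (d - (c + (d - c) * t)) powr (y - 1) =
        ((d - c) * t) powr (x - 1) * ((d - c) * (1 - t)) powr (y - 1)"
        by (simp add: algebra_simps)
      also have "\<dots> = (d - c) powr (x + y - 2) * (t powr (x - 1) * (1 - t) powr (y - 1))"
      proof -
        have "(d - c) powr (x + y - 2) = (d - c) powr (x - 1) * (d - c) powr (y - 1)"
          by (simp add: powr_add[symmetric] algebra_simps)
        then show ?thesis using True dc by (simp add: powr_mult)
      qed
      finally show ?thesis using True unfolding 2 by (simp add: ennreal_mult)
    next
      case False
      then show ?thesis unfolding 2 by simp
    qed
  qed
  also have "\<dots> = ennreal ((d - c) powr (x + y - 2)) * (\<integral>\<^sup>+t. ennreal (t powr (x - 1) * (1 - t) powr (y - 1)) * indicator {0<..<1} t \<partial>lborel)"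
    by (rule nn_integral_cmult) measurable
  also have "(\<integral>\<^sup>+t. ennreal (t powr (x - 1) * (1 - t) powr (y - 1)) * indicator {0<..<1} t \<partial>lborel) = ennreal (Beta x y)"
    using has_integral_Beta_real[OF assms(1,2)]
    by (intro nn_integral_has_integral_lebesgue') (auto simp: has_integral_Icc_iff_Ioo)
  also have "ennreal \<bar>d - c\<bar> * (ennreal ((d - c) powr (x + y - 2)) * ennreal (Beta x y)) = ennreal ((d - c) powr (x + y - 1) * Beta x y)"
  proof -
    have "\<bar>d - c\<bar> * (d - c) powr (x + y - 2) = (d - c) powr 1 * (d - c) powr (x + y - 2)"
      using dc by simp
    also have "\<dots> = (d - c) powr (x + y - 1)" by (simp only: powr_add[symmetric]) simp
    finally have "\<bar>d - c\<bar> * (d - c) powr (x + y - 2) = (d - c) powr (x + y - 1)" .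
    moreover have "0 \<le> Beta x y"
      using assms by (intro Beta_real_nonneg) auto
    ultimately show ?thesis by (simp add: ennreal_mult[symmetric] mult.assoc[symmetric])
  qed
  finally show ?thesis .
qed

text \<open>Up to constants, \<open>kern a m (r\<^sup>2) (\<rho>\<^sup>2)\<close> is the \<open>m\<close>-th angular Fourier coefficient of
  \<open>\<bar>x - y\<bar> powr (- 2 * a)\<close> on \<open>\<bar>x\<bar> = \<rho>\<close>, \<open>\<bar>y\<bar> = r\<close> (Copson). The factors \<open>s - t\<close> and
  \<open>R - t\<close> separate the two radii.\<close>

definition kern :: "real \<Rightarrow> nat \<Rightarrow> real \<Rightarrow> real \<Rightarrow> ennreal" where
  "kern a m s R = (\<integral>\<^sup>+t. indicator {0<..<min s R} t * ennreal (t powr (real m + a - 1) * (s - t) powr (- a) * (R - t) powr (- a)) \<partial>lborel)"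

lemma kern_commute: "kern a m s R = kern a m R s"
  unfolding kern_def by (simp add: min.commute mult_ac)

lemma Gamma_shift: "0 < a \<Longrightarrow> Gamma (a + real n) = pochhammer a n * Gamma (a :: real)"
  using pochhammer_Gamma[of a n] by (simp add: Gamma_real_pos[THEN less_imp_neq, symmetric] nonpos_Ints_def)

text \<open>Expanding \<open>(R - t) powr (- a)\<close> in \<open>t / R\<close> leaves Beta
  integrals over \<open>(0, s)\<close>, and \<open>Beta (m + p + a) (1 - a)\<close> is
  \<open>Gamma a * Gamma (1 - a) * bcf a (p + m)\<close>. All terms are nonnegative, so sum and
  integral commute.\<close>

lemma kern_series:
  assumes a: "0 < a" "a < 1" and s: "0 < s" "s < R"
  shows "kern a m s R = ennreal (R powr (- a) * s ^ m * Gamma a * Gamma (1 - a) * bcf_series a m (s / R))"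
proof -
  let ?G = "\<lambda>t. t powr (real m + a - 1) * (s - t) powr (- a) * (R - t) powr (- a)"
  let ?g = "\<lambda>p t. t powr (real m + real p + a - 1) * (s - t) powr (- a)"
  have R: "0 < R" using s by simp
  have "kern a m s R = (\<integral>\<^sup>+t. (\<Sum>p. ennreal (R powr (- a) * bcf a p / R ^ p) * (indicator {0<..<s} t * ennreal (?g p t))) \<partial>lborel)"
    unfolding kern_def
  proof (intro nn_integral_cong)
    fix t :: real
    have [simp]: "min s R = s" using s by simp
    show "indicator {0<..<min s R} t * ennreal (?G t) =
      (\<Sum>p. ennreal (R powr (- a) * bcf a p / R ^ p) * (indicator {0<..<s} t * ennreal (?g p t)))"
    proof (cases "t \<in> {0<..<s}")
      case True
      have q: "\<bar>t / R\<bar> < 1" using True s by simp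
      have "(\<lambda>p. t powr (real m + a - 1) * (s - t) powr (- a) * R powr (- a) * (bcf a p * (t / R) ^ p)) sums
         (t powr (real m + a - 1) * (s - t) powr (- a) * R powr (- a) * (1 - t / R) powr (- a))"
        by (intro sums_mult binomial_series_real q)
      also have "R powr (- a) * (1 - t / R) powr (- a) = (R - t) powr (- a)"
      proof -
        have "R - t = R * (1 - t / R)" using R by (simp add: field_simps)
        then show ?thesis using R q by (simp add: powr_mult)
      qed
      then have "t powr (real m + a - 1) * (s - t) powr (- a) * R powr (- a) * (1 - t / R) powr (- a) = t powr (real m + a - 1) * (s - t) powr (- a) * (R - t) powr (- a)"
        by (simp only: mult.assoc)
      also have "(\<lambda>p. t powr (real m + a - 1) * (s - t) powr (- a) * R powr (- a) * (bcf a p * (t / R) ^ p)) =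
        (\<lambda>p. R powr (- a) * bcf a p / R ^ p * (?g p t))"
      proof
        fix p
        have "t powr (real m + real p + a - 1) = t powr (real m + a - 1) * t ^ p"
          using True by (simp add: powr_realpow[symmetric] powr_add[symmetric] algebra_simps)
        then show "t powr (real m + a - 1) * (s - t) powr (- a) * R powr (- a) * (bcf a p * (t / R) ^ p) = R powr (- a) * bcf a p / R ^ p * (?g p t)"
          by (simp add: power_divide)
      qed
      finally have S: "(\<lambda>p. R powr (- a) * bcf a p / R ^ p * (?g p t)) sums (?G t)" .
      have nn: "0 \<le> R powr (- a) * bcf a p / R ^ p" for p
        using bcf_pos[OF a(1), of p] R by simp
      have "(\<Sum>p. ennreal (R powr (- a) * bcf a p / R ^ p * (?g p t))) = ennreal (?G t)"
        by (rule suminf_ennreal_eq[OF _ S], rule mult_nonneg_nonneg[OF nn]) simp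
      then have "(\<Sum>p. ennreal (R powr (- a) * bcf a p / R ^ p) * ennreal (?g p t)) = ennreal (?G t)"
        unfolding ennreal_mult'[OF nn] .
      then show ?thesis using True by simp
    qed simp
  qed
  also have "\<dots> = (\<Sum>p. ennreal (R powr (- a) * bcf a p / R ^ p) * (\<integral>\<^sup>+t. indicator {0<..<s} t * ennreal (?g p t) \<partial>lborel))"
    by (simp add: nn_integral_suminf nn_integral_cmult)
  also have "\<dots> = (\<Sum>p. ennreal (R powr (- a) * s ^ m * Gamma a * Gamma (1 - a) * (bcf a p * bcf a (p + m) * (s / R) ^ p)))"
  proof (intro suminf_cong)
    fix p
    have "(\<integral>\<^sup>+t. indicator {0<..<s} t * ennreal (?g p t) \<partial>lborel) = ennreal (s ^ (m + p) * Beta (real m + real p + a) (1 - a))"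
      using nn_integral_Beta[of "real m + real p + a" "1 - a" 0 s] a s
      by (simp add: powr_realpow[symmetric])
    moreover have "Beta (real m + real p + a) (1 - a) = Gamma a * Gamma (1 - a) * bcf a (p + m)"
      using Gamma_shift[OF a(1), of "p + m"] Gamma_fact[of "p + m", where 'a = real]
      by (simp add: Beta_def bcf_def add_ac)
    moreover have "0 \<le> R powr (- a) * bcf a p / R ^ p" using bcf_pos[OF a(1), of p] R by simp
    ultimately show "ennreal (R powr (- a) * bcf a p / R ^ p) * (\<integral>\<^sup>+t. indicator {0<..<s} t * ennreal (?g p t) \<partial>lborel) =
      ennreal (R powr (- a) * s ^ m * Gamma a * Gamma (1 - a) * (bcf a p * bcf a (p + m) * (s / R) ^ p))"
      by (simp add: ennreal_mult'[symmetric] power_add power_divide mult_ac)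
  qed
  also have "\<dots> = ennreal (R powr (- a) * s ^ m * Gamma a * Gamma (1 - a) * bcf_series a m (s / R))"
  proof (rule suminf_ennreal_eq)
    have "0 \<le> s / R" "s / R < 1" using s by auto
    then show "(\<lambda>p. R powr (- a) * s ^ m * Gamma a * Gamma (1 - a) * (bcf a p * bcf a (p + m) * (s / R) ^ p)) sums (R powr (- a) * s ^ m * Gamma a * Gamma (1 - a) * bcf_series a m (s / R))"
      unfolding bcf_series_def by (intro sums_mult summable_sums bcf_double_summable a)
    show "0 \<le> R powr (- a) * s ^ m * Gamma a * Gamma (1 - a) * (bcf a p * bcf a (p + m) * (s / R) ^ p)" for p
      using bcf_pos[OF a(1)] a s R by (auto intro!: mult_nonneg_nonneg Gamma_real_nonneg less_imp_le)
  qed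
  finally show ?thesis .
qed

lemma bcf_series_nonneg: "0 < a \<Longrightarrow> 0 \<le> q \<Longrightarrow> q < 1 \<Longrightarrow> 0 \<le> bcf_series a m q"
  unfolding bcf_series_def
  by (intro suminf_nonneg bcf_double_summable) (auto intro!: mult_nonneg_nonneg less_imp_le[OF bcf_pos])

text \<open>Scaling out the larger of the two radii reduces to \<open>circle_mean_eq\<close> at a
  point inside the unit disk, and \<open>kern_series\<close> recognizes the result. By symmetry of
  \<open>kern\<close> both cases give one formula; the prefactor is
  \<open>1 / cnj X ^ m\<close>.\<close>

lemma kern_mean:
  assumes a: "0 < a" "a < 1" and X: "X \<noteq> 0" and Y: "Y \<noteq> 0" and XY: "norm X \<noteq> norm Y"
  shows "(\<integral>t. (cis t * Y) ^ m * of_real (norm (X - cis t * Y) powr (- 2 * a)) \<partial>circ) =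
     (X / of_real ((norm X)\<^sup>2)) ^ m * of_real (enn2real (kern a m ((norm Y)\<^sup>2) ((norm X)\<^sup>2)) / (Gamma a * Gamma (1 - a)))"
    and "kern a m ((norm Y)\<^sup>2) ((norm X)\<^sup>2) < \<infinity>"
proof -
  let ?I = "\<integral>t. (cis t * Y) ^ m * of_real (norm (X - cis t * Y) powr (- 2 * a)) \<partial>circ"
  have G: "0 < Gamma a" "0 < Gamma (1 - a)" using a by (auto intro: Gamma_real_pos)
  define R where "R = (norm X)\<^sup>2"
  define s where "s = (norm Y)\<^sup>2"
  have pos: "0 < R" "0 < s" using X Y by (auto simp: R_def s_def)
  have sq: "norm Z powr (- 2 * a) = ((norm Z)\<^sup>2) powr (- a)" for Z :: complex
  proof (cases "Z = 0")
    case False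
    then have "(norm Z)\<^sup>2 = norm Z powr 2" by simp
    then have "((norm Z)\<^sup>2) powr (- a) = norm Z powr (2 * (- a))" by (simp only: powr_powr)
    then show ?thesis by simp
  qed simp
  have "?I =
     (X / of_real R) ^ m * of_real (enn2real (kern a m s R) / (Gamma a * Gamma (1 - a))) \<and> kern a m s R < \<infinity>"
  proof (cases "norm Y < norm X")
    case True
    define w where "w = Y / X"
    have w: "norm w < 1" using True X by (simp add: w_def norm_divide)
    have nw: "(norm w)\<^sup>2 = s / R" by (simp add: w_def s_def R_def norm_divide power_divide)
    have sR: "s < R" using True by (simp add: s_def R_def power_strict_mono)
    have "?I =
      (\<integral>t. (X ^ m * of_real (R powr (- a))) * ((w * cis t) ^ m * of_real (norm (1 - w * cis t) powr (- 2 * a))) \<partial>circ)"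
    proof (intro Bochner_Integration.integral_cong refl)
      fix t
      have 1: "cis t * Y = X * (w * cis t)" using X by (simp add: w_def)
      have 2: "X - cis t * Y = X * (1 - w * cis t)" using X by (simp add: w_def field_simps)
      have 3: "norm X powr (- 2 * a) = R powr (- a)" by (simp only: sq R_def)
      show "(cis t * Y) ^ m * of_real (norm (X - cis t * Y) powr (- 2 * a)) = (X ^ m * of_real (R powr (- a))) * ((w * cis t) ^ m * of_real (norm (1 - w * cis t) powr (- 2 * a)))"
        unfolding 2 unfolding 1 norm_mult[of X "1 - w * cis t"] powr_mult 3
        by (simp only: power_mult_distrib of_real_mult mult_ac)
    qed
    also have "\<dots> = (X ^ m * of_real (R powr (- a))) * of_real ((s / R) ^ m * bcf_series a m (s / R))"
      by (simp only: integral_mult_right_zero circle_mean_eq[OF a(1) w] nw)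
    also have "\<dots> = (X / of_real R) ^ m * of_real (R powr (- a) * s ^ m * bcf_series a m (s / R))"
      using pos by (simp add: power_divide)
    finally show ?thesis
      using kern_series[OF a pos(2) sR, of m] G pos bcf_series_nonneg[OF a(1), of "s / R" m] sR by simp
  next
    case False
    then have XlY: "norm X < norm Y" using XY by simp
    \<comment> \<open>Here \<open>cis t * Y\<close> is factored out of the difference. What remains
      is \<open>1 - X / (cis t * Y)\<close>, with the inverse rotation; its conjugate has the same
      norm and is \<open>1 - w * cis t\<close>.\<close>
    define w where "w = cnj (X / Y)"
    have w: "norm w < 1" using XlY Y by (simp add: w_def norm_divide)
    have nw: "(norm w)\<^sup>2 = R / s" by (simp add: w_def s_def R_def norm_divide power_divide)
    have Rs: "R < s" using XlY by (simp add: s_def R_def power_strict_mono)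
    have "?I =
      (\<integral>t. ((X * of_real (s / R)) ^ m * of_real (s powr (- a))) * ((w * cis t) ^ m * of_real (norm (1 - w * cis t) powr (- 2 * a))) \<partial>circ)"
    proof (intro Bochner_Integration.integral_cong refl)
      fix t
      have e: "of_real R = X * cnj X" "of_real s = Y * cnj Y" by (simp_all add: R_def s_def complex_norm_square[symmetric])
      have 0: "of_real (s / R) * X * w = Y"
        using X Y unfolding of_real_divide e w_def by (simp add: field_simps)
      have "(X * of_real (s / R)) * (w * cis t) = cis t * (of_real (s / R) * X * w)" by (simp only: mult_ac)
      then have 1: "cis t * Y = (X * of_real (s / R)) * (w * cis t)" unfolding 0 ..
      have "norm (X - cis t * Y) = norm (cis t * Y) * norm (1 - X / (cis t * Y))"
      proof -
        have "cis t * Y * (1 - X / (cis t * Y)) = cis t * Y - X"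
          using Y by (simp add: right_diff_distrib)
        then show ?thesis by (simp only: norm_mult[symmetric] norm_minus_commute[of X])
      qed
      also have "1 - X / (cis t * Y) = cnj (1 - w * cis t)"
        by (simp add: w_def cis_divide[symmetric] divide_inverse cis_inverse cis_cnj mult_ac)
      finally have 2: "norm (X - cis t * Y) = norm Y * norm (1 - w * cis t)"
        by (simp only: norm_mult norm_cis complex_mod_cnj mult_1)
      have 3: "norm Y powr (- 2 * a) = s powr (- a)" by (simp only: sq s_def)
      show "(cis t * Y) ^ m * of_real (norm (X - cis t * Y) powr (- 2 * a)) = ((X * of_real (s / R)) ^ m * of_real (s powr (- a))) * ((w * cis t) ^ m * of_real (norm (1 - w * cis t) powr (- 2 * a)))"
        unfolding 2 unfolding 1 powr_mult 3
        by (simp only: power_mult_distrib of_real_mult mult_ac)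
    qed
    also have "\<dots> = ((X * of_real (s / R)) ^ m * of_real (s powr (- a))) * of_real ((R / s) ^ m * bcf_series a m (R / s))"
      by (simp only: integral_mult_right_zero circle_mean_eq[OF a(1) w] nw)
    also have "\<dots> = (X / of_real R) ^ m * of_real (s powr (- a) * R ^ m * bcf_series a m (R / s))"
      using pos by (simp add: power_divide power_mult_distrib)
    finally show ?thesis
      using kern_series[OF a pos(1) Rs, of m] G pos bcf_series_nonneg[OF a(1), of "R / s" m] Rs by (simp add: kern_commute[of a m s R])
  qed
  then show "?I =
     (X / of_real ((norm X)\<^sup>2)) ^ m * of_real (enn2real (kern a m ((norm Y)\<^sup>2) ((norm X)\<^sup>2)) / (Gamma a * Gamma (1 - a)))"
    and "kern a m ((norm Y)\<^sup>2) ((norm X)\<^sup>2) < \<infinity>"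
    by (simp_all add: R_def s_def)
qed

lemma kern_measurable [measurable]: "(\<lambda>s. kern a m s R) \<in> borel_measurable borel"
proof -
  have "kern a m s R = (\<integral>\<^sup>+t. (if 0 < t \<and> t < s \<and> t < R then ennreal (t powr (real m + a - 1) * (s - t) powr (- a) * (R - t) powr (- a)) else 0) \<partial>lborel)" for s
    unfolding kern_def by (intro nn_integral_cong) (auto split: split_indicator)
  then show ?thesis by simp
qed

text \<open>The first fractional integral. After Tonelli the inner integral over \<open>s\<close> in
  \<open>(t, 1)\<close> is a Beta integral, and the weight exponent \<open>a - 1\<close> is exactly
  what cancels the \<open>- a\<close> of the kernel, leaving the pure power
  \<open>(1 - t) ^ i\<close>.\<close>

lemma kern_weighted_integral:
  assumes a: "0 < a" "a < 1" and R: "R < 1"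
  shows "(\<integral>\<^sup>+s. indicator {0<..<1} s * (ennreal ((1 - s) powr (a - 1 + real i)) * kern a m s R) \<partial>lborel) =
    ennreal (Beta (1 - a) (a + real i)) * (\<integral>\<^sup>+t. indicator {0<..<R} t * ennreal (t powr (real m + a - 1) * (R - t) powr (- a) * (1 - t) ^ i) \<partial>lborel)"
proof -
  let ?w = "\<lambda>s. (1 - s) powr (a - 1 + real i)"
  let ?G = "\<lambda>s t. t powr (real m + a - 1) * (s - t) powr (- a) * (R - t) powr (- a)"
  have B: "0 \<le> Beta (1 - a) (a + real i)"
    using a by (intro Beta_real_nonneg) auto
  have "(\<integral>\<^sup>+s. indicator {0<..<1} s * (ennreal (?w s) * kern a m s R) \<partial>lborel) =
    (\<integral>\<^sup>+s. (\<integral>\<^sup>+t. indicator {0<..<1} s * ennreal (?w s) * (indicator {0<..<min s R} t * ennreal (?G s t)) \<partial>lborel) \<partial>lborel)"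
    unfolding kern_def by (subst nn_integral_cmult) (auto simp: mult.assoc)
  also have "\<dots> = (\<integral>\<^sup>+t. (\<integral>\<^sup>+s. indicator {0<..<1} s * ennreal (?w s) * (indicator {0<..<min s R} t * ennreal (?G s t)) \<partial>lborel) \<partial>lborel)"
  proof -
    have "(\<lambda>(t, s). if 0 < s \<and> s < 1 \<and> 0 < t \<and> t < s \<and> t < R then ennreal (?w s) * ennreal (?G s t) else 0) \<in> borel_measurable (lborel \<Otimes>\<^sub>M lborel)"
      by measurable
    moreover have "(if 0 < s \<and> s < 1 \<and> 0 < t \<and> t < s \<and> t < R then ennreal (?w s) * ennreal (?G s t) else 0) =
      indicator {0<..<1} s * ennreal (?w s) * (indicator {0<..<min s R} t * ennreal (?G s t))" for s t
      by (auto split: split_indicator)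
    ultimately show ?thesis by (intro lborel_pair.Fubini') (simp add: case_prod_unfold)
  qed
  also have "\<dots> = (\<integral>\<^sup>+t. ennreal (Beta (1 - a) (a + real i)) * (indicator {0<..<R} t * ennreal (t powr (real m + a - 1) * (R - t) powr (- a) * (1 - t) ^ i)) \<partial>lborel)"
  proof (intro nn_integral_cong)
    fix t :: real
    show "(\<integral>\<^sup>+s. indicator {0<..<1} s * ennreal (?w s) * (indicator {0<..<min s R} t * ennreal (?G s t)) \<partial>lborel) =
      ennreal (Beta (1 - a) (a + real i)) * (indicator {0<..<R} t * ennreal (t powr (real m + a - 1) * (R - t) powr (- a) * (1 - t) ^ i))"
    proof (cases "t \<in> {0<..<R}")
      case False
      then have "indicator {0<..<min s R} t = (0::ennreal)" for s by auto
      then show ?thesis using False by simp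
    next
      case True
      then have t: "0 < t" "t < R" "t < 1" using R by auto
      have "(\<integral>\<^sup>+s. indicator {0<..<1} s * ennreal (?w s) * (indicator {0<..<min s R} t * ennreal (?G s t)) \<partial>lborel) =
        (\<integral>\<^sup>+s. ennreal (t powr (real m + a - 1) * (R - t) powr (- a)) * (indicator {t<..<1} s * ennreal ((s - t) powr (1 - a - 1) * (1 - s) powr (a + real i - 1))) \<partial>lborel)"
        using t by (intro nn_integral_cong) (auto simp: ennreal_mult[symmetric] algebra_simps split: split_indicator)
      also have "\<dots> = ennreal (t powr (real m + a - 1) * (R - t) powr (- a)) * ennreal ((1 - t) powr (1 - a + (a + real i) - 1) * Beta (1 - a) (a + real i))"
        using a t by (subst nn_integral_cmult, measurable, subst nn_integral_Beta) auto
      also have "(1 - t) powr (1 - a + (a + real i) - 1) = (1 - t) ^ i"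
        using t by (simp add: powr_realpow)
      finally show ?thesis using t B by (simp add: ennreal_mult[symmetric] mult_ac)
    qed
  qed
  also have "\<dots> = ennreal (Beta (1 - a) (a + real i)) * (\<integral>\<^sup>+t. indicator {0<..<R} t * ennreal (t powr (real m + a - 1) * (R - t) powr (- a) * (1 - t) ^ i) \<partial>lborel)"
    by (rule nn_integral_cmult) measurable
  finally show ?thesis .
qed

section \<open>Riesz potentials of weighted Jacobi polynomials\<close>

lemma kern_moment_finite:
  assumes a: "0 < a" "a < 1" and R: "0 < R" "R < 1"
  shows "(\<integral>\<^sup>+t. indicator {0<..<R} t * ennreal (t powr (real m + a - 1) * (R - t) powr (- a) * (1 - t) ^ i) \<partial>lborel) < \<infinity>"
proof -
  have "(\<integral>\<^sup>+t. indicator {0<..<R} t * ennreal (t powr (real m + a - 1) * (R - t) powr (- a) * (1 - t) ^ i) \<partial>lborel) \<le>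
     (\<integral>\<^sup>+t. indicator {0<..<R} t * ennreal ((t - 0) powr (real m + a - 1) * (R - t) powr (1 - a - 1)) \<partial>lborel)"
    using R by (intro nn_integral_mono) (auto intro!: ennreal_leI mult_right_le_one_le simp: power_le_one split: split_indicator)
  also have "\<dots> < \<infinity>"
    using a R by (subst nn_integral_Beta) auto
  finally show ?thesis .
qed

lemma ennreal_enn2real_mult: "x < \<infinity> \<Longrightarrow> 0 \<le> r \<Longrightarrow> ennreal (enn2real x * r) = x * ennreal r"
  by (simp add: ennreal_mult less_top)

text \<open>Discards the circle through \<open>x\<close>, on which \<open>kern_mean\<close> says
  nothing.\<close>

lemma AE_norm_neq: "AE y in lborel. norm (y :: real^2) \<noteq> r"
proof -
  have "negligible (sphere (0 :: real^2) r)" by (rule negligible_sphere)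
  then have "sphere (0 :: real^2) r \<in> null_sets lborel"
    by (auto simp: null_sets_completion_iff negligible_iff_null_sets)
  then have "AE y in lborel. y \<notin> sphere (0 :: real^2) r" by (rule AE_not_in)
  then show ?thesis by eventually_elim simp
qed

text \<open>Averaging over rotations replaces the kernel by \<open>kern\<close>, the law of
  \<open>r^2\<close> reduces to one variable, and \<open>kern_weighted_integral\<close> performs the
  outer integration. The second fractional integral is still left unevaluated.\<close>

lemma riesz_monomial:
  fixes x :: "real^2"
  assumes a: "0 < a" "a < 1" and x: "x \<noteq> 0" "norm x < 1"
  defines "R \<equiv> (norm x)\<^sup>2"
  defines "F \<equiv> \<lambda>i m y. of_real (indicator unit_disk y * (1 - (norm y)\<^sup>2) powr (a - 1 + real i) * norm (x - y) powr (- 2 * a)) * cz y ^ m"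
  shows "integrable lborel (F i m)"
    and "(\<integral>y. F i m y \<partial>lborel) = (cz x / of_real R) ^ m * of_real (pi / (Gamma a * Gamma (1 - a)) * Beta (1 - a) (a + real i) *
       enn2real (\<integral>\<^sup>+t. indicator {0<..<R} t * ennreal (t powr (real m + a - 1) * (R - t) powr (- a) * (1 - t) ^ i) \<partial>lborel))"
proof -
  have R: "0 < R" "R < 1" using x by (auto simp: R_def abs_square_less_1)
  have G: "0 < Gamma a * Gamma (1 - a)" using a by (auto intro!: Gamma_real_pos mult_pos_pos)
  define Q where "Q = (\<lambda>m. \<integral>\<^sup>+t. indicator {0<..<R} t * ennreal (t powr (real m + a - 1) * (R - t) powr (- a) * (1 - t) ^ i) \<partial>lborel)"
  define \<omega> where "\<omega> = (\<lambda>s::real. (1 - s) powr (a - 1 + real i))"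
  define h where "h = (\<lambda>m s. ennreal (\<omega> s) * kern a m s R * ennreal (1 / (Gamma a * Gamma (1 - a))))"
  have [measurable]: "\<omega> \<in> borel_measurable borel" "h m \<in> borel_measurable borel" for m
    unfolding \<omega>_def h_def by measurable
  let ?H = "\<lambda>m y. indicator unit_disk y * h m ((norm y)\<^sup>2)"
  have Qfin: "Q m < \<infinity>" for m unfolding Q_def by (rule kern_moment_finite[OF a R])
  have H: "(\<integral>\<^sup>+y. indicator unit_disk y * h m ((norm y)\<^sup>2) \<partial>(lborel :: (real^2) measure)) = ennreal (pi / (Gamma a * Gamma (1 - a)) * Beta (1 - a) (a + real i)) * Q m" for m
  proof -
    have "(\<integral>\<^sup>+y. indicator unit_disk y * h m ((norm y)\<^sup>2) \<partial>(lborel :: (real^2) measure)) = ennreal pi * (\<integral>\<^sup>+s. ennreal (1 / (Gamma a * Gamma (1 - a))) * (indicator {0<..<1} s * (ennreal ((1 - s) powr (a - 1 + real i)) * kern a m s R)) \<partial>lborel)"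
      by (subst nn_integral_radial) (auto simp: h_def \<omega>_def mult_ac)
    also have "\<dots> = ennreal pi * (ennreal (1 / (Gamma a * Gamma (1 - a))) * (ennreal (Beta (1 - a) (a + real i)) * Q m))"
      by (subst nn_integral_cmult, measurable) (simp only: kern_weighted_integral[OF a R(2)] Q_def)
    also have "\<dots> = ennreal (pi / (Gamma a * Gamma (1 - a)) * Beta (1 - a) (a + real i)) * Q m"
      using G by (simp add: ennreal_mult'[symmetric] mult.assoc[symmetric])
    finally show ?thesis .
  qed
  define k where "k = (\<lambda>y. norm (x - y) powr (- 2 * a))"
  have [measurable]: "k \<in> borel_measurable borel" unfolding k_def by measurable
  have ae: "AE y in lborel. norm (y :: real^2) \<noteq> norm x \<and> y \<noteq> 0"
    using AE_norm_neq[of "norm x"] AE_norm_neq[of 0] by eventually_elim auto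
  have krot: "k (rot t y) = norm (cz x - cis t * cz y) powr (- 2 * a)" for t y
    unfolding k_def norm_cz[symmetric] by simp
  have ki: "integrable circ (\<lambda>t. k (rot t y))" if "norm y \<noteq> norm x" for y
  proof (rule circ.integrable_const_bound)
    show "AE t in circ. norm (k (rot t y)) \<le> \<bar>norm x - norm y\<bar> powr (- 2 * a)"
    proof (intro AE_I2)
      fix t
      have "\<bar>norm x - norm y\<bar> \<le> norm (x - rot t y)"
        using norm_triangle_ineq3[of x "rot t y"] by simp
      then show "norm (k (rot t y)) \<le> \<bar>norm x - norm y\<bar> powr (- 2 * a)"
        unfolding k_def using a that by (simp add: powr_mono2')
    qed
  qed measurable
  have mean: "(\<integral>t. (cz (rot t y)) ^ m * of_real (k (rot t y)) \<partial>circ) = (cz x / of_real R) ^ m * of_real (enn2real (kern a m ((norm y)\<^sup>2) R) / (Gamma a * Gamma (1 - a)))"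
     "kern a m ((norm y)\<^sup>2) R < \<infinity>" if "norm y \<noteq> norm x \<and> y \<noteq> 0" for y m
    using kern_mean[OF a, of "cz x" "cz y" m] that x by (simp_all add: krot R_def)
  \<comment> \<open>Absolute integrability is settled at \<open>m = 0\<close>; since
    \<open>norm (cz y) \<le> 1\<close> on the disk, that case dominates all other
    \<open>m\<close>.\<close>
  have "(\<integral>\<^sup>+y. ennreal (indicator unit_disk y * \<omega> ((norm y)\<^sup>2) * k y) \<partial>lborel) =
     (\<integral>\<^sup>+y. (\<integral>\<^sup>+t. ennreal (indicator unit_disk y * \<omega> ((norm y)\<^sup>2)) * ennreal (k (rot t y)) \<partial>circ) \<partial>lborel)"
    by (subst nn_integral_rot_average) (auto simp: \<omega>_def k_def ennreal_mult indicator_def)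
  also have "\<dots> = (\<integral>\<^sup>+y. indicator unit_disk y * h 0 ((norm y)\<^sup>2) \<partial>lborel)"
  proof (intro nn_integral_cong_AE)
    show "AE y in lborel. (\<integral>\<^sup>+t. ennreal (indicator unit_disk y * \<omega> ((norm y)\<^sup>2)) * ennreal (k (rot t y)) \<partial>circ) = indicator unit_disk y * h 0 ((norm y)\<^sup>2)"
      using ae
    proof eventually_elim
      case (elim y)
      have "(\<integral>\<^sup>+t. ennreal (k (rot t y)) \<partial>circ) = ennreal (\<integral>t. k (rot t y) \<partial>circ)"
        using elim by (intro nn_integral_eq_integral ki) (auto simp: k_def)
      also have "(\<integral>t. k (rot t y) \<partial>circ) = enn2real (kern a 0 ((norm y)\<^sup>2) R) / (Gamma a * Gamma (1 - a))"
        using mean(1)[OF elim, of 0] by (simp del: of_real_divide of_real_mult)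
      also have "ennreal \<dots> = kern a 0 ((norm y)\<^sup>2) R * ennreal (1 / (Gamma a * Gamma (1 - a)))"
        using ennreal_enn2real_mult[OF mean(2)[OF elim, of 0], of "1 / (Gamma a * Gamma (1 - a))"] G by simp
      finally have "(\<integral>\<^sup>+t. ennreal (k (rot t y)) \<partial>circ) = kern a 0 ((norm y)\<^sup>2) R * ennreal (1 / (Gamma a * Gamma (1 - a)))" .
      then show ?case
        by (subst nn_integral_cmult) (auto simp: h_def mult.assoc split: split_indicator)
    qed
  qed
  also have "\<dots> < \<infinity>"
    unfolding H using Qfin[of 0] by (simp add: ennreal_mult_less_top)
  finally have fin: "(\<integral>\<^sup>+y. ennreal (indicator unit_disk y * \<omega> ((norm y)\<^sup>2) * k y) \<partial>lborel) < \<infinity>" .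
  have F_eq: "F i m y = of_real (indicator unit_disk y * \<omega> ((norm y)\<^sup>2)) * (cz y ^ m * of_real (k y))" for m y
    by (simp add: F_def \<omega>_def k_def)
  have Fm [measurable]: "F i m \<in> borel_measurable borel" for m
    unfolding F_eq by measurable
  show Fint: "integrable lborel (F i m)" for m
  proof (rule integrableI_bounded)
    have "(\<integral>\<^sup>+y. ennreal (norm (F i m y)) \<partial>lborel) \<le> (\<integral>\<^sup>+y. ennreal (indicator unit_disk y * \<omega> ((norm y)\<^sup>2) * k y) \<partial>lborel)"
    proof (intro nn_integral_mono ennreal_leI)
      fix y :: "real^2"
      show "norm (F i m y) \<le> indicator unit_disk y * \<omega> ((norm y)\<^sup>2) * k y"
        unfolding F_eq
        by (auto simp: norm_mult norm_power \<omega>_def k_def intro!: mult_left_mono mult_left_le_one_le power_le_one split: split_indicator)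
    qed
    then show "(\<integral>\<^sup>+y. ennreal (norm (F i m y)) \<partial>lborel) < \<infinity>"
      using fin by (rule le_less_trans)
  qed simp
  have "(\<integral>y. F i m y \<partial>lborel) = (\<integral>y. (\<integral>t. F i m (rot t y) \<partial>circ) \<partial>lborel)"
    by (rule integral_rot_average[OF Fint])
  also have "\<dots> = (\<integral>y. (cz x / of_real R) ^ m * of_real (enn2real (?H m y)) \<partial>lborel)"
  proof (rule integral_cong_AE)
    show "(\<lambda>y. \<integral>t. F i m (rot t y) \<partial>circ) \<in> borel_measurable lborel"
      by measurable
    show "AE y in lborel. (\<integral>t. F i m (rot t y) \<partial>circ) = (cz x / of_real R) ^ m * of_real (enn2real (?H m y))"
      using ae
    proof eventually_elim
      case (elim y)
      have "(\<integral>t. F i m (rot t y) \<partial>circ) = of_real (indicator unit_disk y * \<omega> ((norm y)\<^sup>2)) * (\<integral>t. (cz (rot t y)) ^ m * of_real (k (rot t y)) \<partial>circ)"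
        unfolding F_eq by (subst integral_mult_right_zero[symmetric]) (simp add: indicator_def)
      also have "\<dots> = (cz x / of_real R) ^ m * of_real (enn2real (?H m y))"
        unfolding mean(1)[OF elim]
        using G by (auto simp: h_def enn2real_mult \<omega>_def split: split_indicator)
      finally show ?case .
    qed
  qed measurable
  also have "\<dots> = (cz x / of_real R) ^ m * of_real (\<integral>y. enn2real (?H m y) \<partial>(lborel :: (real^2) measure))"
    by (simp only: integral_mult_right_zero integral_complex_of_real)
  also have "(\<integral>y. enn2real (?H m y) \<partial>(lborel :: (real^2) measure)) = enn2real (\<integral>\<^sup>+y. ennreal (enn2real (?H m y)) \<partial>(lborel :: (real^2) measure))"
    by (rule integral_eq_nn_integral) auto
  also have "(\<integral>\<^sup>+y. ennreal (enn2real (?H m y)) \<partial>(lborel :: (real^2) measure)) = (\<integral>\<^sup>+y. indicator unit_disk y * h m ((norm y)\<^sup>2) \<partial>(lborel :: (real^2) measure))"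
  proof (intro nn_integral_cong_AE)
    show "AE y in (lborel :: (real^2) measure). ennreal (enn2real (?H m y)) = indicator unit_disk y * h m ((norm y)\<^sup>2)"
      using ae
    proof eventually_elim
      case (elim y)
      show ?case using mean(2)[OF elim, of m] G
        by (intro ennreal_enn2real) (auto simp: h_def ennreal_mult_less_top split: split_indicator)
    qed
  qed
  also have "enn2real \<dots> = pi / (Gamma a * Gamma (1 - a)) * Beta (1 - a) (a + real i) * enn2real (Q m)"
  proof -
    have "0 \<le> Beta (1 - a) (a + real i)"
      using a by (intro Beta_real_nonneg) auto
    then show ?thesis unfolding H using G by (simp add: enn2real_mult)
  qed
  finally show "(\<integral>y. F i m y \<partial>lborel) = (cz x / of_real R) ^ m * of_real (pi / (Gamma a * Gamma (1 - a)) * Beta (1 - a) (a + real i) *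
       enn2real (\<integral>\<^sup>+t. indicator {0<..<R} t * ennreal (t powr (real m + a - 1) * (R - t) powr (- a) * (1 - t) ^ i) \<partial>lborel))"
    unfolding Q_def .
qed

text \<open>The right-hand side has lost all dependence on \<open>i\<close> except in the factorial:
  multiplying by a Gamma factor trades the parameter \<open>a - 1\<close> for the parameter 0, which
  is how a fractional integral shifts Jacobi parameters.\<close>

lemma gbinomial_Gamma_quotient:
  assumes "0 < a" "i \<le> n"
  shows "((real n + (a - 1)) gchoose (n - i)) * Gamma (a + real i) = Gamma (a + real n) / fact (n - i)"
proof -
  have "((real n + (a - 1)) gchoose (n - i)) = pochhammer (a + real i) (n - i) / fact (n - i)"
    using assms by (simp add: gbinomial_pochhammer' of_nat_diff algebra_simps)
  moreover have "Gamma (a + real n) = pochhammer (a + real i) (n - i) * Gamma (a + real i)"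
    using Gamma_shift[of "a + real i" "n - i"] assms by (simp add: of_nat_diff add_ac)
  ultimately show ?thesis by simp
qed

lemma integrable_Beta_interval:
  fixes x y R :: real
  assumes "0 < x" "0 < y" "0 < R"
  shows "integrable lborel (\<lambda>t. indicator {0<..<R} t * (t powr (x - 1) * (R - t) powr (y - 1)))"
    and "(\<integral>t. indicator {0<..<R} t * (t powr (x - 1) * (R - t) powr (y - 1)) \<partial>lborel) = R powr (x + y - 1) * Beta x y"
proof -
  have B: "0 \<le> Beta x y"
    using assms by (intro Beta_real_nonneg)
  have *: "(\<integral>\<^sup>+t. ennreal (indicator {0<..<R} t * (t powr (x - 1) * (R - t) powr (y - 1))) \<partial>lborel) = ennreal (R powr (x + y - 1) * Beta x y)"
  proof -
    have "ennreal (indicator {0<..<R} t * (t powr (x - 1) * (R - t) powr (y - 1))) = indicator {0<..<R} t * ennreal ((t - 0) powr (x - 1) * (R - t) powr (y - 1))" for t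
      by (simp split: split_indicator)
    then show ?thesis using nn_integral_Beta[OF assms] by simp
  qed
  show "integrable lborel (\<lambda>t. indicator {0<..<R} t * (t powr (x - 1) * (R - t) powr (y - 1)))"
    by (rule integrableI_nn_integral_finite[OF _ _ *]) (auto simp: B)
  show "(\<integral>t. indicator {0<..<R} t * (t powr (x - 1) * (R - t) powr (y - 1)) \<partial>lborel) = R powr (x + y - 1) * Beta x y"
    by (subst integral_eq_nn_integral) (auto simp: * B)
qed

text \<open>The integral in \<open>s\<close> is diagonal in powers of \<open>1 - s\<close> and the one in \<open>t\<close> in powers of \<open>t\<close>;
  between them the parameters are \<open>(0, a + m - 1)\<close>, and \<open>jac_reflect\<close> switches the expansion point.\<close>

theorem riesz_jacobi:
  fixes x :: "real^2"
  assumes a: "0 < a" "a < 1" and x: "x \<noteq> 0" "norm x < 1"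
  defines "F \<equiv> \<lambda>n m y. of_real (indicator unit_disk y * (1 - (norm y)\<^sup>2) powr (a - 1) * jac n (a - 1) (real m) ((norm y)\<^sup>2) * norm (x - y) powr (- 2 * a)) * cz y ^ m"
  shows "integrable lborel (F n m)"
    and "(\<integral>y. F n m y \<partial>lborel) = of_real (pi * Gamma (1 - a) / Gamma a * (Gamma (a + real n) * Gamma (a + real (n + m)) / (fact n * fact (n + m)))
       * jac n (a - 1) (real m) ((norm x)\<^sup>2)) * cz x ^ m"
proof -
  define R where "R = (norm x)\<^sup>2"
  have R: "0 < R" "R < 1" using x by (auto simp: R_def abs_square_less_1)
  have G: "0 < Gamma a" "0 < Gamma (1 - a)" using a by (auto intro!: Gamma_real_pos)
  \<comment> \<open>The parameter pairs \<open>(a - 1, m)\<close> and \<open>(0, a + m - 1)\<close>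
    have the same sum, hence the same Pochhammer factor. Below, \<open>p\<close> and
    \<open>q\<close> are their coefficients in powers of \<open>1 - s\<close>, and \<open>g\<close>
    and \<open>f\<close> those in powers of \<open>s\<close>.\<close>
  define P where "P = pochhammer (real n + a + real m)"
  define p where "p = (\<lambda>i. (- 1) ^ i * (P i * ((real n + (a - 1)) gchoose (n - i)) / fact i))"
  define q where "q = (\<lambda>i. (- 1) ^ i * (P i * (real n gchoose (n - i)) / fact i))"
  define f where "f = (\<lambda>j. (- 1) ^ n * ((- 1) ^ j * (P j * ((real n + (a + real m - 1)) gchoose (n - j)) / fact j)))"
  define g where "g = (\<lambda>j. (- 1) ^ n * ((- 1) ^ j * (P j * (real (n + m) gchoose (n - j)) / fact j)))"
  have sgn: "(s - 1) ^ i = (- 1) ^ i * (1 - s) ^ i" for s :: real and i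
    by (subst power_mult_distrib[symmetric]) simp
  have neg: "(- s) ^ i = (- 1) ^ i * s ^ i" for s :: real and i
    by (rule power_minus)
  have jp: "jac n (a - 1) (real m) s = (\<Sum>i\<le>n. p i * (1 - s) ^ i)" for s
    unfolding jac_taylor sgn p_def P_def by (intro sum.cong refl) (simp add: add_ac)
  have jq: "jac n 0 (a + real m - 1) s = (\<Sum>i\<le>n. q i * (1 - s) ^ i)" for s
    unfolding jac_taylor sgn q_def P_def by (intro sum.cong refl) (simp add: add_ac)
  have jf: "jac n 0 (a + real m - 1) s = (\<Sum>j\<le>n. f j * s ^ j)" for s
    unfolding jac_reflect[of n 0] unfolding jac_taylor f_def P_def sum_distrib_left by (intro sum.cong refl) (simp add: add_ac neg[of s])
  have jg: "jac n (a - 1) (real m) s = (\<Sum>j\<le>n. g j * s ^ j)" for s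
    unfolding jac_reflect[of n "a - 1"] unfolding jac_taylor g_def P_def sum_distrib_left by (intro sum.cong refl) (simp add: add_ac neg[of s])
  define C where "C = Gamma (1 - a) * Gamma (a + real n) / fact n"
  define D where "D = Gamma (1 - a) * Gamma (a + real (n + m)) / fact (n + m)"
  \<comment> \<open>The multipliers of the \<open>s\<close>-integral carry the coefficients of
    \<open>(a - 1, m)\<close> to those of \<open>(0, a + m - 1)\<close>, up to the common constant
    \<open>C\<close>.\<close>
  have pq: "p i * Beta (1 - a) (a + real i) = C * q i" if i: "i \<le> n" for i
  proof -
    have 1: "(real n gchoose (n - i)) = fact n / (fact (n - i) * fact i)"
      using i binomial_fact[of "n - i" n, where 'a = real] by (simp add: binomial_gbinomial[symmetric])
    have 2: "Beta (1 - a) (a + real i) = Gamma (1 - a) * Gamma (a + real i) / fact i"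
      using Gamma_fact[of i, where 'a = real] by (simp add: Beta_def add_ac)
    have "p i * Beta (1 - a) (a + real i) = (- 1) ^ i * P i / fact i * Gamma (1 - a) / fact i * (((real n + (a - 1)) gchoose (n - i)) * Gamma (a + real i))"
      unfolding p_def 2 by simp
    also have "\<dots> = C * q i"
      unfolding gbinomial_Gamma_quotient[OF a(1) i] q_def C_def 1 by (simp add: mult_ac)
    finally show ?thesis .
  qed
  \<comment> \<open>The multipliers of the \<open>t\<close>-integral lead back from
    \<open>(0, a + m - 1)\<close> to \<open>(a - 1, m)\<close>, with constant \<open>D\<close>; so
    the polynomial reproduces itself.\<close>
  have fg: "f j * Beta (a + real (m + j)) (1 - a) = D * g j" if j: "j \<le> n" for j
  proof -
    have 1: "(real (n + m) gchoose (n - j)) = fact (n + m) / (fact (n - j) * fact (m + j))"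
      unfolding binomial_gbinomial[symmetric] using j by (subst binomial_fact) (auto simp: add_ac)
    have 2: "Beta (a + real (m + j)) (1 - a) = Gamma (1 - a) * Gamma (a + real m + real j) / fact (m + j)"
      using Gamma_fact[of "m + j", where 'a = real] by (simp add: Beta_def add_ac)
    have 3: "((real n + (a + real m - 1)) gchoose (n - j)) * Gamma (a + real m + real j) = Gamma (a + real (n + m)) / fact (n - j)"
      using gbinomial_Gamma_quotient[OF _ j, of "a + real m"] a by (simp add: add_ac)
    have "f j * Beta (a + real (m + j)) (1 - a) = (- 1) ^ n * (- 1) ^ j * P j / fact j * Gamma (1 - a) / fact (m + j) * (((real n + (a + real m - 1)) gchoose (n - j)) * Gamma (a + real m + real j))"
      unfolding f_def 2 by simp
    also have "\<dots> = D * g j"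
      unfolding 3 g_def D_def 1 by (simp add: mult_ac)
    finally show ?thesis .
  qed
  define Fi where "Fi = (\<lambda>i y. of_real (indicator unit_disk y * (1 - (norm y)\<^sup>2) powr (a - 1 + real i) * norm (x - y) powr (- 2 * a)) * cz y ^ m)"
  have F_sum: "F n m = (\<lambda>y. \<Sum>i\<le>n. of_real (p i) * Fi i y)"
  proof
    fix y :: "real^2"
    show "F n m y = (\<Sum>i\<le>n. of_real (p i) * Fi i y)"
    proof (cases "norm y < 1")
      case True
      then have "0 < 1 - (norm y)\<^sup>2" by (simp add: abs_square_less_1)
      then have "(1 - (norm y)\<^sup>2) powr (a - 1 + real i) = (1 - (norm y)\<^sup>2) powr (a - 1) * (1 - (norm y)\<^sup>2) ^ i" for i
        by (simp add: powr_add powr_realpow)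
      then show ?thesis
        unfolding F_def Fi_def jp by (simp add: sum_distrib_left sum_distrib_right mult_ac)
    qed (simp add: F_def Fi_def)
  qed
  define k where "k = (\<lambda>t. indicator {0<..<R} t * (t powr (a + real m - 1) * (R - t) powr (- a)))"
  have k: "integrable lborel (\<lambda>t. k t * t ^ j)" "(\<integral>t. k t * t ^ j \<partial>lborel) = R ^ (m + j) * Beta (a + real (m + j)) (1 - a)" for j
  proof -
    have "(\<lambda>t. k t * t ^ j) = (\<lambda>t. indicator {0<..<R} t * (t powr ((a + real (m + j)) - 1) * (R - t) powr ((1 - a) - 1)))"
      by (auto simp: k_def fun_eq_iff powr_realpow[symmetric] powr_add[symmetric] algebra_simps split: split_indicator)
    then show "integrable lborel (\<lambda>t. k t * t ^ j)" "(\<integral>t. k t * t ^ j \<partial>lborel) = R ^ (m + j) * Beta (a + real (m + j)) (1 - a)"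
      using integrable_Beta_interval[of "a + real (m + j)" "1 - a" R] a R
      by (simp_all add: powr_realpow[symmetric])
  qed
  have k1: "integrable lborel (\<lambda>t. k t * (1 - t) ^ i)" for i
  proof (rule Bochner_Integration.integrable_bound)
    show "integrable lborel k" using k(1)[of 0] by simp
    show "AE t in lborel. norm (k t * (1 - t) ^ i) \<le> norm (k t)"
      using R by (intro AE_I2) (auto simp: k_def abs_mult intro!: mult_right_le_one_le power_le_one split: split_indicator)
    show "(\<lambda>t. k t * (1 - t) ^ i) \<in> borel_measurable lborel"
      unfolding k_def by measurable
  qed
  define Q where "Q = (\<lambda>i. \<integral>t. k t * (1 - t) ^ i \<partial>lborel)"
  have Q: "enn2real (\<integral>\<^sup>+t. indicator {0<..<R} t * ennreal (t powr (real m + a - 1) * (R - t) powr (- a) * (1 - t) ^ i) \<partial>lborel) = Q i" for i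
    unfolding Q_def
  proof (subst integral_eq_nn_integral)
    show "(\<lambda>t. k t * (1 - t) ^ i) \<in> borel_measurable lborel"
      unfolding k_def by measurable
    show "AE t in lborel. 0 \<le> k t * (1 - t) ^ i"
      using R by (auto simp: k_def split: split_indicator)
    show "enn2real (\<integral>\<^sup>+t. indicator {0<..<R} t * ennreal (t powr (real m + a - 1) * (R - t) powr (- a) * (1 - t) ^ i) \<partial>lborel) = enn2real (\<integral>\<^sup>+t. ennreal (k t * (1 - t) ^ i) \<partial>lborel)"
      using R by (intro arg_cong[where f = enn2real] nn_integral_cong) (auto simp: k_def add_ac mult_ac split: split_indicator)
  qed
  have Fi: "integrable lborel (Fi i)" "(\<integral>y. Fi i y \<partial>lborel) = (cz x / of_real R) ^ m * of_real (pi / (Gamma a * Gamma (1 - a)) * Beta (1 - a) (a + real i) * Q i)" for i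
    using riesz_monomial[OF a x, of i m] unfolding Fi_def R_def[symmetric] Q by auto
  show "integrable lborel (F n m)"
    unfolding F_sum by (intro Bochner_Integration.integrable_sum integrable_mult_right Fi)
  have QS: "(\<Sum>i\<le>n. q i * Q i) = D * R ^ m * jac n (a - 1) (real m) R"
  proof -
    have "(\<Sum>i\<le>n. q i * Q i) = (\<integral>t. (\<Sum>i\<le>n. q i * (k t * (1 - t) ^ i)) \<partial>lborel)"
      unfolding Q_def by (subst Bochner_Integration.integral_sum) (auto intro: k1)
    \<comment> \<open>Between the two integrals the same polynomial is re-expanded from powers of
      \<open>1 - t\<close> to powers of \<open>t\<close>.\<close>
    also have "\<dots> = (\<integral>t. (\<Sum>j\<le>n. f j * (k t * t ^ j)) \<partial>lborel)"
    proof (intro Bochner_Integration.integral_cong refl)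
      fix t
      have "(\<Sum>i\<le>n. q i * (k t * (1 - t) ^ i)) = k t * (\<Sum>i\<le>n. q i * (1 - t) ^ i)"
        by (simp add: sum_distrib_left mult_ac)
      also have "\<dots> = k t * (\<Sum>j\<le>n. f j * t ^ j)" by (simp only: jq[symmetric] jf[symmetric])
      also have "\<dots> = (\<Sum>j\<le>n. f j * (k t * t ^ j))" by (simp add: sum_distrib_left mult_ac)
      finally show "(\<Sum>i\<le>n. q i * (k t * (1 - t) ^ i)) = (\<Sum>j\<le>n. f j * (k t * t ^ j))" .
    qed
    also have "\<dots> = (\<Sum>j\<le>n. f j * (R ^ (m + j) * Beta (a + real (m + j)) (1 - a)))"
      by (subst Bochner_Integration.integral_sum) (auto simp: k simp del: of_nat_add)
    also have "\<dots> = (\<Sum>j\<le>n. D * R ^ m * (g j * R ^ j))"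
    proof (intro sum.cong refl)
      fix j assume "j \<in> {..n}"
      then have "f j * Beta (a + real (m + j)) (1 - a) = D * g j" by (intro fg) simp
      then show "f j * (R ^ (m + j) * Beta (a + real (m + j)) (1 - a)) = D * R ^ m * (g j * R ^ j)"
        by (simp add: power_add mult_ac)
    qed
    also have "\<dots> = D * R ^ m * jac n (a - 1) (real m) R"
      unfolding jg by (simp add: sum_distrib_left)
    finally show ?thesis .
  qed
  have "(\<integral>y. F n m y \<partial>lborel) = (\<Sum>i\<le>n. of_real (p i) * ((cz x / of_real R) ^ m * of_real (pi / (Gamma a * Gamma (1 - a)) * Beta (1 - a) (a + real i) * Q i)))"
    unfolding F_sum by (subst Bochner_Integration.integral_sum) (auto intro!: integrable_mult_right simp: Fi simp del: of_real_mult of_real_divide)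
  also have "\<dots> = (\<Sum>i\<le>n. (cz x / of_real R) ^ m * of_real (pi / (Gamma a * Gamma (1 - a)) * C * (q i * Q i)))"
  proof (intro sum.cong refl)
    fix i assume "i \<in> {..n}"
    then have e: "p i * Beta (1 - a) (a + real i) = C * q i" by (intro pq) simp
    have "p i * (pi / (Gamma a * Gamma (1 - a)) * Beta (1 - a) (a + real i) * Q i) = pi / (Gamma a * Gamma (1 - a)) * (p i * Beta (1 - a) (a + real i)) * Q i"
      by (simp only: mult_ac)
    also have "\<dots> = pi / (Gamma a * Gamma (1 - a)) * C * (q i * Q i)" unfolding e by (simp only: mult_ac)
    finally have "p i * (pi / (Gamma a * Gamma (1 - a)) * Beta (1 - a) (a + real i) * Q i) = pi / (Gamma a * Gamma (1 - a)) * C * (q i * Q i)" .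
    then show "of_real (p i) * ((cz x / of_real R) ^ m * of_real (pi / (Gamma a * Gamma (1 - a)) * Beta (1 - a) (a + real i) * Q i)) =
       (cz x / of_real R) ^ m * of_real (pi / (Gamma a * Gamma (1 - a)) * C * (q i * Q i))"
      by (metis mult.left_commute of_real_mult)
  qed
  also have "\<dots> = (cz x / of_real R) ^ m * of_real (pi / (Gamma a * Gamma (1 - a)) * C * (D * R ^ m * jac n (a - 1) (real m) R))"
    unfolding QS[symmetric] by (simp only: sum_distrib_left of_real_sum)
  also have "\<dots> = of_real (pi * Gamma (1 - a) / Gamma a * (Gamma (a + real n) * Gamma (a + real (n + m)) / (fact n * fact (n + m))) * jac n (a - 1) (real m) R) * cz x ^ m"
    using R G by (simp add: C_def D_def power_divide mult_ac)
  finally show "(\<integral>y. F n m y \<partial>lborel) = of_real (pi * Gamma (1 - a) / Gamma a * (Gamma (a + real n) * Gamma (a + real (n + m)) / (fact n * fact (n + m)))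
       * jac n (a - 1) (real m) ((norm x)\<^sup>2)) * cz x ^ m"
    unfolding R_def .
qed

section \<open>Disk polynomials\<close>

text \<open>For \<open>a > - 1\<close> this is \<open>Gamma (a + 1)\<close> times the value of
  \<open>jac n a b\<close> at \<open>s = 1\<close>; dividing by it gives all disk polynomials the
  same modulus on the unit circle.\<close>

definition dn :: "real \<Rightarrow> nat \<Rightarrow> real" where
  "dn a n = Gamma (real n + a + 1) / fact n"

lemma dn_pos: "- 1 < a \<Longrightarrow> 0 < dn a n"
  unfolding dn_def by (intro divide_pos_pos Gamma_real_pos) auto

lemma dn_shift: "0 < a \<Longrightarrow> dn a n = (real n + a) * dn (a - 1) n"
  using Gamma_plus1[of "real n + a"] by (simp add: dn_def nonpos_Ints_def add_ac)

lemma dn_shift_Suc: "real (Suc n) * dn (a - 1) (Suc n) = dn a n"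
  by (simp add: dn_def add_ac del: of_nat_Suc) (simp add: add_ac)

lemma dn_Suc: "0 < a \<Longrightarrow> dn a (Suc n) = dn a n * (real (Suc n) + a) / real (Suc n)"
  by (subst dn_shift, simp, subst dn_shift_Suc[symmetric]) (simp add: field_simps)

text \<open>Zernike-type disk polynomials. The factor \<open>1 / dn\<close> makes the derivative rules below uniform in
  \<open>p\<close> and \<open>q\<close>.\<close>

definition zern :: "real \<Rightarrow> nat \<Rightarrow> nat \<Rightarrow> complex \<Rightarrow> complex" where
  "zern a p q z = (if q \<le> p then z ^ (p - q) * of_real (jac q a (real (p - q)) ((norm z)\<^sup>2) / dn a q)
     else cnj z ^ (q - p) * of_real (jac p a (real (q - p)) ((norm z)\<^sup>2) / dn a p))"

lemma cnj_zern: "cnj (zern a p q z) = zern a q p z"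
  by (auto simp: zern_def)

text \<open>\<open>A\<close> and \<open>B\<close> are the Wirtinger derivatives of \<open>f\<close> with respect to \<open>z\<close> and \<open>cnj z\<close>.\<close>

definition has_wirt :: "(complex \<Rightarrow> complex) \<Rightarrow> complex \<Rightarrow> complex \<Rightarrow> complex \<Rightarrow> bool" where
  "has_wirt f A B z \<longleftrightarrow> (f has_derivative (\<lambda>h. h * A + cnj h * B)) (at z)"

lemma has_wirt_cnj:
  assumes "has_wirt f A B z" shows "has_wirt (\<lambda>z. cnj (f z)) (cnj B) (cnj A) z"
  using has_derivative_cnj[OF assms[unfolded has_wirt_def]]
  by (simp add: has_wirt_def add.commute)

lemma has_wirt_add:
  "has_wirt f A B z \<Longrightarrow> has_wirt g A' B' z \<Longrightarrow> has_wirt (\<lambda>z. f z + g z) (A + A') (B + B') z"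
  unfolding has_wirt_def by (drule (1) has_derivative_add) (simp add: algebra_simps)

lemma has_wirt_cmult:
  assumes "has_wirt f A B z" shows "has_wirt (\<lambda>z. c * f z) (c * A) (c * B) z"
  using has_derivative_mult_right[OF assms[unfolded has_wirt_def], of c]
  by (simp add: has_wirt_def algebra_simps)

text \<open>Product and chain rule, with \<open>cnj z\<close> and \<open>z\<close> as the two
  Wirtinger derivatives of \<open>norm z ^ 2 = z * cnj z\<close>. At \<open>l = 0\<close> the
  truncated exponent is multiplied by zero.\<close>

lemma has_wirt_power_radial:
  assumes g: "(g has_real_derivative g') (at ((norm z)\<^sup>2))"
  shows "has_wirt (\<lambda>z. z ^ l * of_real (g ((norm z)\<^sup>2)))
     (of_nat l * z ^ (l - 1) * of_real (g ((norm z)\<^sup>2)) + z ^ l * cnj z * of_real g') (z ^ Suc l * of_real g') z"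
proof -
  have n: "((\<lambda>z. (norm z)\<^sup>2) has_derivative (\<lambda>h. 2 * (z \<bullet> h))) (at z)"
  proof -
    have "((\<lambda>z. z \<bullet> z) has_derivative (\<lambda>h. z \<bullet> h + h \<bullet> z)) (at z)"
      by (auto intro!: derivative_eq_intros)
    moreover have "(\<lambda>h. z \<bullet> h + h \<bullet> z) = (\<lambda>h. 2 * (z \<bullet> h))"
      by (simp add: fun_eq_iff inner_commute[of _ z])
    ultimately show ?thesis by (simp only: power2_norm_eq_inner)
  qed
  have "((\<lambda>z. g ((norm z)\<^sup>2)) has_derivative (\<lambda>h. 2 * (z \<bullet> h) * g')) (at z)"
    by (rule has_derivative_eq_rhs[OF has_derivative_compose[OF n g[unfolded has_field_derivative_def]]])
       (simp only: mult.commute)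
  then have r: "((\<lambda>z. complex_of_real (g ((norm z)\<^sup>2))) has_derivative (\<lambda>h. complex_of_real (2 * (z \<bullet> h) * g'))) (at z)"
    by (rule has_derivative_of_real)
  have p: "((\<lambda>z. z ^ l) has_derivative (\<lambda>h. of_nat l * z ^ (l - 1) * h)) (at z)"
    by (rule has_derivative_eq_rhs[OF has_derivative_power[OF has_derivative_ident]]) (simp add: fun_eq_iff mult_ac)
  have i: "complex_of_real (2 * (z \<bullet> h)) = h * cnj z + cnj h * z" for h
    by (simp add: inner_complex_def complex_eq_iff)
  show ?thesis
    unfolding has_wirt_def
    by (rule has_derivative_eq_rhs[OF has_derivative_mult[OF p r]])
       (simp only: of_real_mult[of "2 * (z \<bullet> h)" for h] i, simp add: algebra_simps)
qed

lemma power_cnj_mult: "0 < l \<Longrightarrow> z ^ l * cnj z = z ^ (l - 1) * of_real ((norm z)\<^sup>2)"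
  by (cases l) (simp_all add: complex_norm_square[symmetric])

lemma powr_minus_one_mult: "0 < x \<Longrightarrow> x powr (a - 1) * x = (x::real) powr a"
  by (simp add: powr_diff)

text \<open>The derivative in \<open>cnj z\<close> sees only the weight at \<open>s = 1\<close> and
  uses \<open>jac_weighted_deriv_left\<close>. The one in \<open>z\<close> also lowers the power
  \<open>z ^ l\<close>, which acts as a weight at \<open>s = 0\<close>, and uses
  \<open>jac_weighted_deriv_both\<close>.\<close>

lemma weighted_zern_wirt_le:
  assumes a: "0 < a" and z: "norm z < 1" and qp: "q \<le> p"
  defines "\<omega> \<equiv> \<lambda>b z. complex_of_real ((1 - (norm z)\<^sup>2) powr b)"
  shows "has_wirt (\<lambda>z. \<omega> a z * zern a p q z) (- \<omega> (a - 1) z * zern (a - 1) p (Suc q) z) (- \<omega> (a - 1) z * zern (a - 1) (Suc p) q z) z"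
proof -
  define s where "s = (norm z)\<^sup>2"
  have s: "s < 1" using z by (simp add: s_def abs_square_less_1)
  define l where "l = p - q"
  have p: "p = q + l" using qp by (simp add: l_def)
  obtain D where D: "(jac q a (real l) has_real_derivative D) (at s)" using jac_DERIV by blast
  define w where "w = (1 - s) powr (a - 1)"
  have wa: "(1 - s) powr a = w * (1 - s)" using s by (simp add: w_def powr_minus_one_mult)
  define g where "g = (\<lambda>s. (1 - s) powr a * (jac q a (real l) s / dn a q))"
  define g' where "g' = w * (- (real q + a) * jac q (a - 1) (real l + 1) s) / dn a q"
  have d: "0 < dn a q" "0 < dn (a - 1) q" "0 < dn (a - 1) (Suc q)" using a by (auto intro!: dn_pos)
  have "(g has_real_derivative ((1 - s) powr a * (D / dn a q) + - (a * w) * (jac q a (real l) s / dn a q))) (at s)"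
    unfolding g_def w_def using s d
    by (auto intro!: derivative_eq_intros D simp: powr_diff diff_divide_distrib)
  also have "(1 - s) powr a * (D / dn a q) + - (a * w) * (jac q a (real l) s / dn a q) = w * ((1 - s) * D - a * jac q a (real l) s) / dn a q"
    unfolding wa by (simp add: diff_divide_distrib add_divide_distrib algebra_simps)
  also have "\<dots> = g'" unfolding jac_weighted_deriv_left[OF D] g'_def ..
  finally have g: "(g has_real_derivative g') (at ((norm z)\<^sup>2))" unfolding s_def .
  have f: "(\<lambda>z. \<omega> a z * zern a p q z) = (\<lambda>z. z ^ l * of_real (g ((norm z)\<^sup>2)))"
    by (auto simp: fun_eq_iff p zern_def g_def \<omega>_def)
  have g'_alt: "g' = - (w * (jac q (a - 1) (real l + 1) s / dn (a - 1) q))"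
    unfolding g'_def dn_shift[OF a] using a d by (simp add: divide_simps) (simp add: algebra_simps)
  have B: "z ^ Suc l * of_real g' = - \<omega> (a - 1) z * zern (a - 1) (Suc p) q z"
    unfolding g'_alt \<omega>_def zern_def s_def[symmetric] w_def[symmetric]
    by (simp add: p Suc_diff_le add_ac)
  have A: "of_nat l * z ^ (l - 1) * of_real (g ((norm z)\<^sup>2)) + z ^ l * cnj z * of_real g' = - \<omega> (a - 1) z * zern (a - 1) p (Suc q) z"
  \<comment> \<open>For \<open>l = 0\<close> the target index \<open>(p, Suc q)\<close> lies in the
    conjugate branch of \<open>zern\<close>, and only the term with \<open>g'\<close> is
    present.\<close>
  proof (cases "l = 0")
    case True
    then show ?thesis
      unfolding g'_alt \<omega>_def zern_def s_def[symmetric] w_def[symmetric]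
      by (simp add: p add_ac)
  next
    case False
    have g'2: "g' = w * ((1 - s) * D - a * jac q a (real l) s) / dn a q"
      unfolding jac_weighted_deriv_left[OF D] g'_def ..
    have "of_nat l * z ^ (l - 1) * of_real (g ((norm z)\<^sup>2)) + z ^ l * cnj z * of_real g' = z ^ (l - 1) * of_real (real l * g s + s * g')"
    proof -
      have pc: "z ^ l * cnj z = z ^ (l - 1) * of_real s"
        using False unfolding s_def by (intro power_cnj_mult) simp
      show ?thesis unfolding pc s_def[symmetric] by (simp add: algebra_simps)
    qed
    also have "real l * g s + s * g' = w / dn a q * (s * (1 - s) * D + (real l * (1 - s) - a * s) * jac q a (real l) s)"
      unfolding g_def wa g'2 by (simp add: diff_divide_distrib add_divide_distrib algebra_simps)
    also have "\<dots> = - w * jac (Suc q) (a - 1) (real l - 1) s / dn (a - 1) (Suc q)"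
      unfolding jac_weighted_deriv_both[OF D] dn_shift_Suc[symmetric, of a q] using d by (simp add: field_simps del: of_nat_Suc)
    finally show ?thesis
      using False unfolding \<omega>_def zern_def s_def[symmetric] w_def[symmetric]
      by (simp add: p Suc_le_eq of_nat_diff)
  qed
  show ?thesis
    using has_wirt_power_radial[OF g, of l] unfolding A B f .
qed

lemma weighted_zern_wirt:
  assumes a: "0 < a" and z: "norm z < 1"
  defines "\<omega> \<equiv> \<lambda>b z. complex_of_real ((1 - (norm z)\<^sup>2) powr b)"
  shows "has_wirt (\<lambda>z. \<omega> a z * zern a p q z) (- \<omega> (a - 1) z * zern (a - 1) p (Suc q) z) (- \<omega> (a - 1) z * zern (a - 1) (Suc p) q z) z"
proof (cases "q \<le> p")
  case True
  then show ?thesis unfolding \<omega>_def by (rule weighted_zern_wirt_le[OF a z])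
next
  case False
  then have "p \<le> q" by simp
  from has_wirt_cnj[OF weighted_zern_wirt_le[OF a z this]] show ?thesis
    by (simp add: \<omega>_def cnj_zern)
qed

text \<open>The counterpart for the outer derivatives: without weight, differentiation raises the
  parameter from \<open>a - 1\<close> back to \<open>a\<close>. Here
  \<open>jac_has_derivative\<close> serves \<open>cnj z\<close> and, for \<open>l > 0\<close>,
  \<open>jac_weighted_deriv_right\<close> serves \<open>z\<close>. Truncated indices carry a zero
  factor.\<close>

lemma zern_wirt_le:
  assumes a: "0 < a" and qp: "q \<le> p"
  shows "has_wirt (zern (a - 1) p q) (of_real (real p * (real q + a)) * zern a (p - 1) q z) (of_real (real q * (real p + a)) * zern a p (q - 1) z) z"
proof -
  define s where "s = (norm z)\<^sup>2"
  define l where "l = p - q"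
  have p: "p = q + l" using qp by (simp add: l_def)
  obtain D where D: "(jac q (a - 1) (real l) has_real_derivative D) (at s)" using jac_DERIV by blast
  have d: "0 < dn a q" "0 < dn (a - 1) q" using a by (auto intro!: dn_pos)
  define g where "g = (\<lambda>s. jac q (a - 1) (real l) s / dn (a - 1) q)"
  have g: "(g has_real_derivative D / dn (a - 1) q) (at ((norm z)\<^sup>2))"
    unfolding g_def using D by (intro DERIV_cdivide) (simp add: s_def)
  have f: "zern (a - 1) p q = (\<lambda>z. z ^ l * of_real (g ((norm z)\<^sup>2)))"
    by (auto simp: fun_eq_iff p zern_def g_def)
  have Dq: "D / dn (a - 1) q = real q * (real p + a) * (jac (q - 1) a (real l + 1) s / dn a (q - 1))"
  proof (cases q)
    case 0
    then have "(jac q (a - 1) (real l) has_real_derivative 0) (at s)"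
      by (simp add: jac_def[abs_def])
    then show ?thesis using 0 DERIV_unique[OF D] by simp
  next
    case (Suc k)
    have "D = (real (Suc k) + (a - 1) + real l + 1) * jac k (a - 1 + 1) (real l + 1) s"
      using D unfolding Suc by (rule DERIV_unique) (rule jac_has_derivative)
    also have "\<dots> = (real p + a) * jac k a (real l + 1) s" by (simp add: p Suc add_ac)
    finally show ?thesis
      using d unfolding Suc by (simp add: dn_shift_Suc[of k a, symmetric] field_simps del: of_nat_Suc)
  qed
  have B: "z ^ Suc l * of_real (D / dn (a - 1) q) = of_real (real q * (real p + a)) * zern a p (q - 1) z"
  proof (cases q)
    case (Suc k)
    have "p - k = Suc l" "k \<le> p" using p Suc by auto
    then show ?thesis unfolding Dq zern_def s_def[symmetric] unfolding Suc by (simp add: add_ac)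
  next
    case 0
    then have "D / dn (a - 1) q = 0" using Dq by simp
    then show ?thesis using 0 by (simp only:) simp
  qed
  have A: "of_nat l * z ^ (l - 1) * of_real (g ((norm z)\<^sup>2)) + z ^ l * cnj z * of_real (D / dn (a - 1) q) = of_real (real p * (real q + a)) * zern a (p - 1) q z"
  proof (cases "l = 0")
    case True
    then show ?thesis
    proof (cases q)
      case (Suc k)
      then show ?thesis unfolding Dq zern_def s_def[symmetric] using True by (simp add: p add_ac)
    next
      case 0
      then have "D / dn (a - 1) q = 0" using Dq by simp
      then show ?thesis using True 0 p by (simp only:) simp
    qed
  next
    case False
    have "of_nat l * z ^ (l - 1) * of_real (g ((norm z)\<^sup>2)) + z ^ l * cnj z * of_real (D / dn (a - 1) q) = z ^ (l - 1) * of_real (real l * g s + s * (D / dn (a - 1) q))"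
    proof -
      have pc: "z ^ l * cnj z = z ^ (l - 1) * of_real s"
        using False unfolding s_def by (intro power_cnj_mult) simp
      show ?thesis unfolding pc s_def[symmetric] by (simp add: algebra_simps)
    qed
    also have "real l * g s + s * (D / dn (a - 1) q) = (s * D + real l * jac q (a - 1) (real l) s) / dn (a - 1) q"
      unfolding g_def by (simp add: add_divide_distrib algebra_simps)
    also have "\<dots> = real p * (real q + a) * (jac q a (real l - 1) s / dn a q)"
      unfolding jac_weighted_deriv_right[OF D] dn_shift[OF a] using d a by (simp add: p divide_simps) (simp add: algebra_simps)?
    finally have e: "of_nat l * z ^ (l - 1) * of_real (g ((norm z)\<^sup>2)) + z ^ l * cnj z * of_real (D / dn (a - 1) q) =
      z ^ (l - 1) * of_real (real p * (real q + a) * (jac q a (real l - 1) s / dn a q))" .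
    have "q \<le> p - 1" "p - 1 - q = l - 1" "real (l - 1) = real l - 1" using False p by auto
    then show ?thesis
      unfolding e unfolding zern_def s_def[symmetric] by simp
  qed
  show ?thesis
    using has_wirt_power_radial[OF g, of l] unfolding A B f .
qed

lemma zern_wirt:
  assumes a: "0 < a"
  shows "has_wirt (zern (a - 1) p q) (of_real (real p * (real q + a)) * zern a (p - 1) q z) (of_real (real q * (real p + a)) * zern a p (q - 1) z) z"
proof (cases "q \<le> p")
  case True
  then show ?thesis by (rule zern_wirt_le[OF a])
next
  case False
  then have "p \<le> q" by simp
  from has_wirt_cnj[OF zern_wirt_le[OF a this, of z]] show ?thesis
    by (simp add: cnj_zern)
qed

lemma continuous_zern: "continuous_on A (zern a p q)"
  unfolding zern_def divide_inverse
  by (cases "q \<le> p") (auto intro!: continuous_on_mult continuous_on_of_real continuous_on_jac continuous_on_power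
      continuous_on_norm continuous_on_cnj continuous_on_id continuous_on_const)

lemma zern_measurable [measurable]: "zern a p q \<in> borel_measurable borel"
  by (intro borel_measurable_continuous_onI continuous_zern)

text \<open>In \<open>riesz_jacobi\<close> the degrees \<open>n\<close> and \<open>n + m\<close> are
  the smaller and the larger of \<open>p\<close> and \<open>q\<close>, and
  \<open>Gamma (a + n) / fact n\<close> is \<open>dn (a - 1) n\<close>; hence the symmetric
  eigenvalue. Conjugation covers \<open>p < q\<close>.\<close>

theorem riesz_zern:
  fixes x :: "real^2"
  assumes a: "0 < a" "a < 1" and x: "x \<noteq> 0" "norm x < 1"
  defines "F \<equiv> \<lambda>p q y. of_real (indicator unit_disk y * (1 - (norm y)\<^sup>2) powr (a - 1) * norm (x - y) powr (- 2 * a)) * zern (a - 1) p q (cz y)"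
  shows "integrable lborel (F p q)"
    and "(\<integral>y. F p q y \<partial>lborel) = of_real (pi * Gamma (1 - a) / Gamma a * (dn (a - 1) p * dn (a - 1) q)) * zern (a - 1) p q (cz x)"
proof -
  have le: "integrable lborel (F p q) \<and> (\<integral>y. F p q y \<partial>lborel) = of_real (pi * Gamma (1 - a) / Gamma a * (dn (a - 1) p * dn (a - 1) q)) * zern (a - 1) p q (cz x)" if qp: "q \<le> p" for p q
  proof -
    define G where "G = (\<lambda>y. of_real (indicator unit_disk y * (1 - (norm y)\<^sup>2) powr (a - 1) * jac q (a - 1) (real (p - q)) ((norm y)\<^sup>2) * norm (x - y) powr (- 2 * a)) * cz y ^ (p - q))"
    have FG: "F p q = (\<lambda>y. of_real (1 / dn (a - 1) q) * G y)"
      using qp by (auto simp: F_def G_def zern_def fun_eq_iff)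
    note r = riesz_jacobi[OF a x, of q "p - q", folded G_def]
    have "(\<integral>y. F p q y \<partial>lborel) = of_real (1 / dn (a - 1) q) * (\<integral>y. G y \<partial>lborel)"
      unfolding FG by (rule integral_mult_right_zero)
    also have "\<dots> = of_real (pi * Gamma (1 - a) / Gamma a * (dn (a - 1) p * dn (a - 1) q)) * zern (a - 1) p q (cz x)"
      unfolding r(2) zern_def using qp by (simp add: dn_def add_ac mult_ac)
    finally show ?thesis unfolding FG using r(1) by (auto intro: integrable_mult_right)
  qed
  have "integrable lborel (F p q) \<and> (\<integral>y. F p q y \<partial>lborel) = of_real (pi * Gamma (1 - a) / Gamma a * (dn (a - 1) p * dn (a - 1) q)) * zern (a - 1) p q (cz x)"
  proof (cases "q \<le> p")
    case True
    then show ?thesis by (rule le)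
  next
    case False
    then have i: "integrable lborel (F q p)" "(\<integral>y. F q p y \<partial>lborel) = of_real (pi * Gamma (1 - a) / Gamma a * (dn (a - 1) q * dn (a - 1) p)) * zern (a - 1) q p (cz x)"
      using le[of p q] by auto
    have F: "F p q = (\<lambda>y. cnj (F q p y))"
      by (auto simp: F_def fun_eq_iff cnj_zern)
    have "integrable lborel (F p q)" unfolding F using i(1) by simp
    moreover have "(\<integral>y. F p q y \<partial>lborel) = cnj (\<integral>y. F q p y \<partial>lborel)"
      unfolding F by (rule Bochner_Integration.integral_cnj)
    ultimately show ?thesis unfolding i(2) by (simp add: cnj_zern mult_ac)
  qed
  then show "integrable lborel (F p q)"
    and "(\<integral>y. F p q y \<partial>lborel) = of_real (pi * Gamma (1 - a) / Gamma a * (dn (a - 1) p * dn (a - 1) q)) * zern (a - 1) p q (cz x)"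
    by auto
qed

section \<open>The diffusion operator on weighted disk polynomials\<close>

lemma cz_axis: "cz (axis 1 1) = 1" "cz (axis 2 1) = \<i>"
  by (simp_all add: complex_eq_iff axis_def)

text \<open>\<open>L\<close> stands for a multiple of the real or imaginary part, so that both
  parities are treated at once. Agreement near \<open>x\<close> suffices, as it must:
  \<open>weighted_ext\<close> changes its formula outside the disk.\<close>

lemma has_wirt_partial_deriv:
  assumes L: "bounded_linear L" and f: "has_wirt f A B (cz x)"
    and ev: "\<forall>\<^sub>F y in nhds x. g y = L (f (cz y))"
  shows "partial_deriv 1 g x = L (A + B)" and "partial_deriv 2 g x = L (\<i> * (A - B))"
proof -
  interpret L: bounded_linear L by (rule L)
  have d: "partial_deriv i g x = L (cz (axis i 1) * A + cnj (cz (axis i 1)) * B)" for i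
  proof -
    define c where "c = cz (axis i 1)"
    have lin: "((\<lambda>t. cz x + t *\<^sub>R c) has_derivative (\<lambda>t. t *\<^sub>R c)) (at 0)"
      by (auto intro!: derivative_eq_intros)
    have "((\<lambda>t. f (cz x + t *\<^sub>R c)) has_derivative (\<lambda>t. (t *\<^sub>R c) * A + cnj (t *\<^sub>R c) * B)) (at 0)"
      using f unfolding has_wirt_def by (intro has_derivative_compose[OF lin]) simp
    then have "((\<lambda>t. L (f (cz x + t *\<^sub>R c))) has_derivative (\<lambda>t. L ((t *\<^sub>R c) * A + cnj (t *\<^sub>R c) * B))) (at 0)"
      by (rule bounded_linear.has_derivative[OF L])
    also have "(\<lambda>t. L ((t *\<^sub>R c) * A + cnj (t *\<^sub>R c) * B)) = (*) (L (c * A + cnj c * B))"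
    proof
      fix t
      have "(t *\<^sub>R c) * A + cnj (t *\<^sub>R c) * B = t *\<^sub>R (c * A + cnj c * B)"
        by (simp add: scaleR_add_right)
      then show "L ((t *\<^sub>R c) * A + cnj (t *\<^sub>R c) * B) = L (c * A + cnj c * B) * t"
        by (simp add: L.scaleR)
    qed
    finally have D: "((\<lambda>t. L (f (cz x + t *\<^sub>R c))) has_real_derivative L (c * A + cnj c * B)) (at 0)"
      unfolding has_field_derivative_def .
    have "((\<lambda>t. x + t *\<^sub>R axis i 1) \<longlongrightarrow> x + 0 *\<^sub>R axis i 1) (nhds 0)"
      by (intro tendsto_add tendsto_const tendsto_scaleR filterlim_ident)
    then have "filterlim (\<lambda>t. x + t *\<^sub>R axis i 1) (nhds x) (nhds (0::real))" by simp
    from eventually_compose_filterlim[OF ev this]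
    have "\<forall>\<^sub>F t in nhds 0. g (x + t *\<^sub>R axis i 1) = L (f (cz x + t *\<^sub>R c))"
      by (simp add: c_def)
    from DERIV_cong_ev[OF refl this refl] D
    have "((\<lambda>t. g (x + t *\<^sub>R axis i 1)) has_real_derivative L (c * A + cnj c * B)) (at 0)"
      by blast
    then show ?thesis unfolding partial_deriv_def c_def by (rule DERIV_imp_deriv)
  qed
  show "partial_deriv 1 g x = L (A + B)" "partial_deriv 2 g x = L (\<i> * (A - B))"
    unfolding d cz_axis by (simp_all add: algebra_simps)
qed

text \<open>\<open>4 powr (a - 1)\<close> is all that remains of
  \<open>1 / riesz_const (2 * a)\<close> after multiplication by the constant
  \<open>pi * Gamma (1 - a) / Gamma a\<close> of \<open>riesz_zern\<close>.\<close>

definition riesz_eig :: "real \<Rightarrow> nat \<Rightarrow> nat \<Rightarrow> real" where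
  "riesz_eig a p q = 4 powr (a - 1) * (dn (a - 1) p * dn (a - 1) q)"

lemma riesz_potential_zern:
  assumes a: "0 < a" "a < 1" and x: "x \<noteq> 0" "norm x < 1" and L: "bounded_linear L"
    and g: "\<And>y. g y = indicator unit_disk y * L (of_real ((1 - (norm y)\<^sup>2) powr (a - 1)) * (c * zern (a - 1) p q (cz y) + d * zern (a - 1) p' q' (cz y)))"
  shows "riesz_potential (2 * a) g x = L (of_real (riesz_eig a p q) * c * zern (a - 1) p q (cz x) + of_real (riesz_eig a p' q') * d * zern (a - 1) p' q' (cz x))"
proof -
  interpret L: bounded_linear L by (rule L)
  let ?Z = "c * (of_real (dn (a - 1) p * dn (a - 1) q) * zern (a - 1) p q (cz x)) + d * (of_real (dn (a - 1) p' * dn (a - 1) q') * zern (a - 1) p' q' (cz x))"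
  let ?C = "pi * Gamma (1 - a) / Gamma a"
  have G: "0 < Gamma a" "0 < Gamma (1 - a)" using a by (auto intro!: Gamma_real_pos)
  define h where "h = (\<lambda>y. g y * norm (x - y) powr (- 2 * a))"
  have [measurable]: "L \<in> borel_measurable borel"
    by (intro borel_measurable_continuous_onI L.continuous_on continuous_on_id)
  have [measurable]: "g \<in> borel_measurable borel"
    unfolding g[abs_def] by measurable
  define F where "F = (\<lambda>p q y. of_real (indicator unit_disk y * (1 - (norm y)\<^sup>2) powr (a - 1) * norm (x - y) powr (- 2 * a)) * zern (a - 1) p q (cz y))"
  have i: "integrable lborel (F p q)" "(\<integral>y. F p q y \<partial>lborel) = of_real (pi * Gamma (1 - a) / Gamma a * (dn (a - 1) p * dn (a - 1) q)) * zern (a - 1) p q (cz x)" for p q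
    unfolding F_def by (rule riesz_zern[OF a x])+
  have h: "h = (\<lambda>y. L (c * F p q y + d * F p' q' y))"
  proof
    fix y
    have "c * F p q y + d * F p' q' y = (indicator unit_disk y * norm (x - y) powr (- 2 * a)) *\<^sub>R (of_real ((1 - (norm y)\<^sup>2) powr (a - 1)) * (c * zern (a - 1) p q (cz y) + d * zern (a - 1) p' q' (cz y)))"
      unfolding F_def by (simp add: scaleR_conv_of_real algebra_simps)
    then show "h y = L (c * F p q y + d * F p' q' y)"
      unfolding h_def g by (simp only: L.scaleR) simp
  qed
  have "(\<integral>y. g (x - y) / norm y powr (2 * a) \<partial>lebesgue) = (\<integral>y. g (x - y) / norm y powr (2 * a) \<partial>lborel)"
    by (rule integral_completion) measurable
  also have "\<dots> = (\<integral>y. h (x - y) \<partial>lborel)"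
    unfolding h_def by (simp add: powr_minus divide_inverse)
  \<comment> \<open>The substitution \<open>y -> x - y\<close> turns the convolution of the
    definition into the form with kernel centred at \<open>x\<close>.\<close>
  also have "\<dots> = (\<integral>y. h y \<partial>lborel)"
  proof -
    have e: "(\<integral>y. h (x - y) \<partial>lborel) = (\<integral>y. h y \<partial>distr lborel borel (\<lambda>y. x - y))"
      by (rule integral_distr[symmetric]) (auto simp: h_def)
    have "distr lborel borel (\<lambda>y. x - y) = (lborel :: (real^2) measure)"
      using lborel_affine_euclidean[where c = "\<lambda>_. - 1" and t = x]
      by (simp add: density_1 euclidean_representation sum_negf)
    then show ?thesis using e by simp
  qed
  also have "\<dots> = L (\<integral>y. c * F p q y + d * F p' q' y \<partial>lborel)"
    unfolding h using i(1)
    by (intro integral_bounded_linear[OF L] Bochner_Integration.integrable_add integrable_mult_right)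
  also have "(\<integral>y. c * F p q y + d * F p' q' y \<partial>lborel) = of_real ?C * ?Z"
    using i by (simp add: algebra_simps)
  finally have I: "(\<integral>y. g (x - y) / norm y powr (2 * a) \<partial>lebesgue) = L (of_real ?C * ?Z)" .
  have "1 / riesz_const (2 * a) = 4 powr (a - 1) / ?C"
  proof -
    have "(4::real) powr (a - 1) = 2 powr (2 * (a - 1))"
      by (simp only: powr_powr[symmetric]) simp
    also have "\<dots> = 1 / 2 powr (2 - 2 * a)"
      by (simp add: powr_minus_divide[symmetric] algebra_simps)
    finally show ?thesis
      unfolding riesz_const_def by simp
  qed
  then have "riesz_potential (2 * a) g x = 4 powr (a - 1) / ?C * L (of_real ?C * ?Z)"
    unfolding riesz_potential_def I by simp
  also have "\<dots> = L ((4 powr (a - 1) / ?C) *\<^sub>R (of_real ?C * ?Z))"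
    by (simp only: L.scaleR real_scaleR_def)
  also have "\<dots> = L (of_real (riesz_eig a p q) * c * zern (a - 1) p q (cz x) + of_real (riesz_eig a p' q') * d * zern (a - 1) p' q' (cz x))"
  proof (rule arg_cong[where f = L])
    define C where "C = pi * Gamma (1 - a) / Gamma a"
    have C: "C \<noteq> 0" using G by (simp add: C_def)
    define E where "E = (4::real) powr (a - 1)"
    define T where "T = c * (of_real (dn (a - 1) p * dn (a - 1) q) * zern (a - 1) p q (cz x)) + d * (of_real (dn (a - 1) p' * dn (a - 1) q') * zern (a - 1) p' q' (cz x))"
    have "(E / C) *\<^sub>R (of_real C * T) = of_real E * T"
      using C by (simp add: scaleR_conv_of_real)
    also have "\<dots> = of_real (riesz_eig a p q) * c * zern (a - 1) p q (cz x) + of_real (riesz_eig a p' q') * d * zern (a - 1) p' q' (cz x)"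
      unfolding T_def E_def riesz_eig_def by (simp add: algebra_simps)
    finally show "(4 powr (a - 1) / ?C) *\<^sub>R (of_real ?C * ?Z) =
      of_real (riesz_eig a p q) * c * zern (a - 1) p q (cz x) + of_real (riesz_eig a p' q') * d * zern (a - 1) p' q' (cz x)"
      unfolding E_def C_def T_def .
  qed
  finally show ?thesis .
qed

text \<open>For \<open>k1 = k2 = 1\<close> the operator is the fractional Laplacian of order
  \<open>2 * a\<close>, and this is the factor by which it maps the weighted disk polynomial to the
  unweighted one.\<close>

definition eig :: "real \<Rightarrow> nat \<Rightarrow> nat \<Rightarrow> real" where
  "eig a p q = 4 powr a * (dn a p * dn a q)"

text \<open>The factor of an outer derivative raises both \<open>dn (a - 1)\<close> to
  \<open>dn a\<close>, at the index where the derivative arrives. So each entry carries the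
  eigenvalue of its target, and the eigenvalues can be split off on the left.\<close>

lemma riesz_eig_eig:
  assumes a: "0 < a"
  shows "riesz_eig a p (Suc q) * (real (Suc q) * (real p + a)) = eig a p q / 4"
    and "riesz_eig a (Suc p) q * (real (Suc p) * (real q + a)) = eig a p q / 4"
proof -
  have 4: "(4::real) powr (a - 1) = 4 powr a / 4" by (simp add: powr_diff)
  have "riesz_eig a p (Suc q) * (real (Suc q) * (real p + a)) = 4 powr (a - 1) * (((real p + a) * dn (a - 1) p) * (real (Suc q) * dn (a - 1) (Suc q)))"
    by (simp only: riesz_eig_def mult_ac)
  then show "riesz_eig a p (Suc q) * (real (Suc q) * (real p + a)) = eig a p q / 4"
    by (simp only: dn_shift[OF a, symmetric] dn_shift_Suc 4 eig_def mult_ac times_divide_eq_left times_divide_eq_right)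
  have "riesz_eig a (Suc p) q * (real (Suc p) * (real q + a)) = 4 powr (a - 1) * ((real (Suc p) * dn (a - 1) (Suc p)) * ((real q + a) * dn (a - 1) q))"
    by (simp only: riesz_eig_def mult_ac)
  then show "riesz_eig a (Suc p) q * (real (Suc p) * (real q + a)) = eig a p q / 4"
    by (simp only: dn_shift[OF a, symmetric] dn_shift_Suc 4 eig_def mult_ac times_divide_eq_left times_divide_eq_right)
qed

text \<open>The origin is excluded only because \<open>riesz_monomial\<close> divides by \<open>norm x\<close>; a null set does not
  affect the coefficients.\<close>

theorem frac_diffusion_zern:
  assumes a: "0 < a" "a < 1" and x: "x \<noteq> 0" "norm x < 1" and L: "bounded_linear L"
  shows "frac_diffusion (2 * a) (\<lambda>x. vector [vector [k1, 0], vector [0, k2]]) (weighted_ext (2 * a) (\<lambda>y. L (zern a p q (cz y)))) x =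
     (k1 + k2) / 2 * eig a p q * L (zern a p q (cz x)) +
     (k1 - k2) / 4 * ((if p = 0 then 0 else eig a (p - 1) (q + 1) * L (zern a (p - 1) (q + 1) (cz x))) +
        (if q = 0 then 0 else eig a (p + 1) (q - 1) * L (zern a (p + 1) (q - 1) (cz x))))"
proof -
  interpret L: bounded_linear L by (rule L)
  let ?B = "\<lambda>y. zern (a - 1) (Suc p) q (cz y)"
  let ?A = "\<lambda>y. zern (a - 1) p (Suc q) (cz y)"
  define K where "K = (\<lambda>x :: real^2. vector [vector [k1, 0], vector [0, k2 :: real]] :: real^2^2)"
  define v where "v = weighted_ext (2 * a) (\<lambda>y. L (zern a p q (cz y)))"
  define w where "w = (\<lambda>y :: real^2. complex_of_real ((1 - (norm y)\<^sup>2) powr (a - 1)))"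
  have v: "v y = L (of_real ((1 - (norm (cz y))\<^sup>2) powr a) * zern a p q (cz y))" if "norm y < 1" for y
    using that unfolding v_def weighted_ext_def weight_def
    by (simp add: scaleR_conv_of_real[symmetric] L.scaleR)
  have grad: "partial_deriv 1 v y = L (w y * ((- 1) * ?A y + (- 1) * ?B y))"
     "partial_deriv 2 v y = L (w y * ((- \<i>) * ?A y + \<i> * ?B y))" if y: "norm y < 1" for y
  proof -
    have "\<forall>\<^sub>F y' in nhds y. y' \<in> unit_disk"
      using y by (intro eventually_nhds_in_open) auto
    then have ev: "\<forall>\<^sub>F y' in nhds y. v y' = L (of_real ((1 - (norm (cz y'))\<^sup>2) powr a) * zern a p q (cz y'))"
      by eventually_elim (simp add: v)
    have "has_wirt (\<lambda>z. of_real ((1 - (norm z)\<^sup>2) powr a) * zern a p q z) (- w y * ?A y) (- w y * ?B y) (cz y)"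
      using weighted_zern_wirt[of a "cz y" p q] a y by (simp add: w_def)
    note pd = has_wirt_partial_deriv[OF L this ev]
    show "partial_deriv 1 v y = L (w y * ((- 1) * ?A y + (- 1) * ?B y))"
      unfolding pd by (intro arg_cong[where f = L]) (simp add: algebra_simps)
    show "partial_deriv 2 v y = L (w y * ((- \<i>) * ?A y + \<i> * ?B y))"
      unfolding pd by (intro arg_cong[where f = L]) (simp add: algebra_simps)
  qed
  have K1: "(K y *v u) $ 1 = k1 * u $ 1" and K2: "(K y *v u) $ 2 = k2 * u $ 2" for y u
    by (simp_all add: K_def matrix_vector_mult_def sum_2)
  define R where "R = riesz_potential_vec (2 * a) (\<lambda>y. K y *v disk_gradient v y)"
  define f1 where "f1 = (\<lambda>z. of_real (riesz_eig a p (Suc q)) * of_real (- k1) * zern (a - 1) p (Suc q) z + of_real (riesz_eig a (Suc p) q) * of_real (- k1) * zern (a - 1) (Suc p) q z)"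
  define f2 where "f2 = (\<lambda>z. of_real (riesz_eig a p (Suc q)) * (- \<i> * of_real k2) * zern (a - 1) p (Suc q) z + of_real (riesz_eig a (Suc p) q) * (\<i> * of_real k2) * zern (a - 1) (Suc p) q z)"
  have R1: "R y $ 1 = L (f1 (cz y))" and R2: "R y $ 2 = L (f2 (cz y))" if y: "y \<noteq> 0" "norm y < 1" for y
  proof -
    have "R y $ 1 = riesz_potential (2 * a) (\<lambda>y. (K y *v disk_gradient v y) $ 1) y"
      by (simp add: R_def riesz_potential_vec_def)
    also have "\<dots> = L (f1 (cz y))"
      unfolding f1_def
    proof (rule riesz_potential_zern[OF a y L])
      fix y
      show "(K y *v disk_gradient v y) $ 1 = indicator unit_disk y * L (of_real ((1 - (norm y)\<^sup>2) powr (a - 1)) * (of_real (- k1) * ?A y + of_real (- k1) * ?B y))"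
      proof (cases "norm y < 1")
        case True
        have "k1 * L (w y * ((- 1) * ?A y + (- 1) * ?B y)) =
          L (k1 *\<^sub>R (w y * ((- 1) * ?A y + (- 1) * ?B y)))"
          by (simp only: L.scaleR real_scaleR_def)
        also have "\<dots> = L (of_real ((1 - (norm y)\<^sup>2) powr (a - 1)) * (of_real (- k1) * ?A y + of_real (- k1) * ?B y))"
          unfolding w_def by (intro arg_cong[where f = L]) (simp add: scaleR_conv_of_real algebra_simps)
        finally show ?thesis using True unfolding K1 by (simp add: disk_gradient_def grad)
      qed (simp add: K1 disk_gradient_def)
    qed
    finally show "R y $ 1 = L (f1 (cz y))" .
    have "R y $ 2 = riesz_potential (2 * a) (\<lambda>y. (K y *v disk_gradient v y) $ 2) y"
      by (simp add: R_def riesz_potential_vec_def)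
    also have "\<dots> = L (f2 (cz y))"
      unfolding f2_def
    proof (rule riesz_potential_zern[OF a y L])
      fix y
      show "(K y *v disk_gradient v y) $ 2 = indicator unit_disk y * L (of_real ((1 - (norm y)\<^sup>2) powr (a - 1)) * ((- \<i> * of_real k2) * ?A y + (\<i> * of_real k2) * ?B y))"
      proof (cases "norm y < 1")
        case True
        have "k2 * L (w y * ((- \<i>) * ?A y + \<i> * ?B y)) =
          L (k2 *\<^sub>R (w y * ((- \<i>) * ?A y + \<i> * ?B y)))"
          by (simp only: L.scaleR real_scaleR_def)
        also have "\<dots> = L (of_real ((1 - (norm y)\<^sup>2) powr (a - 1)) * ((- \<i> * of_real k2) * ?A y + (\<i> * of_real k2) * ?B y))"
          unfolding w_def by (intro arg_cong[where f = L]) (simp add: scaleR_conv_of_real algebra_simps)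
        finally show ?thesis using True unfolding K2 by (simp add: disk_gradient_def grad)
      qed (simp add: K2 disk_gradient_def)
    qed
    finally show "R y $ 2 = L (f2 (cz y))" .
  qed
  have "\<forall>\<^sub>F y in nhds x. y \<in> unit_disk - {0}"
    using x by (intro eventually_nhds_in_open) auto
  then have ev1: "\<forall>\<^sub>F y in nhds x. R y $ 1 = L (f1 (cz y))" and ev2: "\<forall>\<^sub>F y in nhds x. R y $ 2 = L (f2 (cz y))"
    by (eventually_elim, simp add: R1 R2)+
  define z where "z = cz x"
  define DA where "DA = of_real (real p * (real (Suc q) + a)) * zern a (p - 1) (Suc q) z"
  define DB where "DB = of_real (real (Suc q) * (real p + a)) * zern a p q z"
  define EA where "EA = of_real (real (Suc p) * (real q + a)) * zern a p q z"
  define EB where "EB = of_real (real q * (real (Suc p) + a)) * zern a (Suc p) (q - 1) z"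
  have z1: "has_wirt (zern (a - 1) p (Suc q)) DA DB z"
    using zern_wirt[OF a(1), of p "Suc q" z] by (simp add: DA_def DB_def)
  have z2: "has_wirt (zern (a - 1) (Suc p) q) EA EB z"
    using zern_wirt[OF a(1), of "Suc p" q z] by (simp add: EA_def EB_def)
  define \<rho> where "\<rho> = complex_of_real (riesz_eig a p (Suc q))"
  define \<sigma> where "\<sigma> = complex_of_real (riesz_eig a (Suc p) q)"
  have w1: "has_wirt f1 (\<rho> * of_real (- k1) * DA + \<sigma> * of_real (- k1) * EA) (\<rho> * of_real (- k1) * DB + \<sigma> * of_real (- k1) * EB) (cz x)"
    unfolding f1_def z_def[symmetric] \<rho>_def[symmetric] \<sigma>_def[symmetric] by (intro has_wirt_add has_wirt_cmult z1 z2)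
  have w2: "has_wirt f2 (\<rho> * (- \<i> * of_real k2) * DA + \<sigma> * (\<i> * of_real k2) * EA) (\<rho> * (- \<i> * of_real k2) * DB + \<sigma> * (\<i> * of_real k2) * EB) (cz x)"
    unfolding f2_def z_def[symmetric] \<rho>_def[symmetric] \<sigma>_def[symmetric] by (intro has_wirt_add has_wirt_cmult z1 z2)
  have "frac_diffusion (2 * a) K v x = - (partial_deriv 1 (\<lambda>y. R y $ 1) x + partial_deriv 2 (\<lambda>y. R y $ 2) x)"
    by (simp add: frac_diffusion_def divergence_def sum_2 R_def)
  also have "\<dots> = - (L ((\<rho> * of_real (- k1) * DA + \<sigma> * of_real (- k1) * EA) + (\<rho> * of_real (- k1) * DB + \<sigma> * of_real (- k1) * EB))
     + L (\<i> * ((\<rho> * (- \<i> * of_real k2) * DA + \<sigma> * (\<i> * of_real k2) * EA) - (\<rho> * (- \<i> * of_real k2) * DB + \<sigma> * (\<i> * of_real k2) * EB))))"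
    unfolding has_wirt_partial_deriv(1)[OF L w1 ev1] has_wirt_partial_deriv(2)[OF L w2 ev2] ..
  \<comment> \<open>\<open>DB\<close> and \<open>EA\<close> return to \<open>(p, q)\<close>, and
    both coordinate directions contribute with the same sign. \<open>DA\<close> and
    \<open>EB\<close> reach the neighbours \<open>(p - 1, q + 1)\<close> and
    \<open>(p + 1, q - 1)\<close>, where the two factors \<open>\<i>\<close> of the second direction
    reverse its sign.\<close>
  also have "\<dots> = L ((k1 + k2) *\<^sub>R (\<rho> * DB + \<sigma> * EA) + (k1 - k2) *\<^sub>R (\<rho> * DA + \<sigma> * EB))"
    unfolding L.add[symmetric] L.neg[symmetric]
    by (intro arg_cong[where f = L]) (simp add: scaleR_conv_of_real algebra_simps)
  also have "\<dots> = (k1 + k2) * L (\<rho> * DB + \<sigma> * EA) + (k1 - k2) * L (\<rho> * DA + \<sigma> * EB)"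
    by (simp only: L.add L.scaleR real_scaleR_def)
  also have "\<rho> * DB + \<sigma> * EA = (eig a p q / 2) *\<^sub>R zern a p q z"
  proof -
    have "\<rho> * DB = of_real (eig a p q / 4) * zern a p q z"
      unfolding \<rho>_def DB_def riesz_eig_eig(1)[OF a(1), symmetric] by simp
    moreover have "\<sigma> * EA = of_real (eig a p q / 4) * zern a p q z"
      unfolding \<sigma>_def EA_def riesz_eig_eig(2)[OF a(1), symmetric] by simp
    ultimately show ?thesis by (simp only:) (simp add: scaleR_conv_of_real)
  qed
  also have "\<rho> * DA + \<sigma> * EB = (if p = 0 then 0 else (eig a (p - 1) (q + 1) / 4) *\<^sub>R zern a (p - 1) (q + 1) z) + (if q = 0 then 0 else (eig a (p + 1) (q - 1) / 4) *\<^sub>R zern a (p + 1) (q - 1) z)"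
  proof -
    have "\<rho> * DA = (if p = 0 then 0 else (eig a (p - 1) (q + 1) / 4) *\<^sub>R zern a (p - 1) (q + 1) z)"
    proof (cases p)
      case (Suc k)
      have "riesz_eig a p (Suc q) * (real p * (real (Suc q) + a)) = eig a (p - 1) (q + 1) / 4"
        using riesz_eig_eig(2)[OF a(1), of k "Suc q"] by (simp add: Suc)
      then have "\<rho> * DA = of_real (eig a (p - 1) (q + 1) / 4) * zern a (p - 1) (q + 1) z"
        unfolding \<rho>_def DA_def by (metis Suc_eq_plus1 mult.assoc of_real_mult)
      then show ?thesis using Suc by (simp add: scaleR_conv_of_real)
    qed (simp add: DA_def)
    moreover have "\<sigma> * EB = (if q = 0 then 0 else (eig a (p + 1) (q - 1) / 4) *\<^sub>R zern a (p + 1) (q - 1) z)"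
    proof (cases q)
      case (Suc k)
      have "riesz_eig a (Suc p) q * (real q * (real (Suc p) + a)) = eig a (p + 1) (q - 1) / 4"
        using riesz_eig_eig(1)[OF a(1), of "Suc p" k] by (simp add: Suc)
      then have "\<sigma> * EB = of_real (eig a (p + 1) (q - 1) / 4) * zern a (p + 1) (q - 1) z"
        unfolding \<sigma>_def EB_def by (metis Suc_eq_plus1 mult.assoc of_real_mult)
      then show ?thesis using Suc by (simp add: scaleR_conv_of_real)
    qed (simp add: EB_def)
    ultimately show ?thesis by simp
  qed
  finally show ?thesis
    unfolding K_def v_def z_def
    by (cases "p = 0"; cases "q = 0") (simp_all add: L.add L.scaleR L.zero algebra_simps)
qed

section \<open>Orthogonality\<close>

text \<open>A step of Rodrigues' formula: by \<open>jac_weighted_deriv_both\<close>, differentiating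
  weight times polynomial gives the next degree with both parameters lowered. The factor
  \<open>f\<close> is carried along for integration by parts.\<close>

lemma jac_weight_deriv:
  assumes s: "0 < s" "s < 1" and D: "(f has_real_derivative E) (at s)"
  shows "((\<lambda>s. (1 - s) powr (a + 1) * s ^ Suc l * jac n (a + 1) (real l + 1) s * f s) has_real_derivative
     (- real (Suc n) * ((1 - s) powr a * s ^ l * jac (Suc n) a (real l) s * f s) +
      (1 - s) powr (a + 1) * s ^ Suc l * jac n (a + 1) (real l + 1) s * E)) (at s)"
proof -
  obtain D' where D': "(jac n (a + 1) (real l + 1) has_real_derivative D') (at s)" using jac_DERIV by blast
  have w: "(1 - s) powr (a + 1) = (1 - s) powr a * (1 - s)" using s by (simp add: powr_add)
  have 1: "((\<lambda>s. (1 - s) powr (a + 1)) has_real_derivative - (a + 1) * (1 - s) powr a) (at s)"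
    using s by (auto intro!: derivative_eq_intros simp: algebra_simps)
  have 2: "((\<lambda>s. s ^ Suc l) has_real_derivative (real l + 1) * s ^ l) (at s)"
    using DERIV_pow[of "Suc l" s UNIV] by (simp add: add.commute)
  have "((\<lambda>s. (1 - s) powr (a + 1) * s ^ Suc l * jac n (a + 1) (real l + 1) s) has_real_derivative
     (- (a + 1) * (1 - s) powr a * s ^ Suc l + (real l + 1) * s ^ l * (1 - s) powr (a + 1)) * jac n (a + 1) (real l + 1) s
      + D' * ((1 - s) powr (a + 1) * s ^ Suc l)) (at s)"
    by (intro DERIV_mult 1 2 D')
  also have "(- (a + 1) * (1 - s) powr a * s ^ Suc l + (real l + 1) * s ^ l * (1 - s) powr (a + 1)) * jac n (a + 1) (real l + 1) s
      + D' * ((1 - s) powr (a + 1) * s ^ Suc l) = (1 - s) powr a * s ^ l * (s * (1 - s) * D' + ((real l + 1) * (1 - s) - (a + 1) * s) * jac n (a + 1) (real l + 1) s)"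
    unfolding w by (simp add: algebra_simps)
  also have "\<dots> = - real (Suc n) * ((1 - s) powr a * s ^ l * jac (Suc n) a (real l) s)"
    unfolding jac_weighted_deriv_both[OF D'] by simp
  finally show ?thesis
    by (rule DERIV_cong[OF DERIV_mult[OF _ D]]) (simp add: mult_ac del: of_nat_Suc)
qed

definition jac_norm :: "nat \<Rightarrow> real \<Rightarrow> nat \<Rightarrow> real" where
  "jac_norm n a l = dn a n / (dn a (n + l) * (2 * real n + real l + a + 1))"

lemma jac_norm_0: "0 < a \<Longrightarrow> jac_norm 0 a l = Beta (a + 1) (real l + 1)"
  using Gamma_plus1[of "real l + a + 1"] Gamma_fact[of l, where 'a = real]
  by (simp add: jac_norm_def dn_def Beta_def nonpos_Ints_def add_ac field_simps)

text \<open>The factor is the one that a single integration by parts produces: the numerator comes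
  from \<open>jac_has_derivative\<close>, the denominator from \<open>jac_orth_step\<close>.\<close>

lemma jac_norm_Suc:
  assumes "0 < a"
  shows "(real (Suc n) + a + real l + 1) / real (Suc n) * jac_norm n (a + 1) (Suc l) = jac_norm (Suc n) a l"
proof -
  have d: "dn (a + 1) k = real (Suc k) * dn a (Suc k)" for k
    using dn_shift_Suc[of k "a + 1"] by simp
  have p: "0 < dn a k" for k using assms by (simp add: dn_pos)
  have e: "dn a (Suc (Suc n + l)) = dn a (Suc n + l) * (real (Suc (Suc n + l)) + a) / real (Suc (Suc n + l))"
    by (rule dn_Suc[OF assms])
  define c where "c = real (Suc n) + a + real l + 1"
  have c: "0 < c" using assms by (simp add: c_def)
  have D: "dn (a + 1) (n + Suc l) = dn a (Suc n + l) * c"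
    unfolding d add_Suc_right add_Suc c_def using e by (simp add: field_simps)
  have t: "2 * real n + real (Suc l) + (a + 1) + 1 = 2 * real (Suc n) + real l + a + 1" by simp
  show ?thesis
    unfolding jac_norm_def c_def[symmetric] D t unfolding d using c by simp
qed

text \<open>Integration by parts. The boundary terms vanish because of
  \<open>(1 - s) powr (a + 1)\<close> at 1 and \<open>s ^ Suc l\<close> at 0.\<close>

lemma jac_orth_step:
  fixes I :: real
  assumes a: "0 < a" and f: "\<And>s. (f has_real_derivative f' s) (at s)"
    and I: "((\<lambda>s. (1 - s) powr (a + 1) * s ^ Suc l * jac n (a + 1) (real l + 1) s * f' s) has_integral I) {0..1}"
  shows "((\<lambda>s. (1 - s) powr a * s ^ l * jac (Suc n) a (real l) s * f s) has_integral (I / real (Suc n))) {0..1}"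
proof -
  define G where "G = (\<lambda>s. (1 - s) powr (a + 1) * s ^ Suc l * jac n (a + 1) (real l + 1) s * f s)"
  define g where "g = (\<lambda>s. (1 - s) powr a * s ^ l * jac (Suc n) a (real l) s * f s)"
  define h where "h = (\<lambda>s. (1 - s) powr (a + 1) * s ^ Suc l * jac n (a + 1) (real l + 1) s * f' s)"
  have cf: "continuous_on {0..1} f"
    using f by (auto intro!: continuous_at_imp_continuous_on DERIV_isCont)
  have "((\<lambda>s. - real (Suc n) * g s + h s) has_integral (G 1 - G 0)) {0..1}"
  proof (rule fundamental_theorem_of_calculus_interior)
    show "continuous_on {0..1} G"
      unfolding G_def using a by (intro continuous_intros continuous_on_powr' cf) auto
    fix s :: real assume "s \<in> {0<..<1}"
    then show "(G has_vector_derivative (- real (Suc n) * g s + h s)) (at s)"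
      unfolding G_def g_def h_def has_real_derivative_iff_has_vector_derivative[symmetric]
      by (intro jac_weight_deriv f) auto
  qed simp
  then have "((\<lambda>s. - real (Suc n) * g s + h s) has_integral 0) {0..1}"
    using a by (simp add: G_def)
  from has_integral_diff[OF I[folded h_def] this]
  have "((\<lambda>s. real (Suc n) * g s) has_integral I) {0..1}" by (simp del: of_nat_Suc)
  from has_integral_mult_right[OF this, of "1 / real (Suc n)"]
  show ?thesis unfolding g_def by (simp del: of_nat_Suc)
qed

text \<open>Integration by parts lowers both degrees by one and raises both parameters by one. When
  one degree reaches 0 first, the remaining factor is constant and its derivative kills the
  integral.\<close>

lemma jac_orthogonal:
  assumes "0 < a"
  shows "((\<lambda>s. (1 - s) powr a * s ^ l * jac n a (real l) s * jac k a (real l) s) has_integral (if n = k then jac_norm n a l else 0)) {0..1}"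
  using assms
proof (induction n arbitrary: k a l)
  case 0
  show ?case
  proof (cases k)
    case [simp]: 0
    have "((\<lambda>t. t powr (real l + 1 - 1) * (1 - t) powr (a + 1 - 1)) has_integral Beta (real l + 1) (a + 1)) {0..1}"
      using \<open>0 < a\<close> by (intro has_integral_Beta_real) auto
    then have "((\<lambda>t. t powr (real l) * (1 - t) powr a) has_integral Beta (real l + 1) (a + 1)) {0<..<1}"
      by (simp add: has_integral_Icc_iff_Ioo)
    then have "((\<lambda>s. (1 - s) powr a * s ^ l) has_integral Beta (real l + 1) (a + 1)) {0<..<1}"
      by (rule has_integral_eq[rotated]) (auto simp: powr_realpow)
    then show ?thesis
      using \<open>0 < a\<close> by (simp add: has_integral_Icc_iff_Ioo jac_norm_0 Beta_commute)
  next
    case (Suc m)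
    have "((\<lambda>s. (1 - s) powr a * s ^ l * jac (Suc m) a (real l) s * 1) has_integral (0 / real (Suc m))) {0..1}"
      by (rule jac_orth_step[OF \<open>0 < a\<close>, where f' = "\<lambda>_. 0"]) auto
    then show ?thesis by (simp add: Suc)
  qed
next
  case (Suc n)
  show ?case
  proof (cases k)
    case 0
    have "((\<lambda>s. (1 - s) powr a * s ^ l * jac (Suc n) a (real l) s * 1) has_integral (0 / real (Suc n))) {0..1}"
      by (rule jac_orth_step[OF \<open>0 < a\<close>, where f' = "\<lambda>_. 0"]) auto
    then show ?thesis by (simp add: 0)
  next
    case (Suc m)
    define c where "c = real (Suc m) + a + real l + 1"
    have IH: "((\<lambda>s. (1 - s) powr (a + 1) * s ^ Suc l * jac n (a + 1) (real (Suc l)) s * jac m (a + 1) (real (Suc l)) s) has_integral (if n = m then jac_norm n (a + 1) (Suc l) else 0)) {0..1}"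
      using \<open>0 < a\<close> by (intro Suc.IH) simp
    have "((\<lambda>s. (1 - s) powr a * s ^ l * jac (Suc n) a (real l) s * jac (Suc m) a (real l) s) has_integral ((c * (if n = m then jac_norm n (a + 1) (Suc l) else 0)) / real (Suc n))) {0..1}"
    proof (rule jac_orth_step[OF \<open>0 < a\<close>])
      show "(jac (Suc m) a (real l) has_real_derivative c * jac m (a + 1) (real l + 1) s) (at s)" for s
        unfolding c_def by (rule jac_has_derivative)
      show "((\<lambda>s. (1 - s) powr (a + 1) * s ^ Suc l * jac n (a + 1) (real l + 1) s * (c * jac m (a + 1) (real l + 1) s)) has_integral
        (c * (if n = m then jac_norm n (a + 1) (Suc l) else 0))) {0..1}"
        using has_integral_mult_right[OF IH, of c] by (simp add: mult_ac add_ac)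
    qed
    moreover have "(c * (if n = m then jac_norm n (a + 1) (Suc l) else 0)) / real (Suc n) = (if Suc n = k then jac_norm (Suc n) a l else 0)"
      unfolding Suc c_def using jac_norm_Suc[OF \<open>0 < a\<close>, of m l, symmetric] by (simp del: of_nat_Suc)
    ultimately show ?thesis unfolding Suc by simp
  qed
qed

section \<open>From the interval to the disk\<close>

lemma integral_radial:
  fixes h :: "real \<Rightarrow> real"
  assumes [measurable]: "h \<in> borel_measurable borel"
  shows "(\<integral>y. indicator (ball (0::real^2) 1) y * h ((norm y)\<^sup>2) \<partial>lborel) = pi * (\<integral>s. indicator {0<..<1} s * h s \<partial>lborel)"
proof -
  have 1: "density lborel (indicator (ball 0 1 :: (real^2) set)) = density lborel (\<lambda>y. ennreal (indicator (ball 0 1 :: (real^2) set) y))"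
    by (simp add: ennreal_indicator)
  have "(\<lambda>s. ennreal pi * indicator {0<..<1} s) = (\<lambda>s::real. ennreal (pi * indicator {0<..<1} s))"
    by (auto simp: fun_eq_iff split: split_indicator)
  then have 2: "distr (density lborel (\<lambda>y. ennreal (indicator (ball 0 1 :: (real^2) set) y))) borel (\<lambda>y. (norm y)\<^sup>2) = density lborel (\<lambda>s. ennreal (pi * indicator {0<..<1} s))"
    using distr_norm_square_disk unfolding 1 by simp
  have "(\<integral>y. indicator (ball (0::real^2) 1) y * h ((norm y)\<^sup>2) \<partial>lborel) = (\<integral>s. h s \<partial>distr (density lborel (\<lambda>y. ennreal (indicator (ball 0 1 :: (real^2) set) y))) borel (\<lambda>y. (norm y)\<^sup>2))"
    by (subst integral_distr, simp, simp, subst integral_density) auto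
  also have "\<dots> = pi * (\<integral>s. indicator {0<..<1} s * h s \<partial>lborel)"
    unfolding 2 by (subst integral_density) (auto simp: mult.assoc)
  finally show ?thesis .
qed

definition zern_norm :: "real \<Rightarrow> nat \<Rightarrow> nat \<Rightarrow> real" where
  "zern_norm a p q = pi / ((real (p + q) + a + 1) * (dn a p * dn a q))"

lemma zern_norm_pos: "0 < a \<Longrightarrow> 0 < zern_norm a p q"
  unfolding zern_norm_def by (intro divide_pos_pos mult_pos_pos dn_pos) auto

lemma zern_norm_commute: "zern_norm a p q = zern_norm a q p"
  by (simp add: zern_norm_def mult_ac add_ac)

lemma zern_rot: "zern a p q (cis t * z) = cis t ^ p * cnj (cis t) ^ q * zern a p q z"
proof -
  have 1: "cis t * cnj (cis t) = 1" by (simp add: complex_norm_square[symmetric])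
  have 2: "cis t ^ (k + l) * cnj (cis t) ^ k = cis t ^ l" "cis t ^ k * cnj (cis t) ^ (k + l) = cnj (cis t) ^ l" for k l
  proof -
    have "cis t ^ (k + l) * cnj (cis t) ^ k = (cis t * cnj (cis t)) ^ k * cis t ^ l"
      by (simp add: power_add power_mult_distrib)
    then show "cis t ^ (k + l) * cnj (cis t) ^ k = cis t ^ l" by (simp only: 1) simp
    have "cis t ^ k * cnj (cis t) ^ (k + l) = (cis t * cnj (cis t)) ^ k * cnj (cis t) ^ l"
      by (simp add: power_add power_mult_distrib)
    then show "cis t ^ k * cnj (cis t) ^ (k + l) = cnj (cis t) ^ l" by (simp only: 1) simp
  qed
  show ?thesis
  proof (cases "q \<le> p")
    case True
    then show ?thesis using 2(1)[of q "p - q"]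
      by (simp add: zern_def norm_mult power_mult_distrib)
  next
    case False
    then show ?thesis using 2(2)[of p "q - p"]
      by (simp add: zern_def norm_mult power_mult_distrib)
  qed
qed

lemma integrable_disk_weight:
  fixes f :: "real^2 \<Rightarrow> 'b :: {banach, second_countable_topology}"
  assumes a: "0 < a" and f: "continuous_on UNIV f"
  shows "integrable lborel (\<lambda>y. (indicator unit_disk y * (1 - (norm y)\<^sup>2) powr a) *\<^sub>R f y)"
proof -
  have "compact (f ` cball 0 1)"
    by (intro compact_continuous_image continuous_on_subset[OF f]) auto
  then obtain B where B: "\<And>y. y \<in> cball 0 1 \<Longrightarrow> norm (f y) \<le> B"
    by (meson bounded_iff compact_imp_bounded imageI)
  have [measurable]: "f \<in> borel_measurable borel" using f by (rule borel_measurable_continuous_onI)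
  have m: "emeasure lborel (unit_disk) < \<infinity>" by (rule emeasure_lborel_ball_finite)
  show ?thesis
  proof (rule Bochner_Integration.integrable_bound)
    show "integrable lborel (\<lambda>y. B * indicat_real unit_disk y)"
      using m by (intro integrable_mult_right integrable_real_indicator) auto
    show "AE y in lborel. norm ((indicator unit_disk y * (1 - (norm y)\<^sup>2) powr a) *\<^sub>R f y) \<le> norm (B * indicat_real unit_disk y)"
    proof (rule AE_I2)
      fix y :: "real^2"
      show "norm ((indicator unit_disk y * (1 - (norm y)\<^sup>2) powr a) *\<^sub>R f y) \<le> norm (B * indicat_real unit_disk y)"
      proof (cases "norm y < 1")
        case True
        then have "(norm y)\<^sup>2 \<le> 1" by (simp add: abs_square_le_1)
        then have "(1 - (norm y)\<^sup>2) powr a \<le> 1" using a by (intro powr_le1) auto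
        then have "(1 - (norm y)\<^sup>2) powr a * norm (f y) \<le> 1 * B"
          using B[of y] True by (intro mult_mono) auto
        then show ?thesis using True by simp
      qed simp
    qed
  qed measurable
qed

lemma continuous_on_zern_cz: "continuous_on A (\<lambda>y. zern a p q (cz y))"
proof -
  have "continuous_on A (zern a p q \<circ> cz)"
    by (intro continuous_on_compose linear_continuous_on bounded_linear_cz continuous_zern)
  then show ?thesis by (simp add: o_def)
qed

lemma zern_orthogonal_same_angle:
  assumes a: "0 < a" and e: "q \<le> p" "p + q' = q + p'"
  shows "(\<integral>y. (indicator unit_disk y * (1 - (norm y)\<^sup>2) powr a) *\<^sub>R (zern a p q (cz y) * zern a q' p' (cz y)) \<partial>lborel) = (if p = p' \<and> q = q' then of_real (zern_norm a p q) else 0)"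
proof -
  define l where "l = p - q"
  have p: "p = q + l" "p' = q' + l" using e by (auto simp: l_def)
  define h where "h = (\<lambda>s. (1 - s) powr a * s ^ l * jac q a (real l) s * jac q' a (real l) s / (dn a q * dn a q'))"
  have [measurable]: "jac n a b \<in> borel_measurable borel" for n b
    by (intro borel_measurable_continuous_onI continuous_intros)
  have [measurable]: "h \<in> borel_measurable borel"
    unfolding h_def by measurable
  have "(\<integral>y. (indicator unit_disk y * (1 - (norm y)\<^sup>2) powr a) *\<^sub>R (zern a p q (cz y) * zern a q' p' (cz y)) \<partial>lborel) =
    (\<integral>y. complex_of_real (indicator unit_disk y * h ((norm y)\<^sup>2)) \<partial>lborel)"
  proof (intro Bochner_Integration.integral_cong refl)
    fix y
    have z: "zern a q' p' (cz y) = cnj (cz y) ^ l * of_real (jac q' a (real l) ((norm y)\<^sup>2) / dn a q')"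
      by (cases "l = 0") (auto simp: zern_def p)
    have "cz y ^ l * cnj (cz y) ^ l = of_real (((norm y)\<^sup>2) ^ l)"
      by (simp add: power_mult_distrib[symmetric] complex_norm_square[symmetric])
    moreover have "zern a p q (cz y) * zern a q' p' (cz y) = (cz y ^ l * cnj (cz y) ^ l) * of_real (jac q a (real l) ((norm y)\<^sup>2) / dn a q * (jac q' a (real l) ((norm y)\<^sup>2) / dn a q'))"
      unfolding z by (simp add: zern_def p)
    ultimately have "zern a p q (cz y) * zern a q' p' (cz y) = of_real (((norm y)\<^sup>2) ^ l * (jac q a (real l) ((norm y)\<^sup>2) / dn a q * (jac q' a (real l) ((norm y)\<^sup>2) / dn a q')))"
      by (simp only: of_real_mult)
    then show "(indicator unit_disk y * (1 - (norm y)\<^sup>2) powr a) *\<^sub>R (zern a p q (cz y) * zern a q' p' (cz y)) = complex_of_real (indicator unit_disk y * h ((norm y)\<^sup>2))"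
      by (simp only: scaleR_conv_of_real h_def of_real_mult[symmetric]) (simp add: mult_ac)
  qed
  also have "\<dots> = of_real (pi * (\<integral>s. indicator {0<..<1} s * h s \<partial>lborel))"
    by (simp only: integral_complex_of_real) (subst integral_radial, auto)
  also have "(\<integral>s. indicator {0<..<1} s * h s \<partial>lborel) = (if q = q' then jac_norm q a l else 0) / (dn a q * dn a q')"
  proof -
    have hi: "(h has_integral ((if q = q' then jac_norm q a l else 0) / (dn a q * dn a q'))) {0<..<1}"
      unfolding h_def has_integral_Icc_iff_Ioo[symmetric]
      by (intro has_integral_divide jac_orthogonal a)
    have "continuous_on {0..1} h"
      unfolding h_def divide_inverse using a by (intro continuous_on_mult continuous_on_powr' continuous_on_const continuous_on_diff continuous_on_power continuous_on_id continuous_on_jac) auto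
    then have "set_integrable lborel {0..1} h"
      unfolding set_integrable_def by (intro borel_integrable_compact compact_Icc)
    then have "set_integrable lborel {0<..<1} h"
      by (rule set_integrable_subset) auto
    from set_borel_integral_eq_integral(2)[OF this] hi show ?thesis
      by (simp add: set_lebesgue_integral_def integral_unique)
  qed
  finally show ?thesis
    unfolding p using dn_pos[of a] a
    by (auto simp: jac_norm_def zern_norm_def p divide_simps less_imp_neq[symmetric]) (simp_all add: algebra_simps)?
qed

text \<open>Since \<open>cnj (zern a p' q' z) = zern a q' p' z\<close>, the swapped indices encode
  the Hermitian product. Different angular frequencies cancel by rotation averaging; equal ones
  reduce to \<open>jac_orthogonal\<close>.\<close>

theorem zern_orthogonal:
  assumes a: "0 < a"
  shows "(\<integral>y. (indicator unit_disk y * (1 - (norm y)\<^sup>2) powr a) *\<^sub>R (zern a p q (cz y) * zern a q' p' (cz y)) \<partial>lborel) = (if p = p' \<and> q = q' then of_real (zern_norm a p q) else 0)"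
proof (cases "p + q' = q + p'")
  case True
  show ?thesis
  proof (cases "q \<le> p")
    case True
    then show ?thesis using \<open>p + q' = q + p'\<close> by (intro zern_orthogonal_same_angle a)
  next
    case False
    then have *: "p \<le> q" "q + p' = p + q'" using True by auto
    have "(\<integral>y. (indicator unit_disk y * (1 - (norm y)\<^sup>2) powr a) *\<^sub>R (zern a p q (cz y) * zern a q' p' (cz y)) \<partial>lborel) =
      cnj (\<integral>y. (indicator unit_disk y * (1 - (norm y)\<^sup>2) powr a) *\<^sub>R (zern a q p (cz y) * zern a p' q' (cz y)) \<partial>lborel)"
      by (subst Bochner_Integration.integral_cnj[symmetric]) (simp add: cnj_zern)
    then show ?thesis
      using zern_orthogonal_same_angle[OF a *] by (auto simp: zern_norm_commute[of a q p] zern_norm_commute[of a q' p'])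
  qed
next
  case False
  define F where "F = (\<lambda>y. (indicator unit_disk y * (1 - (norm y)\<^sup>2) powr a) *\<^sub>R (zern a p q (cz y) * zern a q' p' (cz y)))"
  have "integrable lborel F"
    unfolding F_def by (intro integrable_disk_weight a continuous_on_mult continuous_on_zern_cz)
  then have "(\<integral>y. F y \<partial>lborel) = (\<integral>y. (\<integral>t. F (rot t y) \<partial>circ) \<partial>lborel)"
    by (rule integral_rot_average)
  also have "(\<lambda>y. \<integral>t. F (rot t y) \<partial>circ) = (\<lambda>y. 0)"
  proof
    fix y
    have "(\<integral>t. F (rot t y) \<partial>circ) = (\<integral>t. F y * (cis t ^ (p + q') * cnj (cis t) ^ (q + p')) \<partial>circ)"
      by (intro Bochner_Integration.integral_cong refl) (simp add: F_def zern_rot power_add indicator_def)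
    also have "\<dots> = F y * (\<integral>t. cis t ^ (p + q') * cnj (cis t) ^ (q + p') \<partial>circ)"
      by (rule integral_mult_right_zero)
    also have "\<dots> = 0" unfolding integral_cis_power using False by simp
    finally show "(\<integral>t. F (rot t y) \<partial>circ) = 0" .
  qed
  finally have "(\<integral>y. F y \<partial>lborel) = 0" by simp
  then show ?thesis unfolding F_def using False by auto
qed

definition part :: "int \<Rightarrow> complex \<Rightarrow> real" where
  "part \<mu> z = (if \<mu> = 1 then Re z else Im z)"

lemma bounded_linear_part: "bounded_linear (part \<mu>)"
  by (cases "\<mu> = 1") (auto simp: part_def[abs_def] bounded_linear_Re bounded_linear_Im)

lemma weighted_inner_lborel:
  assumes "u \<in> borel_measurable borel" "v \<in> borel_measurable borel"
  shows "weighted_inner (2 * a) u v = (\<integral>y. (indicator unit_disk y * (1 - (norm y)\<^sup>2) powr a) *\<^sub>R (u y * v y) \<partial>lborel)"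
proof -
  note [measurable] = assms
  have "weighted_inner (2 * a) u v = (\<integral>y. indicator unit_disk y *\<^sub>R (weight a y * (u y * v y)) \<partial>lebesgue)"
    unfolding weighted_inner_def by (subst integral_restrict_space) auto
  also have "\<dots> = (\<integral>y. indicator unit_disk y *\<^sub>R (weight a y * (u y * v y)) \<partial>lborel)"
    by (rule integral_completion) (simp add: weight_def)
  finally show ?thesis by (simp add: weight_def mult_ac)
qed

text \<open>Products of real and imaginary parts are half sums of parts of \<open>u * cnj v\<close>
  and \<open>u * v\<close>; the second product accounts for the mirrored index. Mixed parities
  vanish because both complex integrals are real.\<close>

theorem part_zern_inner:
  assumes a: "0 < a" and \<mu>: "\<mu> \<in> {1, -1}" "\<mu>' \<in> {1, -1}"
  shows "weighted_inner (2 * a) (\<lambda>y. part \<mu> (zern a p q (cz y))) (\<lambda>y. part \<mu>' (zern a p' q' (cz y))) =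
    (if \<mu> = \<mu>' then zern_norm a p q / 2 * (of_bool (p = p' \<and> q = q') + of_int \<mu> * of_bool (p = q' \<and> q = p')) else 0)"
proof -
  define \<omega> where "\<omega> = (\<lambda>y :: real^2. indicator unit_disk y * (1 - (norm y)\<^sup>2) powr a)"
  define U where "U = (\<lambda>y. zern a p q (cz y))"
  define V where "V = (\<lambda>y. zern a p' q' (cz y))"
  have [measurable]: "part \<mu> \<in> borel_measurable borel" for \<mu>
    by (intro borel_measurable_continuous_onI linear_continuous_on bounded_linear_part)
  have UV: "integrable lborel (\<lambda>y. \<omega> y *\<^sub>R (U y * V y))" "(\<integral>y. \<omega> y *\<^sub>R (U y * V y) \<partial>lborel) = (if p = q' \<and> q = p' then of_real (zern_norm a p q) else 0)"
    using zern_orthogonal[OF a, of p q p' q'] unfolding \<omega>_def U_def V_def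
    by (auto intro!: integrable_disk_weight a continuous_on_mult continuous_on_zern_cz)
  have UV': "integrable lborel (\<lambda>y. \<omega> y *\<^sub>R (U y * cnj (V y)))" "(\<integral>y. \<omega> y *\<^sub>R (U y * cnj (V y)) \<partial>lborel) = (if p = p' \<and> q = q' then of_real (zern_norm a p q) else 0)"
    using zern_orthogonal[OF a, of p q q' p'] unfolding \<omega>_def U_def V_def cnj_zern
    by (auto intro!: integrable_disk_weight a continuous_on_mult continuous_on_zern_cz)
  have I: "weighted_inner (2 * a) (\<lambda>y. part \<mu> (U y)) (\<lambda>y. part \<mu>' (V y)) = (\<integral>y. \<omega> y *\<^sub>R (part \<mu> (U y) * part \<mu>' (V y)) \<partial>lborel)"
    unfolding \<omega>_def U_def V_def by (rule weighted_inner_lborel) measurable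
  have red: "(\<integral>y. \<omega> y *\<^sub>R (part \<mu> (U y) * part \<mu>' (V y)) \<partial>lborel) = L (\<integral>y. \<omega> y *\<^sub>R (U y * cnj (V y)) \<partial>lborel) / 2 + s * (L (\<integral>y. \<omega> y *\<^sub>R (U y * V y) \<partial>lborel) / 2)"
    if L: "bounded_linear L" and e: "\<And>u v. part \<mu> u * part \<mu>' v = L (u * cnj v) / 2 + s * (L (u * v) / 2)" for L s
  proof -
    interpret L: bounded_linear L by (rule L)
    have "(\<integral>y. \<omega> y *\<^sub>R (part \<mu> (U y) * part \<mu>' (V y)) \<partial>lborel) = (\<integral>y. L (\<omega> y *\<^sub>R (U y * cnj (V y))) / 2 + s * (L (\<omega> y *\<^sub>R (U y * V y)) / 2) \<partial>lborel)"
      by (intro Bochner_Integration.integral_cong refl) (simp add: e L.scaleR algebra_simps)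
    also have "\<dots> = (\<integral>y. L (\<omega> y *\<^sub>R (U y * cnj (V y))) \<partial>lborel) / 2 + s * ((\<integral>y. L (\<omega> y *\<^sub>R (U y * V y)) \<partial>lborel) / 2)"
      using integrable_bounded_linear[OF L UV(1)] integrable_bounded_linear[OF L UV'(1)] by simp
    finally show ?thesis
      using integral_bounded_linear[OF L UV(1)] integral_bounded_linear[OF L UV'(1)] by simp
  qed
  define P1 where "P1 \<longleftrightarrow> p = p' \<and> q = q'"
  define P2 where "P2 \<longleftrightarrow> p = q' \<and> q = p'"
  consider "\<mu> = 1" "\<mu>' = 1" | "\<mu> = -1" "\<mu>' = -1" | "\<mu> = 1" "\<mu>' = -1" | "\<mu> = -1" "\<mu>' = 1" using \<mu> by auto
  then have "weighted_inner (2 * a) (\<lambda>y. part \<mu> (U y)) (\<lambda>y. part \<mu>' (V y)) =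
    (if \<mu> = \<mu>' then zern_norm a p q / 2 * (of_bool (p = p' \<and> q = q') + of_int \<mu> * of_bool (p = q' \<and> q = p')) else 0)"
  proof cases
    case 1
    have "part \<mu> u * part \<mu>' v = Re (u * cnj v) / 2 + 1 * (Re (u * v) / 2)" for u v
      by (simp add: 1 part_def field_simps)
    from red[OF bounded_linear_Re this] show ?thesis
      unfolding I UV(2) UV'(2) P1_def[symmetric] P2_def[symmetric] by (simp add: 1)
  next
    case 2
    have "part \<mu> u * part \<mu>' v = Re (u * cnj v) / 2 + -1 * (Re (u * v) / 2)" for u v
      by (simp add: 2 part_def field_simps)
    from red[OF bounded_linear_Re this] show ?thesis
      unfolding I UV(2) UV'(2) P1_def[symmetric] P2_def[symmetric] by (simp add: 2)
  next
    case 3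
    have "part \<mu> u * part \<mu>' v = (\<lambda>z. - Im z) (u * cnj v) / 2 + -1 * ((\<lambda>z. - Im z) (u * v) / 2)" for u v
      by (simp add: 3 part_def field_simps)
    from red[OF bounded_linear_minus[OF bounded_linear_Im] this] show ?thesis
      unfolding I UV(2) UV'(2) P1_def[symmetric] P2_def[symmetric] by (simp add: 3)
  next
    case 4
    have "part \<mu> u * part \<mu>' v = Im (u * cnj v) / 2 + 1 * (Im (u * v) / 2)" for u v
      by (simp add: 4 part_def field_simps)
    from red[OF bounded_linear_Im this] show ?thesis
      unfolding I UV(2) UV'(2) P1_def[symmetric] P2_def[symmetric] by (simp add: 4)
  qed
  then show ?thesis unfolding U_def V_def .
qed

section \<open>The tridiagonal system\<close>

definition nbr :: "nat \<Rightarrow> (nat \<Rightarrow> real) \<Rightarrow> nat \<Rightarrow> real" where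
  "nbr N X p = (if p = 0 then 0 else X (p - 1)) + (if p < N then X (p + 1) else 0)"

lemma nbr_diff: "nbr N (\<lambda>p. X p - Y p) p = nbr N X p - nbr N Y p"
  by (simp add: nbr_def)

text \<open>The adjacency matrix of a path has norm at most 2 whatever its length: each of the two
  shifts is a contraction. The independence of \<open>N\<close> is what later allows summation over
  all degrees.\<close>

lemma nbr_energy: "\<bar>\<Sum>p\<le>N. X p * nbr N X p\<bar> \<le> 2 * (\<Sum>p\<le>N. (X p)\<^sup>2)"
proof -
  have lo: "(\<Sum>p\<le>N. (if p = 0 then 0 else X (p - 1))\<^sup>2) \<le> (\<Sum>p\<le>N. (X p)\<^sup>2)"
  proof (cases N)
    case (Suc M)
    have "(\<Sum>p\<le>Suc M. (if p = 0 then 0 else X (p - 1))\<^sup>2) = (\<Sum>p\<le>M. (X p)\<^sup>2)"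
      by (simp add: sum.atMost_Suc_shift del: sum.atMost_Suc)
    also have "\<dots> \<le> (\<Sum>p\<le>Suc M. (X p)\<^sup>2)"
      by simp
    finally show ?thesis unfolding Suc .
  qed simp
  have hi: "(\<Sum>p\<le>N. (if p < N then X (p + 1) else 0)\<^sup>2) \<le> (\<Sum>p\<le>N. (X p)\<^sup>2)"
  proof (cases N)
    case (Suc M)
    have "(\<Sum>p\<le>Suc M. (if p < Suc M then X (p + 1) else 0)\<^sup>2) = (\<Sum>p\<le>M. (X (Suc p))\<^sup>2)"
      by simp
    also have "\<dots> \<le> (\<Sum>p\<le>Suc M. (X p)\<^sup>2)"
      by (simp add: sum.atMost_Suc_shift del: sum.atMost_Suc)
    finally show ?thesis unfolding Suc .
  qed simp
  have "\<bar>\<Sum>p\<le>N. X p * nbr N X p\<bar> \<le> (\<Sum>p\<le>N. \<bar>X p * nbr N X p\<bar>)" by (rule sum_abs)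
  also have "\<dots> \<le> (\<Sum>p\<le>N. (X p)\<^sup>2 + ((if p = 0 then 0 else X (p - 1))\<^sup>2 + (if p < N then X (p + 1) else 0)\<^sup>2) / 2)"
  proof (intro sum_mono)
    fix p
    have *: "\<bar>x * y\<bar> \<le> (x\<^sup>2 + y\<^sup>2) / 2" for x y :: real
      using sum_squares_bound[of "\<bar>x\<bar>" "\<bar>y\<bar>"] by (simp add: abs_mult)
    have "\<bar>x * (y + z)\<bar> \<le> x\<^sup>2 + (y\<^sup>2 + z\<^sup>2) / 2" for x y z :: real
      using *[of x y] *[of x z] abs_triangle_ineq[of "x * y" "x * z"] by (simp add: distrib_left field_simps)
    then show "\<bar>X p * nbr N X p\<bar> \<le> (X p)\<^sup>2 + ((if p = 0 then 0 else X (p - 1))\<^sup>2 + (if p < N then X (p + 1) else 0)\<^sup>2) / 2"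
      unfolding nbr_def .
  qed
  also have "\<dots> \<le> 2 * (\<Sum>p\<le>N. (X p)\<^sup>2)"
    using lo hi by (simp add: sum.distrib sum_divide_distrib[symmetric])
  finally show ?thesis .
qed

text \<open>The equation is tested against \<open>X\<close> itself; \<open>nbr_energy\<close> gives
  coercivity and Young's inequality absorbs the right-hand side. With
  \<open>k = (k1 + k2) / 2\<close> and \<open>\<kappa> = (k1 - k2) / 2\<close> the constant
  \<open>k - \<bar>\<kappa>\<bar>\<close> is \<open>min k1 k2\<close>.\<close>

lemma tridiagonal_bound:
  assumes k: "\<bar>\<kappa>\<bar> < k" and eq: "\<And>p. p \<le> N \<Longrightarrow> k * X p + \<kappa> / 2 * nbr N X p = g p"
  shows "(k - \<bar>\<kappa>\<bar>)\<^sup>2 * (\<Sum>p\<le>N. (X p)\<^sup>2) \<le> (\<Sum>p\<le>N. (g p)\<^sup>2)"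
proof -
  let ?S = "\<Sum>p\<le>N. (X p)\<^sup>2"
  define m where "m = k - \<bar>\<kappa>\<bar>"
  have m: "0 < m" using k by (simp add: m_def)
  define E where "E = (\<Sum>p\<le>N. X p * nbr N X p)"
  have "(\<Sum>p\<le>N. X p * g p) = (\<Sum>p\<le>N. k * (X p)\<^sup>2 + \<kappa> / 2 * (X p * nbr N X p))"
    by (intro sum.cong refl) (simp add: eq[symmetric] power2_eq_square algebra_simps)
  also have "\<dots> = k * ?S + \<kappa> / 2 * E"
    by (simp add: sum.distrib sum_distrib_left E_def)
  finally have 0: "(\<Sum>p\<le>N. X p * g p) = k * ?S + \<kappa> / 2 * E" .
  have "\<kappa> / 2 * E \<ge> - \<bar>\<kappa>\<bar> * ?S"
  proof -
    have "\<bar>\<kappa> / 2 * E\<bar> \<le> \<bar>\<kappa>\<bar> / 2 * (2 * ?S)"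
      unfolding abs_mult E_def by (intro mult_mono nbr_energy) auto
    then show ?thesis by (simp add: abs_le_iff)
  qed
  then have 1: "m * ?S \<le> (\<Sum>p\<le>N. X p * g p)"
    unfolding 0 by (simp add: m_def algebra_simps)
  have "(\<Sum>p\<le>N. 2 * m * (X p * g p)) \<le> (\<Sum>p\<le>N. m\<^sup>2 * (X p)\<^sup>2 + (g p)\<^sup>2)"
  proof (intro sum_mono)
    fix p
    show "2 * m * (X p * g p) \<le> m\<^sup>2 * (X p)\<^sup>2 + (g p)\<^sup>2"
      using sum_squares_bound[of "m * X p" "g p"] by (simp add: power_mult_distrib mult_ac)
  qed
  then have 2: "2 * m * (\<Sum>p\<le>N. X p * g p) \<le> m\<^sup>2 * ?S + (\<Sum>p\<le>N. (g p)\<^sup>2)"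
    by (simp add: sum.distrib sum_distrib_left)
  have "2 * m * (m * ?S) \<le> 2 * m * (\<Sum>p\<le>N. X p * g p)"
    using 1 m by (intro mult_left_mono) auto
  then show ?thesis using 2 unfolding m_def[symmetric] by (simp add: power2_eq_square)
qed

lemma tridiagonal_unique:
  assumes k: "\<bar>\<kappa>\<bar> < k"
    and X: "\<And>p. p \<le> N \<Longrightarrow> k * X p + \<kappa> / 2 * nbr N X p = g p"
    and Y: "\<And>p. p \<le> N \<Longrightarrow> k * Y p + \<kappa> / 2 * nbr N Y p = g p"
    and p: "p \<le> N"
  shows "X p = Y p"
proof -
  have "(k - \<bar>\<kappa>\<bar>)\<^sup>2 * (\<Sum>p\<le>N. (X p - Y p)\<^sup>2) \<le> (\<Sum>p\<le>N. (0::real)\<^sup>2)"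
    by (rule tridiagonal_bound[OF k]) (use X Y in \<open>simp add: nbr_diff algebra_simps\<close>)
  then have "(\<Sum>p\<le>N. (X p - Y p)\<^sup>2) \<le> 0"
    using k by (simp add: mult_le_0_iff)
  then have "(\<Sum>p\<le>N. (X p - Y p)\<^sup>2) = 0"
    by (intro antisym sum_nonneg) auto
  then show ?thesis using p by (subst (asm) sum_nonneg_eq_0_iff) auto
qed

text \<open>The system is strictly diagonally dominant, so the Jacobi iteration converges.\<close>

lemma tridiagonal_solvable:
  fixes g :: "nat \<Rightarrow> real"
  assumes k: "\<bar>\<kappa>\<bar> < k"
  shows "\<exists>X. \<forall>p\<le>N. k * X p + \<kappa> / 2 * nbr N X p = g p"
proof -
  define it where "it = rec_nat (\<lambda>p. 0) (\<lambda>_ X p. (g p - \<kappa> / 2 * nbr N X p) / k)"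
  have it_0: "it 0 = (\<lambda>p. 0)" and it_Suc: "it (Suc n) = (\<lambda>p. (g p - \<kappa> / 2 * nbr N (it n) p) / k)" for n
    by (simp_all add: it_def)
  have k0: "0 < k" using k by linarith
  \<comment> \<open>The contraction factor in the maximum norm: at most two neighbours, each with
    weight \<open>\<bar>\<kappa>\<bar> / (2 * k)\<close>.\<close>
  define r where "r = \<bar>\<kappa>\<bar> / k"
  have r: "0 \<le> r" "r < 1" using k k0 by (auto simp: r_def)
  define C where "C = (\<Sum>p\<le>N. \<bar>g p / k\<bar>)"
  have step: "p \<le> N \<Longrightarrow> \<bar>it (Suc n) p - it n p\<bar> \<le> C * r ^ n" for n p
  proof (induction n arbitrary: p)
    case 0
    then have "\<bar>g p / k\<bar> \<le> C" unfolding C_def by (intro member_le_sum) auto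
    then show ?case by (simp add: it_0 it_Suc nbr_def)
  next
    case (Suc n)
    have "it (Suc (Suc n)) p - it (Suc n) p = - (\<kappa> / (2 * k)) * nbr N (\<lambda>p. it (Suc n) p - it n p) p"
      unfolding it_Suc[of "Suc n"] nbr_diff using it_Suc[of n] k0 by (simp add: field_simps)
    then have e: "\<bar>it (Suc (Suc n)) p - it (Suc n) p\<bar> = \<bar>\<kappa>\<bar> / (2 * k) * \<bar>nbr N (\<lambda>p. it (Suc n) p - it n p) p\<bar>"
      using k0 by (simp add: abs_mult)
    have n: "\<bar>nbr N (\<lambda>p. it (Suc n) p - it n p) p\<bar> \<le> C * r ^ n + C * r ^ n"
    proof -
      have C0: "0 \<le> C * r ^ n" using r by (simp add: C_def sum_nonneg)
      have "\<bar>if p = 0 then 0 else it (Suc n) (p - 1) - it n (p - 1)\<bar> \<le> C * r ^ n"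
        using Suc.prems C0 by (auto intro!: Suc.IH)
      moreover have "\<bar>if p < N then it (Suc n) (p + 1) - it n (p + 1) else 0\<bar> \<le> C * r ^ n"
        using C0 Suc.IH[of "p + 1"] by auto
      ultimately show ?thesis unfolding nbr_def by linarith
    qed
    have "\<bar>it (Suc (Suc n)) p - it (Suc n) p\<bar> \<le> \<bar>\<kappa>\<bar> / (2 * k) * (C * r ^ n + C * r ^ n)"
      unfolding e using n k0 by (intro mult_left_mono) auto
    also have "\<dots> = C * r ^ Suc n" using k0 by (simp add: r_def field_simps)
    finally show ?case .
  qed
  have "\<exists>x. (\<lambda>n. it n p) \<longlonglongrightarrow> x" if p: "p \<le> N" for p
  proof -
    have "summable (\<lambda>n. C * r ^ n)" using r by (intro summable_mult summable_geometric) auto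
    then have "summable (\<lambda>n. it (Suc n) p - it n p)"
      by (rule summable_comparison_test') (simp add: step[OF p])
    then have "convergent (\<lambda>n. \<Sum>i<n. it (Suc i) p - it i p)"
      by (simp add: summable_iff_convergent)
    then show ?thesis by (simp add: sum_lessThan_telescope[of "\<lambda>i. it i p"] it_0 convergent_def)
  qed
  then obtain X where X: "\<And>p. p \<le> N \<Longrightarrow> (\<lambda>n. it n p) \<longlonglongrightarrow> X p" by metis
  have "k * X p + \<kappa> / 2 * nbr N X p = g p" if p: "p \<le> N" for p
  proof -
    have "(\<lambda>n. nbr N (it n) p) \<longlonglongrightarrow> nbr N X p"
      unfolding nbr_def using p by (auto intro!: tendsto_add X)
    then have "(\<lambda>n. it (Suc n) p) \<longlonglongrightarrow> (g p - \<kappa> / 2 * nbr N X p) / k"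
      unfolding it_Suc using k0 by (intro tendsto_intros) auto
    from LIMSEQ_unique[OF this LIMSEQ_Suc[OF X[OF p]]] show ?thesis
      using k0 by (simp add: field_simps)
  qed
  then show ?thesis by blast
qed

section \<open>Orthogonal families in L2\<close>

definition l2 :: "'a measure \<Rightarrow> ('a \<Rightarrow> real) set" where
  "l2 M = {f \<in> borel_measurable M. integrable M (\<lambda>x. (f x)\<^sup>2)}"

lemma l2_mult_integrable:
  assumes "f \<in> l2 M" "g \<in> l2 M" shows "integrable M (\<lambda>x. f x * g x)"
proof (rule Bochner_Integration.integrable_bound)
  show "integrable M (\<lambda>x. ((f x)\<^sup>2 + (g x)\<^sup>2) / 2)" using assms by (auto simp: l2_def)
  show "(\<lambda>x. f x * g x) \<in> borel_measurable M" using assms by (auto simp: l2_def)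
  show "AE x in M. norm (f x * g x) \<le> norm (((f x)\<^sup>2 + (g x)\<^sup>2) / 2)"
  proof (rule AE_I2)
    fix x
    show "norm (f x * g x) \<le> norm (((f x)\<^sup>2 + (g x)\<^sup>2) / 2)"
      using sum_squares_bound[of "\<bar>f x\<bar>" "\<bar>g x\<bar>"] by (simp add: abs_mult)
  qed
qed

lemma l2_add: assumes "f \<in> l2 M" "g \<in> l2 M" shows "(\<lambda>x. f x + g x) \<in> l2 M"
  using assms l2_mult_integrable[OF assms] by (auto simp: l2_def power2_sum mult.assoc)

lemma l2_cmult: "f \<in> l2 M \<Longrightarrow> (\<lambda>x. c * f x) \<in> l2 M"
  by (auto simp: l2_def power_mult_distrib)

lemma l2_diff: assumes "f \<in> l2 M" "g \<in> l2 M" shows "(\<lambda>x. f x - g x) \<in> l2 M"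
  using l2_add[OF assms(1) l2_cmult[OF assms(2), of "-1"]] by simp

lemma l2_sum: "(\<And>i. i \<in> S \<Longrightarrow> f i \<in> l2 M) \<Longrightarrow> (\<lambda>x. \<Sum>i\<in>S. c i * f i x) \<in> l2 M"
proof (induction S rule: infinite_finite_induct)
  case (insert i S)
  then have "(\<lambda>x. c i * f i x + (\<Sum>i\<in>S. c i * f i x)) \<in> l2 M"
    by (intro l2_add l2_cmult) auto
  then show ?case using insert by simp
qed (simp_all add: l2_def)

locale orthogonal_family =
  fixes M :: "'a measure" and e :: "'i \<Rightarrow> 'a \<Rightarrow> real" and B :: "'i set"
  assumes e_l2: "b \<in> B \<Longrightarrow> e b \<in> l2 M"
    and orth: "b \<in> B \<Longrightarrow> b' \<in> B \<Longrightarrow> b \<noteq> b' \<Longrightarrow> (\<integral>x. e b x * e b' x \<partial>M) = 0"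
begin

lemma sum_mult_e:
  assumes S: "finite S" "S \<subseteq> B" and b: "b \<in> B"
  shows "(\<integral>x. (\<Sum>i\<in>S. c i * e i x) * e b x \<partial>M) = (if b \<in> S then c b * (\<integral>x. (e b x)\<^sup>2 \<partial>M) else 0)"
proof -
  have "(\<integral>x. (\<Sum>i\<in>S. c i * e i x) * e b x \<partial>M) = (\<integral>x. (\<Sum>i\<in>S. c i * (e i x * e b x)) \<partial>M)"
    by (simp add: sum_distrib_right mult.assoc)
  also have "\<dots> = (\<Sum>i\<in>S. c i * (\<integral>x. e i x * e b x \<partial>M))"
    using S b by (subst Bochner_Integration.integral_sum) (auto intro!: integrable_mult_right l2_mult_integrable e_l2)
  also have "\<dots> = (\<Sum>i\<in>S. if i = b then c b * (\<integral>x. (e b x)\<^sup>2 \<partial>M) else 0)"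
    using S b by (intro sum.cong refl) (auto simp: orth power2_eq_square)
  finally show ?thesis using S by simp
qed

lemma norm_sum:
  assumes S: "finite S" "S \<subseteq> B"
  shows "(\<integral>x. (\<Sum>i\<in>S. c i * e i x)\<^sup>2 \<partial>M) = (\<Sum>i\<in>S. (c i)\<^sup>2 * (\<integral>x. (e i x)\<^sup>2 \<partial>M))"
proof -
  have "(\<integral>x. (\<Sum>i\<in>S. c i * e i x)\<^sup>2 \<partial>M) = (\<integral>x. (\<Sum>b\<in>S. c b * ((\<Sum>i\<in>S. c i * e i x) * e b x)) \<partial>M)"
    by (simp add: power2_eq_square sum_distrib_left mult_ac)
  also have "\<dots> = (\<Sum>b\<in>S. c b * (\<integral>x. (\<Sum>i\<in>S. c i * e i x) * e b x \<partial>M))"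
    using S by (subst Bochner_Integration.integral_sum) (auto intro!: integrable_mult_right l2_mult_integrable l2_sum e_l2)
  also have "\<dots> = (\<Sum>i\<in>S. (c i)\<^sup>2 * (\<integral>x. (e i x)\<^sup>2 \<partial>M))"
    using S by (intro sum.cong refl) (auto simp: sum_mult_e subset_iff power2_eq_square)
  finally show ?thesis .
qed

lemma bessel:
  assumes S: "finite S" "S \<subseteq> B" and f: "f \<in> l2 M"
  shows "(\<Sum>b\<in>S. ((\<integral>x. f x * e b x \<partial>M) / (\<integral>x. (e b x)\<^sup>2 \<partial>M))\<^sup>2 * (\<integral>x. (e b x)\<^sup>2 \<partial>M)) \<le> (\<integral>x. (f x)\<^sup>2 \<partial>M)"
proof -
  define n where "n = (\<lambda>b. \<integral>x. (e b x)\<^sup>2 \<partial>M)"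
  define c where "c = (\<lambda>b. (\<integral>x. f x * e b x \<partial>M) / n b)"
  define s where "s = (\<lambda>x. \<Sum>b\<in>S. c b * e b x)"
  have s: "s \<in> l2 M" unfolding s_def using S by (intro l2_sum e_l2) auto
  have fs: "(\<integral>x. f x * s x \<partial>M) = (\<Sum>b\<in>S. c b * (\<integral>x. f x * e b x \<partial>M))"
  proof -
    have "(\<integral>x. f x * s x \<partial>M) = (\<integral>x. (\<Sum>b\<in>S. c b * (f x * e b x)) \<partial>M)"
      by (simp add: s_def sum_distrib_left mult_ac)
    also have "\<dots> = (\<Sum>b\<in>S. c b * (\<integral>x. f x * e b x \<partial>M))"
      using S by (subst Bochner_Integration.integral_sum) (auto intro!: integrable_mult_right l2_mult_integrable f e_l2)
    finally show ?thesis .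
  qed
  \<comment> \<open>If \<open>n b = 0\<close>, division by zero makes \<open>c b\<close> zero and
    the term drops out on both sides.\<close>
  have cn: "(\<Sum>b\<in>S. c b * (\<integral>x. f x * e b x \<partial>M)) \<ge> (\<Sum>b\<in>S. (c b)\<^sup>2 * n b)"
  proof (intro sum_mono)
    fix b
    show "(c b)\<^sup>2 * n b \<le> c b * (\<integral>x. f x * e b x \<partial>M)"
      by (cases "n b = 0") (auto simp: c_def power2_eq_square)
  qed
  have "0 \<le> (\<integral>x. (f x - s x)\<^sup>2 \<partial>M)" by simp
  also have "\<dots> = (\<integral>x. (f x)\<^sup>2 + (s x)\<^sup>2 - 2 * (f x * s x) \<partial>M)"
    by (simp add: power2_diff mult.assoc)
  also have "\<dots> = (\<integral>x. (f x)\<^sup>2 \<partial>M) + (\<integral>x. (s x)\<^sup>2 \<partial>M) - 2 * (\<integral>x. f x * s x \<partial>M)"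
    using f s l2_mult_integrable[OF f s] by (simp add: l2_def)
  also have "(\<integral>x. (s x)\<^sup>2 \<partial>M) = (\<Sum>b\<in>S. (c b)\<^sup>2 * n b)"
    unfolding s_def n_def by (rule norm_sum[OF S])
  finally show ?thesis using cn unfolding fs c_def n_def by linarith
qed

text \<open>Along an enumeration of \<open>B\<close> the partial sums are Cauchy in L2, hence in L1
  because \<open>M\<close> is finite, so a subsequence converges almost everywhere. Fatou's lemma
  bounds the L2 error of each finite partial sum by the tail of the series, which gives convergence
  along the net of finite sets.\<close>

lemma riesz_fischer:
  assumes M: "finite_measure M" and B: "countable B"
    and t: "(\<lambda>b. (c b)\<^sup>2 * (\<integral>x. (e b x)\<^sup>2 \<partial>M)) summable_on B"
  shows "\<exists>u\<in>l2 M. ((\<lambda>S. \<integral>x. (u x - (\<Sum>b\<in>S. c b * e b x))\<^sup>2 \<partial>M) \<longlongrightarrow> 0) (finite_subsets_at_top B)"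
proof -
  interpret finite_measure M by (rule M)
  define t where "t = (\<lambda>b. (c b)\<^sup>2 * (\<integral>x. (e b x)\<^sup>2 \<partial>M))"
  have t0: "0 \<le> t b" for b by (simp add: t_def)
  have ts: "t summable_on B" using assms(3) by (simp add: t_def)
  define A where "A = infsum t B"
  define s where "s = (\<lambda>S x. \<Sum>b\<in>S. c b * e b x)"
  have sl2: "s S \<in> l2 M" if "S \<subseteq> B" for S
    unfolding s_def using that by (intro l2_sum e_l2) auto
  have tle: "sum t S \<le> A" if "finite S" "S \<subseteq> B" for S
    unfolding A_def using that t0 by (intro finite_sum_le_infsum ts) auto
  have dist: "(\<integral>x. (s T x - s S x)\<^sup>2 \<partial>M) = sum t T - sum t S" if T: "finite T" "T \<subseteq> B" "S \<subseteq> T" for S T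
  proof -
    have "s T x - s S x = (\<Sum>b\<in>T - S. c b * e b x)" for x
      unfolding s_def using T by (simp add: sum_diff)
    then have "(\<integral>x. (s T x - s S x)\<^sup>2 \<partial>M) = sum t (T - S)"
      using T norm_sum[of "T - S" c] by (auto simp: t_def)
    then show ?thesis using T by (simp add: sum_diff)
  qed
  define F where "F = (\<lambda>n. {b \<in> B. to_nat_on B b \<le> n})"
  have Ffin: "finite (F n)" for n
  proof (rule finite_imageD)
    show "finite (to_nat_on B ` F n)" by (rule finite_subset[of _ "{..n}"]) (auto simp: F_def)
    show "inj_on (to_nat_on B) (F n)"
      using inj_on_to_nat_on[OF B] by (rule inj_on_subset) (auto simp: F_def)
  qed
  have FB: "F n \<subseteq> B" for n by (auto simp: F_def)
  have Fmono: "m \<le> n \<Longrightarrow> F m \<subseteq> F n" for m n by (auto simp: F_def)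
  have Fex: "\<exists>n. \<forall>m\<ge>n. S \<subseteq> F m" if S: "finite S" "S \<subseteq> B" for S
  proof (intro exI allI impI)
    fix m assume m: "Max (to_nat_on B ` S) \<le> m"
    show "S \<subseteq> F m"
    proof
      fix b assume b: "b \<in> S"
      then have "to_nat_on B b \<le> Max (to_nat_on B ` S)" using S by (intro Max_ge) auto
      then have "to_nat_on B b \<le> m" using m by (rule order_trans)
      then show "b \<in> F m" using S b by (auto simp: F_def)
    qed
  qed
  define v where "v = (\<lambda>n. s (F n))"
  have vl2: "v n \<in> l2 M" for n unfolding v_def by (rule sl2[OF FB])
  have [measurable]: "v n \<in> borel_measurable M" for n using vl2[of n] by (simp add: l2_def)
  have l2_int: "f \<in> l2 M \<Longrightarrow> integrable M f" for f
    by (rule square_integrable_imp_integrable) (auto simp: l2_def)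
  \<comment> \<open>Integrates \<open>\<bar>f\<bar> \<le> \<delta> + f^2 / \<delta>\<close>. The
    free \<open>\<delta>\<close> makes the contribution of the total mass small before the L2
    distance is used.\<close>
  have l1: "(\<integral>x. \<bar>f x\<bar> \<partial>M) \<le> (\<delta> * measure M (space M) + (\<integral>x. (f x)\<^sup>2 \<partial>M) / \<delta>)" if f: "f \<in> l2 M" and \<delta>: "0 < \<delta>" for f \<delta>
  proof -
    have "(\<integral>x. \<bar>f x\<bar> \<partial>M) \<le> (\<integral>x. \<delta> + (f x)\<^sup>2 / \<delta> \<partial>M)"
    proof (rule integral_mono)
      show "integrable M (\<lambda>x. \<bar>f x\<bar>)" using l2_int[OF f] by simp
      show "integrable M (\<lambda>x. \<delta> + (f x)\<^sup>2 / \<delta>)" using f by (simp add: l2_def)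
      fix x
      have "\<delta> * \<bar>f x\<bar> * 2 \<le> \<delta>\<^sup>2 + (f x)\<^sup>2"
        using sum_squares_bound[of \<delta> "\<bar>f x\<bar>"] by (simp add: mult_ac)
      moreover have "0 \<le> \<delta> * \<bar>f x\<bar>" using \<delta> by simp
      ultimately have "\<delta> * \<bar>f x\<bar> \<le> \<delta>\<^sup>2 + (f x)\<^sup>2" by linarith
      then have "\<delta> * \<bar>f x\<bar> / \<delta> \<le> (\<delta>\<^sup>2 + (f x)\<^sup>2) / \<delta>" using \<delta> by (intro divide_right_mono) auto
      then show "\<bar>f x\<bar> \<le> \<delta> + (f x)\<^sup>2 / \<delta>" using \<delta> by (simp add: add_divide_distrib power2_eq_square)
    qed
    also have "\<dots> = \<delta> * measure M (space M) + (\<integral>x. (f x)\<^sup>2 \<partial>M) / \<delta>"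
      using f by (simp add: l2_def)
    finally show ?thesis .
  qed
  define g where "g = (\<lambda>n. sum t (F n))"
  have gmono: "incseq g"
    unfolding g_def incseq_def by (intro allI impI sum_mono2 Ffin Fmono t0)
  have "g \<longlonglongrightarrow> (SUP n. g n)"
    using tle[OF Ffin FB] gmono by (intro LIMSEQ_incseq_SUP) (auto intro!: bdd_aboveI2[of _ _ A] simp: g_def)
  then have gC: "Cauchy g" by (rule LIMSEQ_imp_Cauchy)
  have vg: "(\<integral>x. (v m x - v n x)\<^sup>2 \<partial>M) \<le> \<bar>g m - g n\<bar>" for m n
  proof (cases "n \<le> m")
    case True
    then show ?thesis using dist[OF Ffin FB Fmono[OF True]] by (simp add: v_def g_def)
  next
    case False
    then have "m \<le> n" by simp
    have "(\<integral>x. (v m x - v n x)\<^sup>2 \<partial>M) = (\<integral>x. (v n x - v m x)\<^sup>2 \<partial>M)" by (simp add: power2_commute)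
    then show ?thesis using dist[OF Ffin FB Fmono[OF \<open>m \<le> n\<close>]] by (simp add: v_def g_def)
  qed
  have "\<exists>r. strict_mono r \<and> (AE x in M. Cauchy (\<lambda>i. v (r i) x))"
  proof -
    have "\<exists>r :: nat \<Rightarrow> nat. strict_mono r \<and> (AE x in M. Cauchy (\<lambda>i. v (r i) x))"
    proof (rule cauchy_L1_AE_cauchy_subseq[of M v])
      show "integrable M (v n)" for n by (rule l2_int[OF vl2])
      fix \<epsilon> :: real assume \<epsilon>: "0 < \<epsilon>"
      define m where "m = measure M (space M) + 1"
      have m: "0 < m" by (simp add: m_def add_nonneg_pos)
      define \<delta> where "\<delta> = \<epsilon> / (2 * m)"
      have \<delta>: "0 < \<delta>" using \<epsilon> m by (simp add: \<delta>_def)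
      obtain N where N: "\<And>i j. i \<ge> N \<Longrightarrow> j \<ge> N \<Longrightarrow> \<bar>g i - g j\<bar> < \<delta> * (\<epsilon> / 2)"
        using gC \<delta> \<epsilon> unfolding Cauchy_def dist_real_def by (meson half_gt_zero mult_pos_pos)
      have "(\<integral>x. norm (v i x - v j x) \<partial>M) < \<epsilon>" if "i \<ge> N" "j \<ge> N" for i j
      proof -
        have "(\<integral>x. norm (v i x - v j x) \<partial>M) \<le> \<delta> * measure M (space M) + (\<integral>x. (v i x - v j x)\<^sup>2 \<partial>M) / \<delta>"
          using l1[OF l2_diff[OF vl2[of i] vl2[of j]] \<delta>] by simp
        also have "\<delta> * measure M (space M) \<le> \<epsilon> / 2"
        proof -
          have "\<delta> * measure M (space M) \<le> \<delta> * m" using \<delta> by (simp add: m_def)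
          also have "\<dots> = \<epsilon> / 2" using m by (simp add: \<delta>_def)
          finally show ?thesis .
        qed
        also have "(\<integral>x. (v i x - v j x)\<^sup>2 \<partial>M) / \<delta> < \<epsilon> / 2"
          using vg[of i j] N[OF that] \<delta> by (simp add: pos_divide_less_eq mult.commute)
        finally show ?thesis by simp
      qed
      then show "\<exists>N. \<forall>i\<ge>N. \<forall>j\<ge>N. (\<integral>x. norm (v i x - v j x) \<partial>M) < \<epsilon>" by blast
    qed blast
    then show ?thesis .
  qed
  then obtain r where r: "strict_mono r" and Cv: "AE x in M. Cauchy (\<lambda>i. v (r i) x)" by blast
  define u where "u = (\<lambda>x. lim (\<lambda>i. v (r i) x))"
  have um [measurable]: "u \<in> borel_measurable M" unfolding u_def by measurable
  have conv: "AE x in M. (\<lambda>i. v (r i) x) \<longlonglongrightarrow> u x"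
    using Cv by eventually_elim (simp add: u_def Cauchy_convergent_iff convergent_LIMSEQ_iff)
  \<comment> \<open>From some index on the exhausting sets contain \<open>S\<close>, and the
    distance to the partial sum over \<open>S\<close> is then a difference of partial sums of
    \<open>t\<close>, at most the tail \<open>A - sum t S\<close>.\<close>
  have est: "(\<integral>\<^sup>+x. ennreal ((u x - s S x)\<^sup>2) \<partial>M) \<le> ennreal (A - sum t S)" if S: "finite S" "S \<subseteq> B" for S
  proof -
    have [measurable]: "s S \<in> borel_measurable M" using sl2[OF S(2)] by (simp add: l2_def)
    obtain n where n: "\<And>m. m \<ge> n \<Longrightarrow> S \<subseteq> F m" using Fex[OF S] by blast
    have "(\<integral>\<^sup>+x. ennreal ((u x - s S x)\<^sup>2) \<partial>M) = (\<integral>\<^sup>+x. liminf (\<lambda>i. ennreal ((v (r i) x - s S x)\<^sup>2)) \<partial>M)"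
    proof (intro nn_integral_cong_AE)
      show "AE x in M. ennreal ((u x - s S x)\<^sup>2) = liminf (\<lambda>i. ennreal ((v (r i) x - s S x)\<^sup>2))"
        using conv
      proof eventually_elim
        case (elim x)
        then have "(\<lambda>i. ennreal ((v (r i) x - s S x)\<^sup>2)) \<longlonglongrightarrow> ennreal ((u x - s S x)\<^sup>2)"
          by (intro tendsto_intros)
        then show ?case by (rule lim_imp_Liminf[OF trivial_limit_sequentially, symmetric])
      qed
    qed
    also have "\<dots> \<le> liminf (\<lambda>i. \<integral>\<^sup>+x. ennreal ((v (r i) x - s S x)\<^sup>2) \<partial>M)"
      by (rule nn_integral_liminf) measurable
    also have "\<dots> \<le> ennreal (A - sum t S)"
    proof (rule Liminf_le)
      have "\<forall>\<^sub>F i in sequentially. n \<le> i" by (rule eventually_ge_at_top)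
      then show "\<forall>\<^sub>F i in sequentially. (\<integral>\<^sup>+x. ennreal ((v (r i) x - s S x)\<^sup>2) \<partial>M) \<le> ennreal (A - sum t S)"
      proof eventually_elim
        case (elim i)
        then have "n \<le> r i" using seq_suble[OF r, of i] by linarith
        then have SF: "S \<subseteq> F (r i)" by (rule n)
        have "(\<lambda>x. v (r i) x - s S x) \<in> l2 M" unfolding v_def by (intro l2_diff sl2 FB S)
        then have "(\<integral>\<^sup>+x. ennreal ((v (r i) x - s S x)\<^sup>2) \<partial>M) = ennreal (\<integral>x. (v (r i) x - s S x)\<^sup>2 \<partial>M)"
          by (intro nn_integral_eq_integral) (auto simp: l2_def)
        also have "(\<integral>x. (v (r i) x - s S x)\<^sup>2 \<partial>M) = sum t (F (r i)) - sum t S"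
          unfolding v_def by (rule dist[OF Ffin FB SF])
        also have "\<dots> \<le> A - sum t S" using tle[OF Ffin FB] by simp
        finally show ?case by (simp add: ennreal_leI)
      qed
    qed simp
    finally show ?thesis .
  qed
  have ul2: "u \<in> l2 M"
  proof -
    have "(\<integral>\<^sup>+x. ennreal ((u x)\<^sup>2) \<partial>M) \<le> ennreal A" using est[of "{}"] by (simp add: s_def)
    then have "integrable M (\<lambda>x. (u x)\<^sup>2)"
      by (intro integrableI_bounded) (auto simp: less_top[symmetric] top_unique intro: le_less_trans)
    then show ?thesis by (simp add: l2_def um)
  qed
  have "((\<lambda>S. \<integral>x. (u x - s S x)\<^sup>2 \<partial>M) \<longlongrightarrow> 0) (finite_subsets_at_top B)"
  proof (rule tendsto_sandwich)
    show "\<forall>\<^sub>F S in finite_subsets_at_top B. 0 \<le> (\<integral>x. (u x - s S x)\<^sup>2 \<partial>M)" by simp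
    show "\<forall>\<^sub>F S in finite_subsets_at_top B. (\<integral>x. (u x - s S x)\<^sup>2 \<partial>M) \<le> A - sum t S"
    proof (rule eventually_finite_subsets_at_top_weakI)
      fix S assume S: "finite S" "S \<subseteq> B"
      have "(\<lambda>x. u x - s S x) \<in> l2 M" by (intro l2_diff sl2 ul2 S)
      then have "ennreal (\<integral>x. (u x - s S x)\<^sup>2 \<partial>M) = (\<integral>\<^sup>+x. ennreal ((u x - s S x)\<^sup>2) \<partial>M)"
        by (intro nn_integral_eq_integral[symmetric]) (auto simp: l2_def)
      then have "ennreal (\<integral>x. (u x - s S x)\<^sup>2 \<partial>M) \<le> ennreal (A - sum t S)"
        using est[OF S] by simp
      then show "(\<integral>x. (u x - s S x)\<^sup>2 \<partial>M) \<le> A - sum t S"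
        using tle[OF S] by (subst (asm) ennreal_le_iff) auto
    qed
    have "(sum t \<longlongrightarrow> A) (finite_subsets_at_top B)"
      using has_sum_infsum[OF ts] by (simp add: has_sum_def A_def)
    then have "((\<lambda>S. A - sum t S) \<longlongrightarrow> A - A) (finite_subsets_at_top B)" by (intro tendsto_intros)
    then show "((\<lambda>S. A - sum t S) \<longlongrightarrow> 0) (finite_subsets_at_top B)" by simp
  qed simp
  then show ?thesis using ul2 unfolding s_def by blast
qed

end

section \<open>The operator in coefficients\<close>

text \<open>The multiplicity correction at \<open>l = 0\<close>, where the two exponentials behind a
  real harmonic coincide. It equals the halving in \<open>series_coeff\<close>.\<close>

definition eps :: "nat \<Rightarrow> real" where
  "eps l = (if l = 0 then 1 / 2 else 1)"

lemma eps_pos: "0 < eps l"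
  by (simp add: eps_def)

lemma part_mult_of_real: "part \<mu> (z * of_real r) = part \<mu> z * r"
  by (simp add: part_def)

lemma solid_harmonic_part: "solid_harmonic l \<mu> x = part \<mu> (cz x ^ l)"
proof -
  have "cz x ^ l = rcis (norm x) (polar_angle x) ^ l"
    using rcis_cmod_Arg[of "cz x"] by (simp add: polar_angle_def cz_def[symmetric])
  also have "\<dots> = rcis (norm x ^ l) (real l * polar_angle x)"
    by (rule DeMoivre2)
  finally show ?thesis by (simp add: solid_harmonic_def part_def)
qed

lemma basis_fun_zern:
  assumes "0 < a"
  shows "basis_fun (2 * a) (l, n, \<mu>) y = dn a n * part \<mu> (zern a (n + l) n (cz y))"
proof -
  have z: "zern a (n + l) n (cz y) = cz y ^ l * of_real (jac n a (real l) ((norm y)\<^sup>2) / dn a n)"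
    by (simp add: zern_def)
  show ?thesis
    using dn_pos[of a n] assms unfolding basis_fun_def z part_mult_of_real
    by (simp add: jacobi_poly_eq_jac solid_harmonic_part)
qed

lemma part_zern_measurable [measurable]: "(\<lambda>y. part \<mu> (zern a p q (cz y))) \<in> borel_measurable borel"
proof -
  have [measurable]: "part \<mu> \<in> borel_measurable borel"
    by (intro borel_measurable_continuous_onI linear_continuous_on bounded_linear_part)
  show ?thesis by measurable
qed

lemma continuous_part_zern: "continuous_on UNIV (\<lambda>y. part \<mu> (zern a p q (cz y)))"
  using continuous_on_compose[OF continuous_on_zern_cz linear_continuous_on[OF bounded_linear_part]]
  by (simp add: o_def)

lemma weighted_inner_cmult: "weighted_inner \<alpha> (\<lambda>y. c * u y) v = c * weighted_inner \<alpha> u v"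
  "weighted_inner \<alpha> u (\<lambda>y. c * v y) = c * weighted_inner \<alpha> u v"
  unfolding weighted_inner_def by (subst integral_mult_right_zero[symmetric], simp add: mult_ac)+

lemma part_zern_basis_inner:
  assumes a: "0 < a" and b: "(l, n, \<mu>) \<in> basis_index" and \<mu>': "\<mu>' \<in> {1, -1}"
  shows "weighted_inner (2 * a) (\<lambda>y. part \<mu>' (zern a p q (cz y))) (basis_fun (2 * a) (l, n, \<mu>)) =
    (if \<mu>' = \<mu> then dn a n * zern_norm a (n + l) n / 2 * (of_bool (p = n + l \<and> q = n) + of_int \<mu> * of_bool (p = n \<and> q = n + l)) else 0)"
proof -
  have \<mu>: "\<mu> \<in> {1, -1}" using b by (simp add: basis_index_def)
  have "basis_fun (2 * a) (l, n, \<mu>) = (\<lambda>y. dn a n * part \<mu> (zern a (n + l) n (cz y)))"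
    by (simp add: fun_eq_iff basis_fun_zern[OF a])
  then show ?thesis
    using zern_norm_commute[of a "n + l" n]
    by (auto simp: weighted_inner_cmult part_zern_inner[OF a \<mu>' \<mu>])
qed

text \<open>\<open>eps\<close> is in the denominator because the square of a radial function has no
  factor \<open>cos^2\<close> or \<open>sin^2\<close> to halve its angular mean.\<close>

definition basis_norm :: "real \<Rightarrow> index \<Rightarrow> real" where
  "basis_norm a = (\<lambda>(l, n, \<mu>). (dn a n)\<^sup>2 * zern_norm a (n + l) n / (2 * eps l))"

lemma basis_norm_pos: "0 < a \<Longrightarrow> 0 < basis_norm a b"
  by (cases b) (auto simp: basis_norm_def intro!: divide_pos_pos mult_pos_pos zero_less_power zern_norm_pos dn_pos eps_pos)

lemma basis_inner:
  assumes a: "0 < a" and b: "b \<in> basis_index" "b' \<in> basis_index"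
  shows "weighted_inner (2 * a) (basis_fun (2 * a) b') (basis_fun (2 * a) b) = (if b' = b then basis_norm a b else 0)"
proof -
  obtain l n \<mu> where [simp]: "b = (l, n, \<mu>)" by (cases b) auto
  obtain l' n' \<mu>' where [simp]: "b' = (l', n', \<mu>')" by (cases b') auto
  have \<mu>: "\<mu> \<in> {1, -1}" "\<mu>' \<in> {1, -1}" using b by (auto simp: basis_index_def)
  have "basis_fun (2 * a) (l', n', \<mu>') = (\<lambda>y. dn a n' * part \<mu>' (zern a (n' + l') n' (cz y)))"
    by (simp add: fun_eq_iff basis_fun_zern[OF a])
  then have e: "weighted_inner (2 * a) (basis_fun (2 * a) b') (basis_fun (2 * a) b) =
     dn a n' * (if \<mu>' = \<mu> then dn a n * zern_norm a (n + l) n / 2 * (of_bool (n' + l' = n + l \<and> n' = n) + of_int \<mu> * of_bool (n' + l' = n \<and> n' = n + l)) else 0)"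
    using part_zern_basis_inner[OF a _ \<mu>(2), of l n \<mu>] b by (simp add: weighted_inner_cmult)
  \<comment> \<open>The mirrored index coincides with the original one only at \<open>l = 0\<close>;
    there \<open>\<mu> = 1\<close>, and the two contributions add up to the doubled norm.\<close>
  have "n' + l' = n + l \<and> n' = n \<longleftrightarrow> l' = l \<and> n' = n" "n' + l' = n \<and> n' = n + l \<longleftrightarrow> l' = 0 \<and> l = 0 \<and> n' = n" by auto
  then show ?thesis
    unfolding e using \<mu> b by (auto simp: basis_norm_def eps_def basis_index_def power2_eq_square)
qed

text \<open>The coefficient of \<open>part \<mu> (zern a p q)\<close> at a basis function of the
  same parity. The indices \<open>(p, q)\<close> and \<open>(q, p)\<close> give the same real
  function up to the sign \<open>\<mu>\<close>, hence two terms.\<close>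

definition coef :: "real \<Rightarrow> index \<Rightarrow> nat \<Rightarrow> nat \<Rightarrow> real" where
  "coef a = (\<lambda>(l, n, \<mu>) p q. eps l / dn a n * (of_bool (p = n + l \<and> q = n) + of_int \<mu> * of_bool (p = n \<and> q = n + l)))"

lemma basis_coeff_part_zern:
  assumes a: "0 < a" and b: "(l, n, \<mu>) \<in> basis_index" and \<mu>': "\<mu>' \<in> {1, -1}"
  shows "basis_coeff (2 * a) (\<lambda>y. part \<mu>' (zern a p q (cz y))) (l, n, \<mu>) = (if \<mu>' = \<mu> then coef a (l, n, \<mu>) p q else 0)"
proof -
  have p: "0 < dn a n" "0 < zern_norm a (n + l) n" "0 < eps l" using a by (auto intro: dn_pos zern_norm_pos eps_pos)
  show ?thesis
    unfolding basis_coeff_def part_zern_basis_inner[OF a b \<mu>'] basis_inner[OF a b b] basis_norm_def coef_def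
    using p by (simp add: power2_eq_square field_simps)
qed

lemma part_zern_weighted_integrable:
  assumes a: "0 < a"
  shows "integrable (lebesgue_on unit_disk) (\<lambda>y. weight (2 * a / 2) y * (part \<mu> (zern a p q (cz y)) * part \<mu>' (zern a p' q' (cz y))))"
proof -
  have "integrable lborel (\<lambda>y. (indicator unit_disk y * (1 - (norm y)\<^sup>2) powr a) *\<^sub>R (part \<mu> (zern a p q (cz y)) * part \<mu>' (zern a p' q' (cz y))))"
    by (intro integrable_disk_weight a continuous_on_mult continuous_part_zern)
  then have "integrable lebesgue (\<lambda>y. (indicator unit_disk y * (1 - (norm y)\<^sup>2) powr a) *\<^sub>R (part \<mu> (zern a p q (cz y)) * part \<mu>' (zern a p' q' (cz y))))"
    by (rule integrable_completion[THEN iffD2, rotated]) measurable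
  then show ?thesis
    by (subst integrable_restrict_space) (auto simp: weight_def mult_ac)
qed

lemma basis_coeff_combination:
  assumes a: "0 < a" and b: "(l, n, \<mu>) \<in> basis_index" and \<mu>': "\<mu>' \<in> {1, -1}" and I: "finite I"
    and g: "\<And>x. x \<noteq> 0 \<Longrightarrow> norm x < 1 \<Longrightarrow> g x = (\<Sum>i\<in>I. r i * part \<mu>' (zern a (p i) (q i) (cz x)))"
  shows "basis_coeff (2 * a) g (l, n, \<mu>) = (\<Sum>i\<in>I. r i * (if \<mu>' = \<mu> then coef a (l, n, \<mu>) (p i) (q i) else 0))"
proof -
  define e where "e = basis_fun (2 * a) (l, n, \<mu>)"
  have e: "e = (\<lambda>y. dn a n * part \<mu> (zern a (n + l) n (cz y)))"
    by (simp add: fun_eq_iff basis_fun_zern[OF a] e_def)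
  define u where "u = (\<lambda>i y. part \<mu>' (zern a (p i) (q i) (cz y)))"
  define s where "s = (\<lambda>x. \<Sum>i\<in>I. r i * u i x)"
  have int: "integrable (lebesgue_on unit_disk) (\<lambda>x. weight (2 * a / 2) x * (u i x * e x))" for i
    using integrable_mult_right[OF part_zern_weighted_integrable[OF a, of \<mu>' "p i" "q i" \<mu> "n + l" n], of "dn a n"]
    unfolding e u_def by (simp add: mult_ac)
  have ints: "integrable (lebesgue_on unit_disk) (\<lambda>x. \<Sum>i\<in>I. r i * (weight (2 * a / 2) x * (u i x * e x)))"
    by (intro Bochner_Integration.integrable_sum integrable_mult_right int)
  have se: "weight (2 * a / 2) x * (s x * e x) = (\<Sum>i\<in>I. r i * (weight (2 * a / 2) x * (u i x * e x)))" for x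
    by (simp add: s_def sum_distrib_left sum_distrib_right mult_ac)
  have m: "(\<lambda>x. weight (2 * a / 2) x * (s x * e x)) \<in> borel_measurable (lebesgue_on unit_disk)"
    unfolding se using ints by (rule borel_measurable_integrable)
  \<comment> \<open>\<open>g\<close> is known only off the origin. Isolating its value there by a
    case distinction yields a measurable integrand, to which almost everywhere equality
    applies.\<close>
  have "weighted_inner (2 * a) g e = (\<integral>x. (if x = 0 then weight (2 * a / 2) 0 * (g 0 * e 0) else weight (2 * a / 2) x * (s x * e x)) \<partial>(lebesgue_on unit_disk))"
    unfolding weighted_inner_def by (intro Bochner_Integration.integral_cong refl) (auto simp: g s_def u_def)
  also have "\<dots> = (\<integral>x. weight (2 * a / 2) x * (s x * e x) \<partial>(lebesgue_on unit_disk))"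
  proof (rule integral_cong_AE)
    have z: "{x \<in> space (lebesgue_on unit_disk). x = (0 :: real^2)} \<in> sets (lebesgue_on unit_disk)"
      by (simp add: space_restrict_space sets_restrict_space) (auto simp: image_iff intro!: exI[of _ "{0}"])
    show "(\<lambda>x. if x = 0 then weight (2 * a / 2) 0 * (g 0 * e 0) else weight (2 * a / 2) x * (s x * e x)) \<in> borel_measurable (lebesgue_on unit_disk)"
      by (intro measurable_If m z) simp
    have "AE x in lebesgue. x \<noteq> (0 :: real^2)"
      by (rule AE_completion) (rule AE_lborel_singleton)
    then have "AE x in lebesgue. x \<in> unit_disk \<longrightarrow> (if x = 0 then weight (2 * a / 2) 0 * (g 0 * e 0) else weight (2 * a / 2) x * (s x * e x)) = weight (2 * a / 2) x * (s x * e x)"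
      by eventually_elim simp
    then show "AE x in lebesgue_on unit_disk. (if x = 0 then weight (2 * a / 2) 0 * (g 0 * e 0) else weight (2 * a / 2) x * (s x * e x)) = weight (2 * a / 2) x * (s x * e x)"
      by (rule AE_restrict_space_iff[THEN iffD2, rotated]) simp
  qed (rule m)
  also have "\<dots> = (\<Sum>i\<in>I. r i * weighted_inner (2 * a) (u i) e)"
    unfolding se weighted_inner_def
    by (subst Bochner_Integration.integral_sum, rule integrable_mult_right[OF int], simp only: integral_mult_right_zero)
  finally have "basis_coeff (2 * a) g (l, n, \<mu>) = (\<Sum>i\<in>I. r i * basis_coeff (2 * a) (u i) (l, n, \<mu>))"
    unfolding basis_coeff_def e_def by (simp add: sum_divide_distrib)
  then show ?thesis unfolding u_def basis_coeff_part_zern[OF a b \<mu>'] .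
qed

definition diagK :: "real \<Rightarrow> real \<Rightarrow> real^2 \<Rightarrow> real^2^2" where
  "diagK k1 k2 = (\<lambda>x. vector [vector [k1, 0], vector [0, k2]])"

definition deg :: "index \<Rightarrow> nat" where
  "deg = (\<lambda>(l, n, \<mu>). l + 2 * n)"

text \<open>\<open>E N\<close> is the functional, on vectors of degree \<open>N\<close>, that reads
  off the target coefficient together with the target eigenvalue; the entry is the Toeplitz matrix
  applied to it. The quotient \<open>(k1 - k2) / 2 / 2\<close> is kept in the form required by the
  tridiagonal lemmas.\<close>

lemma operator_entry_eq:
  assumes a: "0 < a" "a < 1" and b: "(l, n, \<mu>) \<in> basis_index" and b': "(l', n', \<mu>') \<in> basis_index"
  defines "E \<equiv> \<lambda>N p. eig a p (N - p) * coef a (l, n, \<mu>) p (N - p)"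
  shows "operator_entry (2 * a) (diagK k1 k2) (l, n, \<mu>) (l', n', \<mu>') =
    (if \<mu>' = \<mu> then dn a n' * ((k1 + k2) / 2 * E (l' + 2 * n') (n' + l') + (k1 - k2) / 2 / 2 * nbr (l' + 2 * n') (E (l' + 2 * n')) (n' + l')) else 0)"
proof -
  have \<mu>': "\<mu>' \<in> {1, -1}" using b' by (simp add: basis_index_def)
  define p where "p = n' + l'"
  define q where "q = n'"
  have N: "l' + 2 * n' = p + q" by (simp add: p_def q_def)
  define L where "L = (\<lambda>z. dn a n' * part \<mu>' z)"
  have L: "bounded_linear L"
    unfolding L_def by (intro bounded_linear_const_mult bounded_linear_part)
  have bf: "basis_fun (2 * a) (l', n', \<mu>') = (\<lambda>y. L (zern a p q (cz y)))"
    by (simp add: fun_eq_iff basis_fun_zern[OF a(1)] L_def p_def q_def)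
  define r where "r = (\<lambda>i::nat. dn a n' * (if i = 0 then (k1 + k2) / 2 * eig a p q else if i = 1 then (if p = 0 then 0 else (k1 - k2) / 4 * eig a (p - 1) (q + 1)) else (if q = 0 then 0 else (k1 - k2) / 4 * eig a (p + 1) (q - 1))))"
  define pp where "pp = (\<lambda>i::nat. if i = 0 then p else if i = 1 then p - 1 else p + 1)"
  define qq where "qq = (\<lambda>i::nat. if i = 0 then q else if i = 1 then q + 1 else q - 1)"
  have S: "(\<Sum>i\<in>{0, 1, 2::nat}. h i) = h 0 + h 1 + h 2" for h :: "nat \<Rightarrow> real" by simp
  have "operator_entry (2 * a) (diagK k1 k2) (l, n, \<mu>) (l', n', \<mu>') = (\<Sum>i\<in>{0, 1, 2}. r i * (if \<mu>' = \<mu> then coef a (l, n, \<mu>) (pp i) (qq i) else 0))"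
    unfolding operator_entry_def diagK_def
  proof (rule basis_coeff_combination[OF a(1) b \<mu>'])
    fix x :: "real^2" assume x: "x \<noteq> 0" "norm x < 1"
    show "frac_diffusion (2 * a) (\<lambda>x. vector [vector [k1, 0], vector [0, k2]]) (weighted_ext (2 * a) (basis_fun (2 * a) (l', n', \<mu>'))) x =
      (\<Sum>i\<in>{0, 1, 2}. r i * part \<mu>' (zern a (pp i) (qq i) (cz x)))"
      unfolding bf frac_diffusion_zern[OF a x L] S r_def pp_def qq_def
      by (cases "p = 0"; cases "q = 0") (simp_all add: L_def algebra_simps)
  qed simp
  also have "\<dots> = (if \<mu>' = \<mu> then dn a n' * ((k1 + k2) / 2 * E (p + q) p + (k1 - k2) / 2 / 2 * nbr (p + q) (E (p + q)) p) else 0)"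
    unfolding S r_def pp_def qq_def E_def nbr_def
    by (cases "p = 0"; cases "q = 0") (simp_all add: algebra_simps Suc_diff_le)
  finally show ?thesis unfolding N p_def[symmetric] .
qed

text \<open>The blocks invariant under the operator: the degree is preserved, and so is the parity,
  as a diagonal \<open>K\<close> respects reflection in the first axis.\<close>

definition sector :: "nat \<Rightarrow> int \<Rightarrow> index set" where
  "sector N \<mu> = {b \<in> basis_index. deg b = N \<and> snd (snd b) = \<mu>}"

lemma sector_param:
  assumes \<mu>: "\<mu> \<in> {1, -1}"
  shows "sector N \<mu> = (\<lambda>p. (2 * p - N, N - p, \<mu>)) ` {p. p \<le> N \<and> N \<le> 2 * p \<and> (\<mu> = 1 \<or> N \<noteq> 2 * p)}"
proof (intro set_eqI iffI)
  fix b assume "b \<in> sector N \<mu>"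
  then obtain l n where b: "b = (l, n, \<mu>)" "l + 2 * n = N" "(l, \<mu>) \<noteq> (0, -1)"
    by (auto simp: sector_def deg_def basis_index_def)
  then have "b = (2 * (n + l) - N, N - (n + l), \<mu>)" "n + l \<in> {p. p \<le> N \<and> N \<le> 2 * p \<and> (\<mu> = 1 \<or> N \<noteq> 2 * p)}"
    using \<mu> by auto
  then show "b \<in> (\<lambda>p. (2 * p - N, N - p, \<mu>)) ` {p. p \<le> N \<and> N \<le> 2 * p \<and> (\<mu> = 1 \<or> N \<noteq> 2 * p)}" by blast
next
  fix b assume "b \<in> (\<lambda>p. (2 * p - N, N - p, \<mu>)) ` {p. p \<le> N \<and> N \<le> 2 * p \<and> (\<mu> = 1 \<or> N \<noteq> 2 * p)}"
  then show "b \<in> sector N \<mu>" using \<mu> by (auto simp: sector_def deg_def basis_index_def)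
qed

lemma finite_sector: "\<mu> \<in> {1, -1} \<Longrightarrow> finite (sector N \<mu>)"
  unfolding sector_param by (rule finite_imageI, rule finite_subset[of _ "{..N}"]) auto

text \<open>A sector is the half \<open>N \<le> 2 * p\<close> of \<open>0, ..., N\<close>. Mirror
  symmetry supplies the other half, and \<open>eps\<close> counts the midpoint with weight one half;
  for \<open>\<mu> = -1\<close> the midpoint is absent from the sector, so \<open>F\<close> has to
  vanish there.\<close>

lemma half_sum:
  assumes \<mu>: "\<mu> \<in> {1, -1}" and F: "\<And>p. p \<le> N \<Longrightarrow> F (N - p) = F p" and F0: "\<mu> = -1 \<Longrightarrow> even N \<Longrightarrow> F (N div 2) = (0::real)"
  shows "(\<Sum>(l, n, \<nu>)\<in>sector N \<mu>. eps l * F (n + l)) = (\<Sum>p\<le>N. F p) / 2"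
proof -
  define hi where "hi = {p. p \<le> N \<and> N < 2 * p}"
  define mid where "mid = {p. p \<le> N \<and> N = 2 * p}"
  define lo where "lo = {p. p \<le> N \<and> 2 * p < N}"
  have fin: "finite hi" "finite mid" "finite lo" by (auto simp: hi_def mid_def lo_def)
  have "{..N} = hi \<union> (mid \<union> lo)" by (auto simp: hi_def mid_def lo_def)
  then have "(\<Sum>p\<le>N. F p) = sum F hi + (sum F mid + sum F lo)"
    using fin by (simp, subst sum.union_disjoint, auto simp: hi_def mid_def lo_def, subst sum.union_disjoint, auto)
  also have "sum F lo = sum F hi"
    by (rule sum.reindex_bij_witness[of _ "\<lambda>p. N - p" "\<lambda>p. N - p"]) (auto simp: hi_def lo_def F)
  finally have tot: "(\<Sum>p\<le>N. F p) = 2 * sum F hi + sum F mid" by simp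
  define J where "J = {p. p \<le> N \<and> N \<le> 2 * p \<and> (\<mu> = 1 \<or> N \<noteq> 2 * p)}"
  have inj: "inj_on (\<lambda>p. (2 * p - N, N - p, \<mu>)) J" by (auto simp: inj_on_def J_def)
  have "(\<Sum>(l, n, \<nu>)\<in>sector N \<mu>. eps l * F (n + l)) = (\<Sum>p\<in>J. eps (2 * p - N) * F (N - p + (2 * p - N)))"
    unfolding sector_param[OF \<mu>] J_def[symmetric] by (subst sum.reindex[OF inj]) simp
  also have "\<dots> = (\<Sum>p\<in>J. eps (2 * p - N) * F p)"
    by (intro sum.cong refl) (auto simp: J_def)
  also have "\<dots> = (\<Sum>p\<in>hi \<union> mid. eps (2 * p - N) * F p)"
    by (rule sum.mono_neutral_left) (use \<mu> F0 fin in \<open>auto simp: J_def hi_def mid_def\<close>)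
  also have "\<dots> = (\<Sum>p\<in>hi. eps (2 * p - N) * F p) + (\<Sum>p\<in>mid. eps (2 * p - N) * F p)"
    using fin by (subst sum.union_disjoint) (auto simp: hi_def mid_def)
  also have "(\<Sum>p\<in>hi. eps (2 * p - N) * F p) = sum F hi"
    by (intro sum.cong refl) (auto simp: hi_def eps_def)
  also have "(\<Sum>p\<in>mid. eps (2 * p - N) * F p) = sum F mid / 2"
    unfolding sum_divide_distrib by (intro sum.cong refl) (auto simp: mid_def eps_def)
  finally show ?thesis using tot by simp
qed

text \<open>Extends the values on a sector, which live on \<open>N \<le> 2 * p\<close>, to all \<open>p \<le> N\<close> with parity \<open>\<mu>\<close>
  under \<open>p \<mapsto> N - p\<close>; this undoes the identification of \<open>e\<^sup>i\<^sup>l\<^sup>\<theta>\<close> and \<open>e\<^sup>-\<^sup>i\<^sup>l\<^sup>\<theta>\<close> in real harmonics.\<close>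

definition ext :: "nat \<Rightarrow> int \<Rightarrow> (index \<Rightarrow> real) \<Rightarrow> nat \<Rightarrow> real" where
  "ext N \<mu> h p = (if N < 2 * p then h (2 * p - N, N - p, \<mu>)
     else if 2 * p = N then (if \<mu> = 1 then h (0, p, \<mu>) else 0)
     else of_int \<mu> * h (N - 2 * p, p, \<mu>))"

lemma ext_reflect:
  assumes \<mu>: "\<mu> \<in> {1, -1}" and p: "p \<le> N"
  shows "ext N \<mu> h (N - p) = of_int \<mu> * ext N \<mu> h p"
proof -
  have e: "2 * (N - p) - N = N - 2 * p" "N - 2 * (N - p) = 2 * p - N" "N - (N - p) = p"
    "N < 2 * (N - p) \<longleftrightarrow> 2 * p < N" "2 * (N - p) = N \<longleftrightarrow> 2 * p = N"
    using p by auto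
  show ?thesis
    unfolding ext_def e using \<mu> by auto
qed

lemma ext_index: "(l, n, \<mu>) \<in> basis_index \<Longrightarrow> ext (l + 2 * n) \<mu> h (n + l) = h (l, n, \<mu>)"
  by (cases "l = 0") (auto simp: ext_def basis_index_def)

text \<open>Parity under \<open>p -> N - p\<close> together with the values on the sector determines
  a vector; in the odd case parity forces the midpoint value 0.\<close>

lemma eq_ext:
  assumes \<mu>: "\<mu> \<in> {1, -1}" and \<phi>: "\<And>p. p \<le> N \<Longrightarrow> \<phi> (N - p) = of_int \<mu> * \<phi> p"
    and h: "\<And>l n. (l, n, \<mu>) \<in> basis_index \<Longrightarrow> l + 2 * n = N \<Longrightarrow> \<phi> (n + l) = h (l, n, \<mu>)"
    and p: "p \<le> N"
  shows "\<phi> p = ext N \<mu> h p"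
proof -
  have 1: "\<phi> p = ext N \<mu> h p" if "p \<le> N" "N < 2 * p" for p
    using h[of "2 * p - N" "N - p"] that \<mu> by (auto simp: ext_def basis_index_def)
  consider "N < 2 * p" | "2 * p = N" | "2 * p < N" by linarith
  then show ?thesis
  proof cases
    case 1
    then show ?thesis using p by (rule \<open>\<And>p. p \<le> N \<Longrightarrow> N < 2 * p \<Longrightarrow> \<phi> p = ext N \<mu> h p\<close>[rotated])
  next
    case 2
    then show ?thesis
      using h[of 0 p] \<phi>[OF p] \<mu> by (auto simp: ext_def basis_index_def)
  next
    case 3
    have "\<phi> p = of_int \<mu> * \<phi> (N - p)" using \<phi>[of "N - p"] p by simp
    also have "\<phi> (N - p) = ext N \<mu> h (N - p)" using 3 p by (intro 1) auto
    also have "of_int \<mu> * ext N \<mu> h (N - p) = ext N \<mu> h p" using ext_reflect[OF \<mu> p, of h] \<mu> by auto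
    finally show ?thesis .
  qed
qed

lemma nbr_reflect:
  assumes \<phi>: "\<And>p. p \<le> N \<Longrightarrow> \<phi> (N - p) = c * \<phi> p" and p: "p \<le> N"
  shows "nbr N \<phi> (N - p) = c * nbr N \<phi> p"
proof -
  have 1: "(if N - p = 0 then 0 else \<phi> (N - p - 1)) = c * (if p < N then \<phi> (p + 1) else 0)"
    using \<phi>[of "p + 1"] p by auto
  have 2: "(if N - p < N then \<phi> (N - p + 1) else 0) = c * (if p = 0 then 0 else \<phi> (p - 1))"
    using \<phi>[of "p - 1"] p by (cases p) (auto simp: Suc_diff_Suc)
  show ?thesis unfolding nbr_def 1 2 by (simp add: algebra_simps)
qed

text \<open>Moves the matrix from the functional \<open>E N\<close> of
  \<open>operator_entry_eq\<close> onto the vector of unknowns.\<close>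

lemma nbr_self_adjoint: "(\<Sum>p\<le>N. X p * nbr N Y p) = (\<Sum>p\<le>N. Y p * nbr N X p)"
proof (cases N)
  case (Suc M)
  have *: "(\<Sum>p\<le>Suc M. A p * nbr (Suc M) B p) = (\<Sum>p\<le>M. A (Suc p) * B p) + (\<Sum>p\<le>M. A p * B (Suc p))" for A B :: "nat \<Rightarrow> real"
  proof -
    have "(\<Sum>p\<le>Suc M. A p * nbr (Suc M) B p) = (\<Sum>p\<le>Suc M. A p * (if p = 0 then 0 else B (p - 1))) + (\<Sum>p\<le>Suc M. A p * (if p < Suc M then B (p + 1) else 0))"
      unfolding nbr_def distrib_left sum.distrib ..
    also have "(\<Sum>p\<le>Suc M. A p * (if p = 0 then 0 else B (p - 1))) = (\<Sum>p\<le>M. A (Suc p) * B p)"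
      by (simp add: sum.atMost_Suc_shift del: sum.atMost_Suc)
    also have "(\<Sum>p\<le>Suc M. A p * (if p < Suc M then B (p + 1) else 0)) = (\<Sum>p\<le>M. A p * B (Suc p))"
      by simp
    finally show ?thesis .
  qed
  show ?thesis unfolding Suc * by (simp add: mult.commute add.commute)
qed (simp add: nbr_def)

text \<open>Basis functions are \<open>dn a n\<close> times parts of disk polynomials, so these are
  the coefficients with respect to \<open>zern\<close>.\<close>

definition scaled :: "real \<Rightarrow> (index \<Rightarrow> real) \<Rightarrow> index \<Rightarrow> real" where
  "scaled a c = (\<lambda>(l, n, \<mu>). dn a n * c (l, n, \<mu>))"

lemma series_coeff_eps: "series_coeff c (l, n, \<mu>) = eps l * c (l, n, \<mu>)"
  by (simp add: series_coeff_def eps_def)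

lemma eig_commute: "eig a p q = eig a q p"
  by (simp add: eig_def mult_ac)

lemma eig_pos: "0 < a \<Longrightarrow> 0 < eig a p q"
  unfolding eig_def by (intro mult_pos_pos dn_pos) auto

text \<open>Only the sector of the row contributes, which gives finiteness. \<open>half_sum\<close>
  unfolds the sum to \<open>0, ..., N\<close>, self-adjointness transfers the matrix to the
  unknowns, and the functional \<open>E N\<close> then evaluates the result at its support.\<close>

lemma operator_row:
  assumes a: "0 < a" "a < 1" and b: "(l, n, \<mu>) \<in> basis_index"
  shows "finite (contributing (2 * a) (diagK k1 k2) (l, n, \<mu>))"
    and "(\<Sum>b'\<in>contributing (2 * a) (diagK k1 k2) (l, n, \<mu>). series_coeff c b' * operator_entry (2 * a) (diagK k1 k2) (l, n, \<mu>) b') =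
      eps l / dn a n * eig a (n + l) n * ((k1 + k2) / 2 * ext (l + 2 * n) \<mu> (scaled a c) (n + l) + (k1 - k2) / 2 / 2 * nbr (l + 2 * n) (ext (l + 2 * n) \<mu> (scaled a c)) (n + l))"
proof -
  define X where "X = ext (l + 2 * n) \<mu> (scaled a c)"
  define N where "N = l + 2 * n"
  have \<mu>: "\<mu> \<in> {1, -1}" using b by (simp add: basis_index_def)
  define E where "E = (\<lambda>N p. eig a p (N - p) * coef a (l, n, \<mu>) p (N - p))"
  define G where "G = (\<lambda>p. (k1 + k2) / 2 * E N p + (k1 - k2) / 2 / 2 * nbr N (E N) p)"
  have entry: "operator_entry (2 * a) (diagK k1 k2) (l, n, \<mu>) (l', n', \<mu>') = (if \<mu>' = \<mu> then dn a n' * ((k1 + k2) / 2 * E (l' + 2 * n') (n' + l') + (k1 - k2) / 2 / 2 * nbr (l' + 2 * n') (E (l' + 2 * n')) (n' + l')) else 0)"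
    if "(l', n', \<mu>') \<in> basis_index" for l' n' \<mu>'
    unfolding E_def by (rule operator_entry_eq[OF a b that])
  have E0: "E N' p = 0" if "N' \<noteq> N" "p \<le> N'" for N' p
  proof -
    have "\<not> (p = n + l \<and> N' - p = n)" "\<not> (p = n \<and> N' - p = n + l)"
      using that unfolding N_def by linarith+
    then show ?thesis by (simp only: E_def coef_def case_prod_conv of_bool_eq) simp
  qed
  have zero: "operator_entry (2 * a) (diagK k1 k2) (l, n, \<mu>) b' = 0" if "b' \<in> basis_index" "b' \<notin> sector N \<mu>" for b'
  proof -
    obtain l' n' \<mu>' where b': "b' = (l', n', \<mu>')" by (cases b') auto
    show ?thesis
    proof (cases "\<mu>' = \<mu>")
      case True
      then have "l' + 2 * n' \<noteq> N" using that by (auto simp: b' sector_def deg_def)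
      then show ?thesis using that unfolding b' by (simp add: entry nbr_def E0)
    qed (use that in \<open>simp add: b' entry\<close>)
  qed
  then have sub: "contributing (2 * a) (diagK k1 k2) (l, n, \<mu>) \<subseteq> sector N \<mu>" by (auto simp: contributing_def)
  then show "finite (contributing (2 * a) (diagK k1 k2) (l, n, \<mu>))" using finite_sector[OF \<mu>] by (rule finite_subset)
  have "(\<Sum>b'\<in>contributing (2 * a) (diagK k1 k2) (l, n, \<mu>). series_coeff c b' * operator_entry (2 * a) (diagK k1 k2) (l, n, \<mu>) b') =
    (\<Sum>b'\<in>sector N \<mu>. series_coeff c b' * operator_entry (2 * a) (diagK k1 k2) (l, n, \<mu>) b')"
    by (rule sum.mono_neutral_left[OF finite_sector[OF \<mu>] sub]) (auto simp: contributing_def sector_def)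
  also have "\<dots> = (\<Sum>(l', n', \<mu>')\<in>sector N \<mu>. eps l' * (X (n' + l') * G (n' + l')))"
  proof (intro sum.cong refl)
    fix b' assume b': "b' \<in> sector N \<mu>"
    obtain l' n' \<nu> where e': "b' = (l', n', \<nu>)" by (cases b') auto
    then have e: "b' = (l', n', \<mu>)" "l' + 2 * n' = N" "(l', n', \<mu>) \<in> basis_index"
      using b' by (auto simp: sector_def deg_def)
    have "X (n' + l') = dn a n' * c (l', n', \<mu>)"
      using ext_index[OF e(3), of "scaled a c"] e(2) by (simp add: X_def N_def scaled_def)
    then show "series_coeff c b' * operator_entry (2 * a) (diagK k1 k2) (l, n, \<mu>) b' = (case b' of (l', n', \<mu>') \<Rightarrow> eps l' * (X (n' + l') * G (n' + l')))"
      using e by (simp add: entry series_coeff_eps G_def)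
  qed
  also have "\<dots> = (\<Sum>p\<le>N. X p * G p) / 2"
  proof (rule half_sum[OF \<mu>])
    fix p assume p: "p \<le> N"
    have Er: "E N (N - p) = of_int \<mu> * E N p" if "p \<le> N" for p
      using that \<mu> eig_commute[of a p "N - p"] by (auto simp: E_def coef_def)
    have "G (N - p) = of_int \<mu> * G p"
      unfolding G_def nbr_reflect[of N "E N", OF Er p, simplified] Er[OF p] by (simp add: algebra_simps)
    moreover have "X (N - p) = of_int \<mu> * X p" unfolding X_def N_def[symmetric] by (rule ext_reflect[OF \<mu> p])
    ultimately show "X (N - p) * G (N - p) = X p * G p" using \<mu> by auto
  next
    assume "\<mu> = -1" "even N"
    then show "X (N div 2) * G (N div 2) = 0" by (simp add: X_def N_def[symmetric] ext_def)
  qed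
  also have "(\<Sum>p\<le>N. X p * G p) = (\<Sum>p\<le>N. E N p * ((k1 + k2) / 2 * X p + (k1 - k2) / 2 / 2 * nbr N X p))"
  proof -
    have "(\<Sum>p\<le>N. X p * G p) = (k1 + k2) / 2 * (\<Sum>p\<le>N. X p * E N p) + (k1 - k2) / 2 / 2 * (\<Sum>p\<le>N. X p * nbr N (E N) p)"
      by (simp add: G_def sum.distrib sum_distrib_left algebra_simps)
    also have "\<dots> = (\<Sum>p\<le>N. E N p * ((k1 + k2) / 2 * X p + (k1 - k2) / 2 / 2 * nbr N X p))"
      unfolding nbr_self_adjoint[of X N "E N"] by (simp add: sum.distrib sum_distrib_left algebra_simps)
    finally show ?thesis .
  qed
  \<comment> \<open>\<open>E N\<close> lives at the mirror points \<open>n + l\<close> and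
    \<open>n\<close>, which contribute equally by parity. The resulting 2 compensates the half from
    \<open>half_sum\<close>.\<close>
  also have "\<dots> = 2 * (eps l / dn a n * eig a (n + l) n * ((k1 + k2) / 2 * X (n + l) + (k1 - k2) / 2 / 2 * nbr N X (n + l)))"
  proof -
    define Y where "Y = (\<lambda>p. (k1 + k2) / 2 * X p + (k1 - k2) / 2 / 2 * nbr N X p)"
    have Xr: "X (N - p) = of_int \<mu> * X p" if "p \<le> N" for p
      unfolding X_def N_def[symmetric] by (rule ext_reflect[OF \<mu> that])
    have Y: "Y n = of_int \<mu> * Y (n + l)"
    proof -
      have n: "N - (n + l) = n" "n + l \<le> N" by (auto simp: N_def)
      show ?thesis using Xr[OF n(2)] nbr_reflect[of N X, OF Xr n(2)] unfolding Y_def n(1) by (simp add: algebra_simps)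
    qed
    have "(\<Sum>p\<le>N. E N p * Y p) = (\<Sum>p\<le>N. eps l / dn a n * (if p = n + l then eig a (n + l) n * Y (n + l) else 0) + eps l / dn a n * (if p = n then of_int \<mu> * (eig a n (n + l) * Y n) else 0))"
    proof (intro sum.cong refl)
      fix p assume "p \<in> {..N}"
      have "p = n + l \<and> N - p = n \<longleftrightarrow> p = n + l" "p = n \<and> N - p = n + l \<longleftrightarrow> p = n" by (auto simp: N_def)
      then show "E N p * Y p = eps l / dn a n * (if p = n + l then eig a (n + l) n * Y (n + l) else 0) + eps l / dn a n * (if p = n then of_int \<mu> * (eig a n (n + l) * Y n) else 0)"
        unfolding E_def coef_def by (auto simp: N_def algebra_simps)
    qed
    also have "\<dots> = eps l / dn a n * (eig a (n + l) n * Y (n + l)) + eps l / dn a n * (of_int \<mu> * (eig a n (n + l) * Y n))"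
      unfolding sum.distrib sum_distrib_left[symmetric] by (simp add: N_def)
    also have "\<dots> = 2 * (eps l / dn a n * eig a (n + l) n * Y (n + l))"
      unfolding Y eig_commute[of a n] using \<mu> by auto
    finally show ?thesis unfolding Y_def .
  qed
  finally show "(\<Sum>b'\<in>contributing (2 * a) (diagK k1 k2) (l, n, \<mu>). series_coeff c b' * operator_entry (2 * a) (diagK k1 k2) (l, n, \<mu>) b') =
      eps l / dn a n * eig a (n + l) n * ((k1 + k2) / 2 * ext (l + 2 * n) \<mu> (scaled a c) (n + l) + (k1 - k2) / 2 / 2 * nbr (l + 2 * n) (ext (l + 2 * n) \<mu> (scaled a c)) (n + l))"
    by (simp add: N_def X_def)
qed

text \<open>The data with the whole row factor of \<open>operator_row\<close>, including the
  eigenvalue, divided out; what remains on the left is the pure Toeplitz system.\<close>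

definition rhs :: "real \<Rightarrow> (real^2 \<Rightarrow> real) \<Rightarrow> index \<Rightarrow> real" where
  "rhs a f = (\<lambda>(l, n, \<mu>). basis_coeff (2 * a) f (l, n, \<mu>) * dn a n / (eps l * eig a (n + l) n))"

text \<open>The rows of a sector give the equations for \<open>N \<le> 2 * p\<close> only. Both
  sides have parity \<open>\<mu>\<close>, so the remaining equations are their mirror images and the
  full Toeplitz system may be solved instead.\<close>

lemma coefficients_agree_iff:
  assumes a: "0 < a" "a < 1"
  shows "coefficients_agree (2 * a) (diagK k1 k2) f c \<longleftrightarrow>
    (\<forall>N. \<forall>\<mu>\<in>{1, -1}. \<forall>p\<le>N. (k1 + k2) / 2 * ext N \<mu> (scaled a c) p + (k1 - k2) / 2 / 2 * nbr N (ext N \<mu> (scaled a c)) p = ext N \<mu> (rhs a f) p)"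
proof -
  define Y where "Y = (\<lambda>N \<mu> p. (k1 + k2) / 2 * ext N \<mu> (scaled a c) p + (k1 - k2) / 2 / 2 * nbr N (ext N \<mu> (scaled a c)) p)"
  have row: "finite (contributing (2 * a) (diagK k1 k2) (l, n, \<mu>))"
     "(\<Sum>b'\<in>contributing (2 * a) (diagK k1 k2) (l, n, \<mu>). series_coeff c b' * operator_entry (2 * a) (diagK k1 k2) (l, n, \<mu>) b') = eps l / dn a n * eig a (n + l) n * Y (l + 2 * n) \<mu> (n + l)"
    if "(l, n, \<mu>) \<in> basis_index" for l n \<mu>
    unfolding Y_def by (rule operator_row[OF a that])+
  have iff: "eps l / dn a n * eig a (n + l) n * y = basis_coeff (2 * a) f (l, n, \<mu>) \<longleftrightarrow> y = rhs a f (l, n, \<mu>)" for l n \<mu> y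
    using eps_pos[of l] dn_pos[of a n] eig_pos[of a "n + l" n] a by (auto simp: rhs_def field_simps)
  have "coefficients_agree (2 * a) (diagK k1 k2) f c \<longleftrightarrow> (\<forall>(l, n, \<mu>)\<in>basis_index. Y (l + 2 * n) \<mu> (n + l) = rhs a f (l, n, \<mu>))"
    unfolding coefficients_agree_def using row iff by fastforce
  also have "\<dots> \<longleftrightarrow> (\<forall>N. \<forall>\<mu>\<in>{1, -1}. \<forall>p\<le>N. Y N \<mu> p = ext N \<mu> (rhs a f) p)"
  proof (intro iffI allI ballI impI)
    fix N p :: nat and \<mu> assume H: "\<forall>(l, n, \<mu>)\<in>basis_index. Y (l + 2 * n) \<mu> (n + l) = rhs a f (l, n, \<mu>)"
      and \<mu>: "\<mu> \<in> {1, - 1 :: int}" and p: "p \<le> N"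
    show "Y N \<mu> p = ext N \<mu> (rhs a f) p"
    proof (rule eq_ext[OF \<mu> _ _ p])
      fix p assume p: "p \<le> N"
      note r = ext_reflect[OF \<mu>, of _ N "scaled a c"]
      show "Y N \<mu> (N - p) = of_int \<mu> * Y N \<mu> p"
        unfolding Y_def r[OF p] nbr_reflect[of N "ext N \<mu> (scaled a c)", OF r p, simplified] by (simp add: algebra_simps)
    next
      fix l n assume "(l, n, \<mu>) \<in> basis_index" "l + 2 * n = N"
      then show "Y N \<mu> (n + l) = rhs a f (l, n, \<mu>)" using H by auto
    qed
  next
    fix b assume H: "\<forall>N. \<forall>\<mu>\<in>{1, - 1}. \<forall>p\<le>N. Y N \<mu> p = ext N \<mu> (rhs a f) p" and b: "b \<in> basis_index"
    obtain l n \<mu> where e: "b = (l, n, \<mu>)" by (cases b) auto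
    have "\<mu> \<in> {1, -1}" using b by (simp add: e basis_index_def)
    then have "Y (l + 2 * n) \<mu> (n + l) = ext (l + 2 * n) \<mu> (rhs a f) (n + l)" using H by auto
    then show "case b of (l, n, \<mu>) \<Rightarrow> Y (l + 2 * n) \<mu> (n + l) = rhs a f (l, n, \<mu>)"
      using ext_index[of l n \<mu> "rhs a f"] b by (simp add: e)
  qed
  finally show ?thesis unfolding Y_def .
qed

lemma nbr_cong: "(\<And>p. p \<le> N \<Longrightarrow> X p = Y p) \<Longrightarrow> p \<le> N \<Longrightarrow> nbr N X p = nbr N Y p"
  by (auto simp: nbr_def)

lemma coefficients_exist:
  assumes a: "0 < a" "a < 1" and k: "0 < k1" "0 < k2"
  shows "\<exists>!c. c \<in> basis_index \<rightarrow>\<^sub>E (UNIV :: real set) \<and> coefficients_agree (2 * a) (diagK k1 k2) f c"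
proof -
  have kk: "\<bar>(k1 - k2) / 2\<bar> < (k1 + k2) / 2" using k unfolding abs_less_iff by (auto simp: field_simps)
  have "\<exists>c. c \<in> basis_index \<rightarrow>\<^sub>E (UNIV :: real set) \<and> coefficients_agree (2 * a) (diagK k1 k2) f c"
  proof -
    have "\<exists>X. \<forall>p\<le>N. (k1 + k2) / 2 * X p + (k1 - k2) / 2 / 2 * nbr N X p = ext N \<mu> (rhs a f) p" for N \<mu>
      by (rule tridiagonal_solvable[OF kk])
    then obtain X where X: "\<And>N \<mu> p. p \<le> N \<Longrightarrow> (k1 + k2) / 2 * X N \<mu> p + (k1 - k2) / 2 / 2 * nbr N (X N \<mu>) p = ext N \<mu> (rhs a f) p"
      by metis
    define c where "c = restrict (\<lambda>(l, n, \<mu>). X (l + 2 * n) \<mu> (n + l) / dn a n) basis_index"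
    have XE: "X N \<mu> p = ext N \<mu> (scaled a c) p" if \<mu>: "\<mu> \<in> {1, -1}" and p: "p \<le> N" for N \<mu> p
    proof (rule eq_ext[OF \<mu> _ _ p])
      fix p assume p: "p \<le> N"
      \<comment> \<open>The mirrored solution solves the same system, since the matrix commutes with
        reflection and the right-hand side has parity \<open>\<mu>\<close>. By uniqueness the
        solution has that parity too and therefore comes from real coefficients.\<close>
      have "of_int \<mu> * X N \<mu> (N - p) = X N \<mu> p"
      proof (rule tridiagonal_unique[OF kk _ X p])
        fix p assume p: "p \<le> N"
        define Z where "Z = (\<lambda>p. of_int \<mu> * X N \<mu> (N - p))"
        have "nbr N (X N \<mu>) (N - p) = of_int \<mu> * nbr N Z p"
        proof -
          have 1: "(if N - p = 0 then 0 else X N \<mu> (N - p - 1)) = of_int \<mu> * (if p < N then Z (p + 1) else 0)"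
            using \<mu> p by (auto simp: Z_def)
          have 2: "(if N - p < N then X N \<mu> (N - p + 1) else 0) = of_int \<mu> * (if p = 0 then 0 else Z (p - 1))"
            using \<mu> p by (cases p) (auto simp: Z_def Suc_diff_Suc)
          show ?thesis unfolding nbr_def 1 2 by (simp add: algebra_simps)
        qed
        moreover have "X N \<mu> (N - p) = of_int \<mu> * Z p" using \<mu> by (auto simp: Z_def)
        ultimately have "of_int \<mu> * ((k1 + k2) / 2 * Z p + (k1 - k2) / 2 / 2 * nbr N Z p) = of_int \<mu> * ext N \<mu> (rhs a f) p"
          using X[of "N - p" N \<mu>] ext_reflect[OF \<mu> p, of "rhs a f"] by (simp add: algebra_simps)
        then show "(k1 + k2) / 2 * (of_int \<mu> * X N \<mu> (N - p)) + (k1 - k2) / 2 / 2 * nbr N (\<lambda>p. of_int \<mu> * X N \<mu> (N - p)) p = ext N \<mu> (rhs a f) p"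
          using \<mu> unfolding Z_def by auto
      qed
      then show "X N \<mu> (N - p) = of_int \<mu> * X N \<mu> p" using \<mu> by auto
    next
      fix l n assume "(l, n, \<mu>) \<in> basis_index" "l + 2 * n = N"
      then show "X N \<mu> (n + l) = scaled a c (l, n, \<mu>)"
        using dn_pos[of a n] a by (auto simp: scaled_def c_def)
    qed
    have "coefficients_agree (2 * a) (diagK k1 k2) f c"
      unfolding coefficients_agree_iff[OF a]
    proof (intro allI ballI impI)
      fix N p :: nat and \<mu> :: int assume \<mu>: "\<mu> \<in> {1, -1}" and p: "p \<le> N"
      have 2: "nbr N (X N \<mu>) p = nbr N (ext N \<mu> (scaled a c)) p"
        by (rule nbr_cong[OF XE[OF \<mu>] p])
      show "(k1 + k2) / 2 * ext N \<mu> (scaled a c) p + (k1 - k2) / 2 / 2 * nbr N (ext N \<mu> (scaled a c)) p = ext N \<mu> (rhs a f) p"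
        using X[OF p, of \<mu>] unfolding 2 XE[OF \<mu> p] .
    qed
    then show ?thesis by (intro exI[of _ c]) (auto simp: c_def)
  qed
  moreover have "c = c'" if c: "c \<in> basis_index \<rightarrow>\<^sub>E (UNIV :: real set)" "coefficients_agree (2 * a) (diagK k1 k2) f c"
    and c': "c' \<in> basis_index \<rightarrow>\<^sub>E (UNIV :: real set)" "coefficients_agree (2 * a) (diagK k1 k2) f c'" for c c'
  proof (rule PiE_ext[OF c(1) c'(1)])
    fix b assume b: "b \<in> basis_index"
    obtain l n \<mu> where e: "b = (l, n, \<mu>)" by (cases b) auto
    have \<mu>: "\<mu> \<in> {1, -1}" using b by (simp add: e basis_index_def)
    define N where "N = l + 2 * n"
    have s: "(k1 + k2) / 2 * ext N \<mu> (scaled a d) p + (k1 - k2) / 2 / 2 * nbr N (ext N \<mu> (scaled a d)) p = ext N \<mu> (rhs a f) p"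
      if "coefficients_agree (2 * a) (diagK k1 k2) f d" "p \<le> N" for d p
      using that \<mu> unfolding coefficients_agree_iff[OF a] by blast
    have "ext N \<mu> (scaled a c) (n + l) = ext N \<mu> (scaled a c') (n + l)"
      by (rule tridiagonal_unique[OF kk s[OF c(2)] s[OF c'(2)]]) (simp_all add: N_def)
    then show "c b = c' b"
      using b dn_pos[of a n] a unfolding e N_def by (simp add: ext_index scaled_def)
  qed
  ultimately show ?thesis by blast
qed

section \<open>Convergence of the series\<close>

text \<open>Absorbing the weight into the measure turns the weighted space into an ordinary L2 over
  a finite measure, as \<open>riesz_fischer\<close> requires.\<close>

definition wmeas :: "real \<Rightarrow> (real^2) measure" where
  "wmeas a = density (lebesgue_on unit_disk) (\<lambda>x. ennreal (weight a x))"

lemma borel_measurable_lebesgue_on: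
  "f \<in> borel_measurable borel \<Longrightarrow> f \<in> borel_measurable (lebesgue_on unit_disk)"
  by (intro measurable_restrict_space1 measurable_completion) simp

lemma weight_measurable: "weight a \<in> borel_measurable (lebesgue_on unit_disk)"
  by (rule borel_measurable_lebesgue_on) (simp add: weight_def[abs_def])

lemma weight_nonneg: "0 \<le> weight a x"
  by (simp add: weight_def)

lemma finite_measure_wmeas:
  assumes "0 < a" shows "finite_measure (wmeas a)"
proof
  have "emeasure (wmeas a) (space (wmeas a)) = (\<integral>\<^sup>+x. ennreal (weight a x) \<partial>lebesgue_on unit_disk)"
    unfolding wmeas_def using weight_measurable
    by (subst emeasure_density) (auto intro!: nn_integral_cong simp: indicator_def space_restrict_space)
  also have "\<dots> \<le> (\<integral>\<^sup>+x. 1 \<partial>lebesgue_on unit_disk)"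
  proof (rule nn_integral_mono)
    fix x :: "real^2" assume "x \<in> space (lebesgue_on unit_disk)"
    then have "norm x < 1" by (simp add: space_restrict_space)
    then have "(norm x)\<^sup>2 \<le> 1" by (simp add: abs_square_le_1)
    then have "weight a x \<le> 1" unfolding weight_def using assms by (intro powr_le1) auto
    then show "ennreal (weight a x) \<le> 1" by (simp add: ennreal_le_1)
  qed
  also have "\<dots> = emeasure lborel (unit_disk)"
    by (simp add: space_restrict_space emeasure_restrict_space)
  also have "\<dots> < \<infinity>" by (rule emeasure_lborel_ball_finite)
  finally show "emeasure (wmeas a) (space (wmeas a)) \<noteq> \<infinity>" by simp
qed

lemma borel_measurable_wmeas: "borel_measurable (wmeas a) = borel_measurable (lebesgue_on unit_disk)"
  unfolding wmeas_def by (rule measurable_cong_sets) simp_all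

lemma l2_wmeas: "l2 (wmeas a) = weighted_L2 (2 * a)"
proof -
  have "integrable (wmeas a) (\<lambda>x. (g x)\<^sup>2) \<longleftrightarrow> integrable (lebesgue_on unit_disk) (\<lambda>x. weight a x * (g x)\<^sup>2)"
    if "g \<in> borel_measurable (lebesgue_on unit_disk)" for g
    unfolding wmeas_def using that weight_measurable weight_nonneg by (subst integrable_density) auto
  then show ?thesis
    unfolding l2_def weighted_L2_def borel_measurable_wmeas by auto
qed

lemma integral_wmeas:
  assumes "u \<in> l2 (wmeas a)" "v \<in> l2 (wmeas a)"
  shows "(\<integral>x. u x * v x \<partial>wmeas a) = weighted_inner (2 * a) u v"
proof -
  have "u \<in> borel_measurable (lebesgue_on unit_disk)" "v \<in> borel_measurable (lebesgue_on unit_disk)"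
    using assms by (auto simp: l2_def borel_measurable_wmeas)
  then show ?thesis
    unfolding wmeas_def weighted_inner_def using weight_measurable weight_nonneg
    by (subst integral_density) auto
qed

lemma basis_fun_l2:
  assumes a: "0 < a" shows "basis_fun (2 * a) b \<in> l2 (wmeas a)"
proof -
  obtain l n \<mu> where [simp]: "b = (l, n, \<mu>)" by (cases b) auto
  have b: "basis_fun (2 * a) b = (\<lambda>y. dn a n * part \<mu> (zern a (n + l) n (cz y)))"
    by (simp add: fun_eq_iff basis_fun_zern[OF a])
  have "(\<lambda>y. part \<mu> (zern a (n + l) n (cz y))) \<in> weighted_L2 (2 * a)"
    unfolding weighted_L2_def using part_zern_weighted_integrable[OF a, of \<mu> "n + l" n \<mu> "n + l" n]
      borel_measurable_lebesgue_on[OF part_zern_measurable]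
    by (simp add: power2_eq_square)
  then show ?thesis unfolding b l2_wmeas[symmetric] by (rule l2_cmult)
qed

lemma basis_square_integral: "0 < a \<Longrightarrow> b \<in> basis_index \<Longrightarrow> (\<integral>x. (basis_fun (2 * a) b x)\<^sup>2 \<partial>wmeas a) = basis_norm a b"
  by (simp add: power2_eq_square integral_wmeas basis_fun_l2 basis_inner)

lemma orthogonal_family_basis:
  assumes "0 < a" shows "orthogonal_family (wmeas a) (basis_fun (2 * a)) basis_index"
  by standard (use assms in \<open>auto simp: basis_fun_l2 integral_wmeas basis_inner\<close>)

text \<open>Consecutive quotients \<open>(Suc n + a) / Suc n\<close> exceed 1. This keeps the
  eigenvalues away from zero.\<close>

lemma dn_ge: assumes "0 < a" shows "dn a 0 \<le> dn a n"
proof (induction n)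
  case (Suc n)
  have "dn a n \<le> dn a n * ((real (Suc n) + a) / real (Suc n))"
    using dn_pos[of a n] assms by (intro mult_le_cancel_left1[THEN iffD2]) auto
  also have "\<dots> = dn a (Suc n)" by (simp add: dn_Suc[OF assms])
  finally show ?case using Suc.IH by linarith
qed simp

text \<open>Squares of vectors of either parity are mirror symmetric, so \<open>half_sum\<close>
  converts the \<open>eps\<close>-weighted energy of a sector into the Euclidean norm of
  \<open>tridiagonal_bound\<close>.\<close>

lemma sector_energy:
  assumes \<mu>: "\<mu> \<in> {1, -1}"
  shows "(\<Sum>(l, n, \<nu>)\<in>sector N \<mu>. eps l * (h (l, n, \<mu>))\<^sup>2) = (\<Sum>p\<le>N. (ext N \<mu> h p)\<^sup>2) / 2"
proof -
  have "(\<Sum>(l, n, \<nu>)\<in>sector N \<mu>. eps l * (h (l, n, \<mu>))\<^sup>2) = (\<Sum>(l, n, \<nu>)\<in>sector N \<mu>. eps l * (ext N \<mu> h (n + l))\<^sup>2)"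
  proof (intro sum.cong refl)
    fix b assume b: "b \<in> sector N \<mu>"
    obtain l n \<nu> where e: "b = (l, n, \<nu>)" by (cases b) auto
    with b have "\<nu> = \<mu>" "l + 2 * n = N" "(l, n, \<mu>) \<in> basis_index" by (auto simp: sector_def deg_def)
    then show "(case b of (l, n, \<nu>) \<Rightarrow> eps l * (h (l, n, \<mu>))\<^sup>2) = (case b of (l, n, \<nu>) \<Rightarrow> eps l * (ext N \<mu> h (n + l))\<^sup>2)"
      using ext_index[of l n \<mu> h] by (simp add: e)
  qed
  also have "\<dots> = (\<Sum>p\<le>N. (ext N \<mu> h p)\<^sup>2) / 2"
  proof (rule half_sum[OF \<mu>])
    fix p assume "p \<le> N"
    then show "(ext N \<mu> h (N - p))\<^sup>2 = (ext N \<mu> h p)\<^sup>2"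
      using ext_reflect[OF \<mu>, of p N h] \<mu> by (auto simp: power_mult_distrib)
  next
    assume "\<mu> = -1" "even N"
    then show "(ext N \<mu> h (N div 2))\<^sup>2 = 0" by (simp add: ext_def)
  qed
  finally show ?thesis .
qed

text \<open>The weights in \<open>basis_norm\<close> are reciprocal to the eigenvalues \<open>eig\<close> up to a factor depending
  on the degree alone, so the unweighted bound for the tridiagonal system survives the weights.\<close>

lemma sector_bound:
  assumes a: "0 < a" "a < 1" and k: "0 < k1" "0 < k2" and \<mu>: "\<mu> \<in> {1, -1}"
    and c: "coefficients_agree (2 * a) (diagK k1 k2) f c"
  defines "m \<equiv> (k1 + k2) / 2 - \<bar>(k1 - k2) / 2\<bar>"
  shows "(\<Sum>b\<in>sector N \<mu>. (series_coeff c b)\<^sup>2 * basis_norm a b) \<le>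
    1 / (m * 4 powr a * (dn a 0)\<^sup>2)\<^sup>2 * (\<Sum>b\<in>sector N \<mu>. (basis_coeff (2 * a) f b)\<^sup>2 * basis_norm a b)"
proof -
  have kk: "\<bar>(k1 - k2) / 2\<bar> < (k1 + k2) / 2" using k unfolding abs_less_iff by (auto simp: field_simps)
  then have m: "0 < m" by (simp add: m_def)
  define \<delta> where "\<delta> = dn a 0"
  have \<delta>: "0 < \<delta>" "\<delta> \<le> dn a n" for n using dn_pos[of a] dn_ge[OF a(1)] a by (auto simp: \<delta>_def)
  have \<delta>2: "\<delta>\<^sup>2 \<le> dn a p * dn a q" for p q
    unfolding power2_eq_square using \<delta> by (intro mult_mono) (auto intro: less_imp_le order_less_le_trans)
  \<comment> \<open>The part of \<open>zern_norm\<close> that depends on the degree alone and is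
    therefore constant on the sector.\<close>
  define C where "C = pi / (real N + a + 1)"
  have C: "0 < C" using a by (simp add: C_def)
  define w where "w = (\<lambda>(l, n, \<nu> :: int). eps l * (scaled a c (l, n, \<mu>))\<^sup>2 :: real)"
  define r where "r = (\<lambda>(l, n, \<nu> :: int). eps l * (rhs a f (l, n, \<mu>))\<^sup>2 :: real)"
  have N: "zern_norm a (n + l) n = C / (dn a (n + l) * dn a n)" if "l + 2 * n = N" for l n
    using that by (auto simp: zern_norm_def C_def)
  have dp: "0 < dn a n" for n using dn_pos[of a n] a by simp
  have left: "(series_coeff c b)\<^sup>2 * basis_norm a b \<le> C / (2 * \<delta>\<^sup>2) * w b" if b: "b \<in> sector N \<mu>" for b
  proof -
    obtain l n \<nu> where e: "b = (l, n, \<nu>)" by (cases b) auto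
    with b have e: "b = (l, n, \<mu>)" "l + 2 * n = N" by (auto simp: sector_def deg_def)
    have "(series_coeff c b)\<^sup>2 * basis_norm a b = C / (2 * (dn a (n + l) * dn a n)) * w b"
      unfolding e(1) series_coeff_eps basis_norm_def w_def scaled_def case_prod_conv N[OF e(2)] using eps_pos[of l] dp[of n] dp[of "n + l"]
      by (simp add: power2_eq_square field_simps)
    also have "\<dots> \<le> C / (2 * \<delta>\<^sup>2) * w b"
    proof (rule mult_right_mono)
      show "C / (2 * (dn a (n + l) * dn a n)) \<le> C / (2 * \<delta>\<^sup>2)"
        using C \<delta>(1) \<delta>2[of "n + l" n] by (intro divide_left_mono) (auto simp: dp)
      show "0 \<le> w b" using eps_pos[of l] by (simp add: w_def e)
    qed
    finally show ?thesis .
  qed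
  have right: "r b \<le> 2 / (C * (4 powr a)\<^sup>2 * \<delta>\<^sup>2) * ((basis_coeff (2 * a) f b)\<^sup>2 * basis_norm a b)" if b: "b \<in> sector N \<mu>" for b
  proof -
    obtain l n \<nu> where e: "b = (l, n, \<nu>)" by (cases b) auto
    with b have e: "b = (l, n, \<mu>)" "l + 2 * n = N" by (auto simp: sector_def deg_def)
    define P where "P = (4::real) powr a"
    have P: "0 < P" by (simp add: P_def)
    have "r b = 2 / (C * P\<^sup>2 * (dn a (n + l) * dn a n)) * ((basis_coeff (2 * a) f b)\<^sup>2 * basis_norm a b)"
      unfolding e(1) basis_norm_def r_def rhs_def eig_def P_def[symmetric] case_prod_conv N[OF e(2)]
      using eps_pos[of l] dp[of n] dp[of "n + l"] C P
      by (simp add: power2_eq_square field_simps)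
    also have "\<dots> \<le> 2 / (C * P\<^sup>2 * \<delta>\<^sup>2) * ((basis_coeff (2 * a) f b)\<^sup>2 * basis_norm a b)"
    proof (rule mult_right_mono)
      show "2 / (C * P\<^sup>2 * (dn a (n + l) * dn a n)) \<le> 2 / (C * P\<^sup>2 * \<delta>\<^sup>2)"
        using C P \<delta>(1) \<delta>2[of "n + l" n] by (intro divide_left_mono mult_left_mono) (auto simp: dp)
      show "0 \<le> (basis_coeff (2 * a) f b)\<^sup>2 * basis_norm a b" using basis_norm_pos[OF a(1), of b] by simp
    qed
    finally show ?thesis unfolding P_def .
  qed
  have bound: "m\<^sup>2 * sum w (sector N \<mu>) \<le> sum r (sector N \<mu>)"
  proof -
    have 1: "sum w (sector N \<mu>) = (\<Sum>p\<le>N. (ext N \<mu> (scaled a c) p)\<^sup>2) / 2"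
      unfolding w_def by (rule sector_energy[OF \<mu>])
    have 2: "sum r (sector N \<mu>) = (\<Sum>p\<le>N. (ext N \<mu> (rhs a f) p)\<^sup>2) / 2"
      unfolding r_def by (rule sector_energy[OF \<mu>])
    have 3: "m\<^sup>2 * (\<Sum>p\<le>N. (ext N \<mu> (scaled a c) p)\<^sup>2) \<le> (\<Sum>p\<le>N. (ext N \<mu> (rhs a f) p)\<^sup>2)"
      unfolding m_def using c \<mu> unfolding coefficients_agree_iff[OF a]
      by (intro tridiagonal_bound[OF kk]) auto
    show ?thesis unfolding 1 2 using 3 by simp
  qed
  have "(\<Sum>b\<in>sector N \<mu>. (series_coeff c b)\<^sup>2 * basis_norm a b) \<le> C / (2 * \<delta>\<^sup>2) * sum w (sector N \<mu>)"
    unfolding sum_distrib_left by (intro sum_mono left)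
  also have "\<dots> \<le> C / (2 * \<delta>\<^sup>2) * (sum r (sector N \<mu>) / m\<^sup>2)"
    using bound m C \<delta>(1) by (intro mult_left_mono) (auto simp: field_simps)
  also have "\<dots> \<le> C / (2 * \<delta>\<^sup>2) * ((2 / (C * (4 powr a)\<^sup>2 * \<delta>\<^sup>2) * (\<Sum>b\<in>sector N \<mu>. (basis_coeff (2 * a) f b)\<^sup>2 * basis_norm a b)) / m\<^sup>2)"
    using C m \<delta>(1) unfolding sum_distrib_left by (intro mult_left_mono divide_right_mono sum_mono right) auto
  \<comment> \<open>\<open>C\<close> enters \<open>left\<close> as a factor and \<open>right\<close>
    as a divisor and cancels, so the constant is the same for every degree.\<close>
  also have "\<dots> = 1 / (m * 4 powr a * \<delta>\<^sup>2)\<^sup>2 * (\<Sum>b\<in>sector N \<mu>. (basis_coeff (2 * a) f b)\<^sup>2 * basis_norm a b)"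
    using C m \<delta>(1) by (simp add: power2_eq_square field_simps)
  finally show ?thesis unfolding \<delta>_def .
qed

text \<open>The constant of \<open>sector_bound\<close> is uniform, so a partial sum, enlarged to
  full sectors, is controlled by the corresponding partial sum for \<open>f\<close>, and that by
  Bessel's inequality.\<close>

lemma coefficients_summable:
  assumes a: "0 < a" "a < 1" and k: "0 < k1" "0 < k2" and f: "f \<in> weighted_L2 (2 * a)"
    and c: "coefficients_agree (2 * a) (diagK k1 k2) f c"
  shows "(\<lambda>b. (series_coeff c b)\<^sup>2 * basis_norm a b) summable_on basis_index"
proof -
  let ?n = "\<lambda>b. \<integral>x. (basis_fun (2 * a) b x)\<^sup>2 \<partial>wmeas a"
  interpret orthogonal_family "wmeas a" "basis_fun (2 * a)" basis_index
    by (rule orthogonal_family_basis[OF a(1)])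
  have fl2: "f \<in> l2 (wmeas a)" using f by (simp add: l2_wmeas)
  define B where "B = 1 / (((k1 + k2) / 2 - \<bar>(k1 - k2) / 2\<bar>) * 4 powr a * (dn a 0)\<^sup>2)\<^sup>2"
  have B: "0 \<le> B" by (simp add: B_def)
  define U where "U = (\<lambda>M. \<Union>(N, \<mu>)\<in>{..M} \<times> {1, -1}. sector N \<mu>)"
  have nn: "0 \<le> (series_coeff c b)\<^sup>2 * basis_norm a b" for b
    using basis_norm_pos[OF a(1), of b] by simp
  have disj: "sector N \<mu> \<inter> sector N' \<mu>' = {}" if "(N, \<mu>) \<noteq> (N', \<mu>')" for N \<mu> N' \<mu>'
    using that by (auto simp: sector_def)
  have U: "finite (U M)" "U M \<subseteq> basis_index" for M
  proof -
    show "finite (U M)" unfolding U_def by (intro finite_UN_I) (auto intro: finite_sector)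
    show "U M \<subseteq> basis_index" unfolding U_def by (auto simp: sector_def)
  qed
  have sumU: "sum h (U M) = (\<Sum>(N, \<mu>)\<in>{..M} \<times> {1, -1}. sum h (sector N \<mu>))" for h :: "index \<Rightarrow> real" and M
    unfolding U_def by (subst sum.UNION_disjoint) (use disj in \<open>auto intro!: finite_sector simp: case_prod_unfold\<close>)
  have "sum (\<lambda>b. (series_coeff c b)\<^sup>2 * basis_norm a b) T \<le> B * (\<integral>x. (f x)\<^sup>2 \<partial>wmeas a)"
    if T: "finite T" "T \<subseteq> basis_index" for T
  proof -
    define M where "M = Max (deg ` T)"
    have "T \<subseteq> U M"
    proof
      fix b assume b: "b \<in> T"
      then have "deg b \<le> M" using T by (simp add: M_def)
      moreover have "snd (snd b) \<in> {1, -1}" using b T by (auto simp: basis_index_def)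
      ultimately show "b \<in> U M" using b T unfolding U_def by (auto simp: sector_def)
    qed
    then have "sum (\<lambda>b. (series_coeff c b)\<^sup>2 * basis_norm a b) T \<le> sum (\<lambda>b. (series_coeff c b)\<^sup>2 * basis_norm a b) (U M)"
      by (intro sum_mono2 U(1) nn)
    also have "\<dots> \<le> (\<Sum>(N, \<mu>)\<in>{..M} \<times> {1, -1}. B * (\<Sum>b\<in>sector N \<mu>. (basis_coeff (2 * a) f b)\<^sup>2 * basis_norm a b))"
      unfolding sumU B_def by (intro sum_mono) (use sector_bound[OF a k _ c] in auto)
    also have "\<dots> = B * (\<Sum>b\<in>U M. (basis_coeff (2 * a) f b)\<^sup>2 * basis_norm a b)"
      unfolding sumU by (simp add: sum_distrib_left case_prod_unfold)
    also have "(\<Sum>b\<in>U M. (basis_coeff (2 * a) f b)\<^sup>2 * basis_norm a b) = (\<Sum>b\<in>U M. ((\<integral>x. f x * basis_fun (2 * a) b x \<partial>wmeas a) / (?n b))\<^sup>2 * (?n b))"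
    proof (intro sum.cong refl)
      fix b assume "b \<in> U M"
      then have b: "b \<in> basis_index" using U by blast
      show "(basis_coeff (2 * a) f b)\<^sup>2 * basis_norm a b = ((\<integral>x. f x * basis_fun (2 * a) b x \<partial>wmeas a) / (?n b))\<^sup>2 * (?n b)"
        unfolding basis_square_integral[OF a(1) b] integral_wmeas[OF fl2 basis_fun_l2[OF a(1)]] basis_coeff_def basis_inner[OF a(1) b b] by simp
    qed
    also have "B * \<dots> \<le> B * (\<integral>x. (f x)\<^sup>2 \<partial>wmeas a)"
      by (intro mult_left_mono bessel U fl2 B)
    finally show ?thesis .
  qed
  then show ?thesis
    by (intro nonneg_bdd_above_summable_on bdd_aboveI2[where M = "B * (\<integral>x. (f x)\<^sup>2 \<partial>wmeas a)"] nn) auto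
qed

lemma series_limit_exists:
  assumes a: "0 < a" and c: "(\<lambda>b. (series_coeff c b)\<^sup>2 * basis_norm a b) summable_on basis_index"
  shows "\<exists>u\<in>weighted_L2 (2 * a). series_converges_to (2 * a) c u"
proof -
  let ?s = "\<lambda>S x. \<Sum>b\<in>S. series_coeff c b * basis_fun (2 * a) b x"
  interpret orthogonal_family "wmeas a" "basis_fun (2 * a)" basis_index
    by (rule orthogonal_family_basis[OF a])
  have "countable basis_index" by simp
  then have "\<exists>u\<in>l2 (wmeas a). ((\<lambda>S. \<integral>x. (u x - (?s S x))\<^sup>2 \<partial>wmeas a) \<longlongrightarrow> 0) (finite_subsets_at_top basis_index)"
    by (intro riesz_fischer finite_measure_wmeas a \<open>countable basis_index\<close>) (use c in \<open>simp add: basis_square_integral[OF a] cong: summable_on_cong\<close>)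
  then obtain u where u: "u \<in> l2 (wmeas a)"
    and lim: "((\<lambda>S. \<integral>x. (u x - (?s S x))\<^sup>2 \<partial>wmeas a) \<longlongrightarrow> 0) (finite_subsets_at_top basis_index)"
    by blast
  have wi: "weighted_inner (2 * a) (\<lambda>x. u x - (?s S x)) (\<lambda>x. u x - (?s S x)) =
      (\<integral>x. (u x - (?s S x))\<^sup>2 \<partial>wmeas a)" for S
    unfolding power2_eq_square by (intro integral_wmeas[symmetric] l2_diff u l2_sum basis_fun_l2 a)
  have "series_converges_to (2 * a) c u"
    unfolding series_converges_to_def Let_def wi by (rule lim)
  then show ?thesis using u unfolding l2_wmeas by blast
qed

text \<open>Uniqueness is purely algebraic, block by block, among all coefficient families. That the
  family so determined represents a function of the weighted space rests on the bound uniform in the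
  degree.\<close>

theorem theorem4p1:
  fixes \<alpha> k1 k2 :: real and K :: "real^2 \<Rightarrow> real^2^2" and f :: "real^2 \<Rightarrow> real"
  assumes "0 < \<alpha>" and "\<alpha> < 2"
    and "0 < k1" and "0 < k2"
    and "K = (\<lambda>x. vector [vector [k1, 0], vector [0, k2]])"
    and "f \<in> weighted_L2 \<alpha>"
  shows "(\<exists>!c. c \<in> basis_index \<rightarrow>\<^sub>E (UNIV :: real set) \<and> coefficients_agree \<alpha> K f c) \<and>
         (\<exists>c \<in> basis_index \<rightarrow>\<^sub>E (UNIV :: real set). coefficients_agree \<alpha> K f c \<and>
            (\<exists>u \<in> weighted_L2 \<alpha>. series_converges_to \<alpha> c u))"
proof -
  define a where "a = \<alpha> / 2"
  have \<alpha>: "\<alpha> = 2 * a" and a: "0 < a" "a < 1" using assms(1,2) by (auto simp: a_def)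
  have K: "K = diagK k1 k2" unfolding assms(5) diagK_def ..
  have f: "f \<in> weighted_L2 (2 * a)" using assms(6) by (simp add: \<alpha>)
  have ex: "\<exists>!c. c \<in> basis_index \<rightarrow>\<^sub>E (UNIV :: real set) \<and> coefficients_agree (2 * a) (diagK k1 k2) f c"
    by (rule coefficients_exist[OF a assms(3,4)])
  then obtain c where c: "c \<in> basis_index \<rightarrow>\<^sub>E (UNIV :: real set)" "coefficients_agree (2 * a) (diagK k1 k2) f c" by blast
  have "\<exists>u \<in> weighted_L2 (2 * a). series_converges_to (2 * a) c u"
    by (intro series_limit_exists[OF a(1)] coefficients_summable[OF a assms(3,4) f c(2)])
  then show ?thesis unfolding \<alpha> K using ex c by blast
qed

end
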